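(* Let $M\in\mathcal{HD}_{2,\mathbb{R}}$ and $T_t=e^{tA_M}$. Let $d^M\in L^2_{\mathrm{loc}}[0,\infty)$ be such that $\mathcal{L}[d^M](z)=1/(zM(z))$ (for $\mathrm{Re}\,z$ sufficiently large), and set $d^M_t(x)=1_{(0,t]}(x)d^M(t-x)$ for $t>0$. Then $\{d^M_t\}_{t>0}$ is an imaginary additive cocycle for the pair $(\{S_t\},\{T_t\})$. Every imaginary additive cocycle for $(\{S_t\},\{T_t\})$ is a scalar multiple of $\{d^M_t\}_{t>0}$.
   Context: Notation: $\mathbb{H}_r=\{z\in\mathbb{C}:\mathrm{Re}\,z>0\}$ with Hardy space $H^2(\mathbb{H}_r)$; $\mathcal{L}[f](z)=\int_0^\infty f(x)e^{-zx}dx$ (for $\mathrm{Re}\,z$ large enough); $(f,g)=\int_0^\infty f(x)g(x)dx$ (bilinear); $L^2_{\mathrm{loc}}[0,\infty)$ is the set of measurable functions square integrable on compact subsets of $[0,\infty)$; $L^2(0,t)_{\mathbb{R}}$, $0<t\le\infty$, is the real Hilbert space of real functions in $L^2(0,t)$, viewed inside $L^2(0,\infty)_{\mathbb{R}}$; $\{S_t\}$ is the shift semigroup $(S_tf)(x)=1_{[t,\infty)}(x)f(x-t)$. $\mathcal{HD}$ is the set of holomorphic functions $M$ on $\mathbb{H}_r$ with $M(z)/(1+z)\in H^2(\mathbb{H}_r)$ and $M\notin H^2(\mathbb{H}_r)$. For $M\in\mathcal{HD}$ let $q\in L^2(0,\infty)$ satisfy $\mathcal{L}[q](z)=M(z)/(1+z)$;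 $A_M$ is the operator $A_Mf=-f'$ whose domain is the set of locally absolutely continuous $f\in L^2(0,\infty)$ with $f'\in L^2(0,\infty)$ and $(f-f',q)=0$. $\mathcal{HD}_2$ is the set of $M\in\mathcal{HD}$ such that $A_M$ generates a $C_0$-semigroup and $e^{tA_M}-S_t$ is Hilbert–Schmidt for all $t\ge0$. $\mathcal{HD}_{2,\mathbb{R}}$ is the set of $M\in\mathcal{HD}_2$ with $\overline{M(z)}=M(\overline z)$. For such $M$, $T_t=e^{tA_M}$ preserves $L^2(0,\infty)_{\mathbb{R}}$ and $T_t^*S_t=1$. An imaginary additive cocycle for $(\{S_t\},\{T_t\})$ is a measurable family $\{d_t\}_{t>0}$ in $L^2(0,\infty)_{\mathbb{R}}$ with $d_t\in L^2(0,t)_{\mathbb{R}}$ for all $t>0$ and $d_{s+t}=d_s+T_sd_t$ for all $s,t>0$. It is known that a function $d^M$ as in the claim exists. *)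

theory Defs
  imports "HOL-Analysis.Analysis" "HOL-Complex_Analysis.Complex_Analysis"
begin

text \<open>
  Elements of \<open>L\<^sup>2(0,\<infinity>)\<close> are represented by functions \<open>real \<Rightarrow> complex\<close>, of which only the
  restriction to \<open>(0,\<infinity>)\<close> matters, and equality in \<open>L\<^sup>2(0,\<infinity>)\<close> is written \<open>ae_eq\<close>. Operators on
  \<open>L\<^sup>2(0,\<infinity>)\<close> are maps on such representatives. Operators that are linear and bounded in the sense
  of \<open>L2_operator\<close> respect \<open>ae_eq\<close>.
\<close>

section \<open>The spaces of square integrable functions\<close>

abbreviation halfline :: "real measure" where
  "halfline \<equiv> lebesgue_on {0<..}"

definition ae_eq :: "(real \<Rightarrow> complex) \<Rightarrow> (real \<Rightarrow> complex) \<Rightarrow> bool" where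
  "ae_eq f g \<longleftrightarrow> (AE x in halfline. f x = g x)"

definition L2 :: "(real \<Rightarrow> complex) set" where
  "L2 = {f \<in> borel_measurable halfline. integrable halfline (\<lambda>x. (cmod (f x))\<^sup>2)}"

definition L2_norm :: "(real \<Rightarrow> complex) \<Rightarrow> real" where
  "L2_norm f = sqrt (LINT x|halfline. (cmod (f x))\<^sup>2)"

definition L2_inner :: "(real \<Rightarrow> complex) \<Rightarrow> (real \<Rightarrow> complex) \<Rightarrow> complex" where
  "L2_inner f g = (LINT x|halfline. f x * cnj (g x))"

definition pairing :: "(real \<Rightarrow> complex) \<Rightarrow> (real \<Rightarrow> complex) \<Rightarrow> complex" where
  "pairing f g = (LINT x|halfline. f x * g x)"

definition L2_real :: "(real \<Rightarrow> complex) set" where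
  "L2_real = {f \<in> L2. AE x in halfline. f x \<in> \<real>}"

text \<open>\<open>L\<^sup>2(0,t)\<^sub>\<real>\<close>, viewed inside \<open>L\<^sup>2(0,\<infinity>)\<^sub>\<real>\<close> by extension by zero.\<close>

definition L2_real_upto :: "real \<Rightarrow> (real \<Rightarrow> complex) set" where
  "L2_real_upto t = {f \<in> L2_real. AE x in halfline. t \<le> x \<longrightarrow> f x = 0}"

definition L2_loc :: "(real \<Rightarrow> complex) set" where
  "L2_loc = {f \<in> borel_measurable (lebesgue_on {0..}).
     \<forall>K. compact K \<and> K \<subseteq> {0..} \<longrightarrow> integrable (lebesgue_on K) (\<lambda>x. (cmod (f x))\<^sup>2)}"

definition L2_open :: "(real \<Rightarrow> complex) set \<Rightarrow> bool" where
  "L2_open U \<longleftrightarrow> U \<subseteq> L2 \<and>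
     (\<forall>f\<in>U. \<exists>r>0. \<forall>g\<in>L2. L2_norm (\<lambda>x. g x - f x) < r \<longrightarrow> g \<in> U)"

section \<open>Hardy space and Laplace transform\<close>

definition Hr :: "complex set" where
  "Hr = {z. 0 < Re z}"

definition hardy_H2 :: "(complex \<Rightarrow> complex) set" where
  "hardy_H2 = {F. F holomorphic_on Hr \<and>
     (SUP x\<in>{0<..}. \<integral>\<^sup>+ y. ennreal ((cmod (F (Complex x y)))\<^sup>2) \<partial>lborel) < \<infinity>}"

text \<open>The Laplace integral of \<open>f\<close> at \<open>z\<close> converges absolutely, with value \<open>w\<close>.\<close>

definition has_laplace :: "(real \<Rightarrow> complex) \<Rightarrow> complex \<Rightarrow> complex \<Rightarrow> bool" where
  "has_laplace f z w \<longleftrightarrow>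
     integrable halfline (\<lambda>x. f x * exp (- z * of_real x)) \<and>
     (LINT x|halfline. f x * exp (- z * of_real x)) = w"

section \<open>Operators and semigroups\<close>

definition L2_operator :: "((real \<Rightarrow> complex) \<Rightarrow> (real \<Rightarrow> complex)) \<Rightarrow> bool" where
  "L2_operator K \<longleftrightarrow>
     (\<forall>f\<in>L2. K f \<in> L2) \<and>
     (\<forall>f\<in>L2. \<forall>g\<in>L2. ae_eq (K (\<lambda>x. f x + g x)) (\<lambda>x. K f x + K g x)) \<and>
     (\<forall>c. \<forall>f\<in>L2. ae_eq (K (\<lambda>x. c * f x)) (\<lambda>x. c * K f x)) \<and>
     (\<exists>C. \<forall>f\<in>L2. L2_norm (K f) \<le> C * L2_norm f)"

definition L2_orthonormal_basis :: "(nat \<Rightarrow> real \<Rightarrow> complex) \<Rightarrow> bool" where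
  "L2_orthonormal_basis e \<longleftrightarrow>
     (\<forall>n. e n \<in> L2) \<and>
     (\<forall>m n. L2_inner (e m) (e n) = (if m = n then 1 else 0)) \<and>
     (\<forall>f\<in>L2. (\<forall>n. L2_inner f (e n) = 0) \<longrightarrow> ae_eq f (\<lambda>x. 0))"

definition hilbert_schmidt :: "((real \<Rightarrow> complex) \<Rightarrow> (real \<Rightarrow> complex)) \<Rightarrow> bool" where
  "hilbert_schmidt K \<longleftrightarrow> L2_operator K \<and>
     (\<exists>e. L2_orthonormal_basis e \<and> summable (\<lambda>n. (L2_norm (K (e n)))\<^sup>2))"

definition C0_semigroup :: "(real \<Rightarrow> (real \<Rightarrow> complex) \<Rightarrow> (real \<Rightarrow> complex)) \<Rightarrow> bool" where
  "C0_semigroup T \<longleftrightarrow>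
     (\<forall>t\<ge>0. L2_operator (T t)) \<and>
     (\<forall>f\<in>L2. ae_eq (T 0 f) f) \<and>
     (\<forall>s\<ge>0. \<forall>t\<ge>0. \<forall>f\<in>L2. ae_eq (T (s + t) f) (T s (T t f))) \<and>
     (\<forall>f\<in>L2. ((\<lambda>t. L2_norm (\<lambda>x. T t f x - f x)) \<longlongrightarrow> 0) (at_right 0))"

text \<open>Unbounded operators are given by their graphs, which are closed under \<open>ae_eq\<close>.\<close>

definition generator ::
  "(real \<Rightarrow> (real \<Rightarrow> complex) \<Rightarrow> (real \<Rightarrow> complex)) \<Rightarrow> ((real \<Rightarrow> complex) \<times> (real \<Rightarrow> complex)) set"
  where
  "generator T = {(f, g). f \<in> L2 \<and> g \<in> L2 \<and>
     ((\<lambda>t. L2_norm (\<lambda>x. (T t f x - f x) / of_real t - g x)) \<longlongrightarrow> 0) (at_right 0)}"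

definition shift :: "real \<Rightarrow> (real \<Rightarrow> complex) \<Rightarrow> (real \<Rightarrow> complex)" where
  "shift t f = (\<lambda>x. if t \<le> x then f (x - t) else 0)"

section \<open>The operators \<open>A\<^sub>M\<close>\<close>

definition absolutely_cont_on :: "real set \<Rightarrow> (real \<Rightarrow> complex) \<Rightarrow> bool" where
  "absolutely_cont_on S f \<longleftrightarrow>
     (\<forall>\<epsilon>>0. \<exists>\<delta>>0. \<forall>D. D division_of \<Union>D \<and> \<Union>D \<subseteq> S \<and> (\<Sum>I\<in>D. Sup I - Inf I) < \<delta>
        \<longrightarrow> (\<Sum>I\<in>D. cmod (f (Sup I) - f (Inf I))) < \<epsilon>)"

text \<open>\<open>f\<close> has a locally absolutely continuous representative on \<open>[0,\<infinity>)\<close>, with derivative \<open>f'\<close>.\<close>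

definition loc_abs_cont_deriv :: "(real \<Rightarrow> complex) \<Rightarrow> (real \<Rightarrow> complex) \<Rightarrow> bool" where
  "loc_abs_cont_deriv f f' \<longleftrightarrow> (\<exists>h. ae_eq f h \<and>
     (\<forall>b>0. absolutely_cont_on {0..b} h) \<and>
     (AE x in halfline. (h has_vector_derivative f' x) (at x)))"

text \<open>
  The function \<open>q\<close> in the definition of \<open>A\<^sub>M\<close> exists for \<open>M \<in> HD\<close> by the Paley-Wiener theorem, and
  it is unique up to \<open>ae_eq\<close>.
\<close>

definition A_graph :: "(complex \<Rightarrow> complex) \<Rightarrow> ((real \<Rightarrow> complex) \<times> (real \<Rightarrow> complex)) set" where
  "A_graph M = {(f, g). \<exists>f' q.
     q \<in> L2 \<and> (\<forall>z\<in>Hr. has_laplace q z (M z / (1 + z))) \<and>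
     f \<in> L2 \<and> f' \<in> L2 \<and> loc_abs_cont_deriv f f' \<and>
     pairing (\<lambda>x. f x - f' x) q = 0 \<and>
     g \<in> L2 \<and> ae_eq g (\<lambda>x. - f' x)}"

definition HD :: "(complex \<Rightarrow> complex) set" where
  "HD = {M. M holomorphic_on Hr \<and> (\<lambda>z. M z / (1 + z)) \<in> hardy_H2 \<and> M \<notin> hardy_H2}"

text \<open>
  \<open>T\<^sub>t = e\<^bsup>tA\<^esup>\<close> with \<open>A = A\<^sub>M\<close>. Since a generator determines its semigroup, \<open>T t f\<close> is unique up to
  \<open>ae_eq\<close> for \<open>t \<ge> 0\<close> and \<open>f \<in> L2\<close>.
\<close>

definition is_exp_A :: "(complex \<Rightarrow> complex) \<Rightarrow> (real \<Rightarrow> (real \<Rightarrow> complex) \<Rightarrow> (real \<Rightarrow> complex)) \<Rightarrow> bool"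
  where
  "is_exp_A M T \<longleftrightarrow> C0_semigroup T \<and> generator T = A_graph M"

definition HD2 :: "(complex \<Rightarrow> complex) set" where
  "HD2 = {M \<in> HD. \<exists>T. is_exp_A M T \<and>
     (\<forall>t\<ge>0. hilbert_schmidt (\<lambda>f x. T t f x - shift t f x))}"

definition HD2_real :: "(complex \<Rightarrow> complex) set" where
  "HD2_real = {M \<in> HD2. \<forall>z\<in>Hr. cnj (M z) = M (cnj z)}"

section \<open>Cocycles\<close>

text \<open>
  Measurability of \<open>t \<mapsto> d t\<close> is Borel measurability as a map from \<open>(0,\<infinity>)\<close> to \<open>L\<^sup>2(0,\<infinity>)\<close> with its
  norm topology. The shift semigroup enters through \<open>L\<^sup>2(0,t)\<close>, the kernel of the adjoint of
  \<open>shift t\<close>.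
\<close>

definition imaginary_additive_cocycle ::
  "(real \<Rightarrow> (real \<Rightarrow> complex) \<Rightarrow> (real \<Rightarrow> complex)) \<Rightarrow> (real \<Rightarrow> real \<Rightarrow> complex) \<Rightarrow> bool" where
  "imaginary_additive_cocycle T d \<longleftrightarrow>
     (\<forall>U. L2_open U \<longrightarrow> {t \<in> {0<..}. d t \<in> U} \<in> sets borel) \<and>
     (\<forall>t>0. d t \<in> L2_real_upto t) \<and>
     (\<forall>s>0. \<forall>t>0. ae_eq (d (s + t)) (\<lambda>x. d s x + T s (d t) x))"

definition reflected_family :: "(real \<Rightarrow> complex) \<Rightarrow> real \<Rightarrow> real \<Rightarrow> complex" where
  "reflected_family d t = (\<lambda>x. indicator {0<..t} x * d (t - x))"

end

theory Submission
  imports Defs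
begin

text \<open>
  Three facts about \<open>T\<^sub>t = e\<^bsup>tA\<^esup>\<close>, with \<open>A = A\<^sub>M\<close>, carry the proof. Let \<open>*\<close> be the convolution of functions
  supported in \<open>(0,\<infinity>)\<close>.

  First, \<open>A f = -f'\<close> generates a motion to the right: \<open>T\<^sub>t f\<close> is the shift of \<open>f\<close> by \<open>t\<close> plus a function
  supported in \<open>(0,t)\<close> (\<open>left_shift\<close>). For \<open>f\<close> in the domain of \<open>A\<close> the integral of \<open>T\<^sub>t f\<close> over the moving
  interval \<open>(t + a, t + b]\<close> is continuous in \<open>t\<close> with vanishing right derivative, hence constant.

  Second, the boundary condition \<open>(f - f', q) = 0\<close> reads \<open>(f + A f, q) = 0\<close>, so \<open>q\<close> is an eigenvector of the
  adjoint of \<open>A\<close>, and \<open>(T\<^sub>t f, q) = e\<^bsup>-t\<^esup> (f, q)\<close> (\<open>eigenfunctional\<close>).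

  Third, \<open>d\<^sup>M\<close> and \<open>q\<close> are related by \<open>d\<^sup>M * q = 1 - e\<^bsup>-t\<^esup>\<close>, since the Laplace transforms multiply to
  \<open>1/(z M(z)) \<cdot> M(z)/(1 + z) = 1/(z (1 + z))\<close>. This is \<open>(d\<^sup>M\<^sub>t, q) = 1 - e\<^bsup>-t\<^esup>\<close>. It also shows that convolution
  with \<open>q\<close> is injective: if \<open>Z * q = 0\<close> then \<open>Z * (1 - e\<^bsup>-t\<^esup>) = 0\<close>, and hence \<open>Z = 0\<close> (\<open>conv_injective\<close>).

  The first two facts hold on the domain of \<open>A\<close> and extend to \<open>L\<^sup>2\<close> because the domain is dense. Density is
  not a formality here, and it is again explained by \<open>d\<^sup>M\<close>: for \<open>J = 1 * 1 * d\<^sup>M\<close> the function \<open>J(s - x)\<close> violates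
  the boundary condition by \<open>s\<^sup>2/2\<close> although its norm is \<open>o(s\<^sup>2)\<close>, so that smooth functions can be corrected
  at arbitrarily small cost (\<open>boundary_correction\<close>).

  Now consider a family \<open>R\<^sub>s\<close> with \<open>R\<^sub>s\<close> supported in \<open>(0,s)\<close>, with \<open>R\<^sub>S(x + S - s) = R\<^sub>s(x)\<close> and with \<open>(R\<^sub>s, q) = 0\<close>.
  Shift compatibility says that \<open>R\<^sub>s(x) = Z(s - x)\<close> for one function \<open>Z\<close>, and then \<open>(Z * q)(s) = (R\<^sub>s, q) = 0\<close> gives
  \<open>Z = 0\<close> (\<open>shift_compatible_family_eq_0\<close>). Both halves of the theorem are instances. For
  \<open>R\<^sub>s = T\<^sub>s d\<^sup>M\<^sub>t - d\<^sup>M\<^sub>s\<^sub>+\<^sub>t + d\<^sup>M\<^sub>s\<close> the pairing with \<open>q\<close> is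
  \<open>e\<^bsup>-s\<^esup> (1 - e\<^bsup>-t\<^esup>) - (1 - e\<^bsup>-s-t\<^esup>) + (1 - e\<^bsup>-s\<^esup>) = 0\<close>, which is the cocycle identity. For an arbitrary cocycle \<open>d\<close>,
  the function \<open>p(t) = (d\<^sub>t, q)\<close> satisfies \<open>p(s + t) = p(s) + e\<^bsup>-s\<^esup> p(t)\<close>; exchanging \<open>s\<close> and \<open>t\<close> shows
  \<open>p(t) = c (1 - e\<^bsup>-t\<^esup>)\<close>, and \<open>R\<^sub>s = d\<^sub>s - c d\<^sup>M\<^sub>s\<close> qualifies.

  Elements of \<open>L\<^sup>2(0,\<infinity>)\<close> are replaced by Borel functions on \<open>\<real>\<close> vanishing on \<open>(-\<infinity>,0]\<close> whenever Fubini's theorem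
  is applied, since \<open>(x, t) \<mapsto> f(t - x)\<close> is measurable for the product \<open>\<sigma>\<close>-algebra only if \<open>f\<close> is Borel.
\<close>

section \<open>Square integrable functions\<close>

text \<open>The measure is a parameter because the same estimates are used for \<open>halfline\<close>, on which the
  problem is posed, and for \<open>lborel\<close>, on which convolutions are computed.\<close>

definition square_integrable :: "real measure \<Rightarrow> (real \<Rightarrow> complex) \<Rightarrow> bool" where
  "square_integrable M f \<longleftrightarrow> f \<in> borel_measurable M \<and> integrable M (\<lambda>x. (cmod (f x))\<^sup>2)"

definition norm2 :: "real measure \<Rightarrow> (real \<Rightarrow> complex) \<Rightarrow> real" where
  "norm2 M f = sqrt (LINT x|M. (cmod (f x))\<^sup>2)"

lemma L2_iff: "f \<in> L2 \<longleftrightarrow> square_integrable halfline f"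
  by (simp add: L2_def square_integrable_def)

lemma L2_norm_eq: "L2_norm f = norm2 halfline f"
  by (simp add: L2_norm_def norm2_def)

lemma norm2_nonneg [simp]: "0 \<le> norm2 M f"
  by (simp add: norm2_def)

lemma norm2_sq: "(norm2 M f)\<^sup>2 = (LINT x|M. (cmod (f x))\<^sup>2)"
  by (simp add: norm2_def)

lemma square_integrable_measurable [dest, measurable_dest]:
  "square_integrable M f \<Longrightarrow> f \<in> borel_measurable M"
  by (simp add: square_integrable_def)

lemma square_integrable_cmult:
  assumes "square_integrable M f" shows "square_integrable M (\<lambda>x. c * f x)"
  using assms by (auto simp: square_integrable_def norm_mult power_mult_distrib)

lemma norm2_cmult: "norm2 M (\<lambda>x. c * f x) = cmod c * norm2 M f"
  by (simp add: norm2_def norm_mult power_mult_distrib real_sqrt_mult)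

lemma square_integrable_dominated:
  assumes "square_integrable M f" "g \<in> borel_measurable M" "AE x in M. cmod (g x) \<le> cmod (f x)"
  shows "square_integrable M g" "norm2 M g \<le> norm2 M f"
proof -
  have le: "AE x in M. (cmod (g x))\<^sup>2 \<le> (cmod (f x))\<^sup>2"
    using assms(3) by eventually_elim (simp add: power_mono)
  have f: "integrable M (\<lambda>x. (cmod (f x))\<^sup>2)" using assms(1) by (simp add: square_integrable_def)
  have g: "integrable M (\<lambda>x. (cmod (g x))\<^sup>2)"
    by (rule Bochner_Integration.integrable_bound[OF f]) (use assms(2) le in auto)
  then show "square_integrable M g" using assms(2) by (simp add: square_integrable_def)
  show "norm2 M g \<le> norm2 M f"
    unfolding norm2_def using integral_mono_AE[OF g f le] by simp
qed

lemma norm2_cong_AE: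
  assumes "f \<in> borel_measurable M" "g \<in> borel_measurable M" "AE x in M. f x = g x"
  shows "norm2 M f = norm2 M g"
  unfolding norm2_def
  by (rule arg_cong[where f = sqrt], rule integral_cong_AE) (use assms in auto)

text \<open>The elementary bound \<open>2|ab| \<le> |a|\<^sup>2 + |b|\<^sup>2\<close> gives integrability, and the Cauchy-Schwarz
  inequality for nonnegative functions gives the estimate.\<close>

lemma Cauchy_Schwarz_integral:
  assumes f: "square_integrable M f" and g: "square_integrable M g"
  shows "integrable M (\<lambda>x. f x * g x)"
    and "integrable M (\<lambda>x. cmod (f x) * cmod (g x))"
    and "(LINT x|M. cmod (f x) * cmod (g x)) \<le> norm2 M f * norm2 M g"
    and "cmod (LINT x|M. f x * g x) \<le> norm2 M f * norm2 M g"
proof -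
  have f2: "integrable M (\<lambda>x. (cmod (f x))\<^sup>2)" and g2: "integrable M (\<lambda>x. (cmod (g x))\<^sup>2)"
    and [measurable]: "f \<in> borel_measurable M" "g \<in> borel_measurable M"
    using f g by (auto simp: square_integrable_def)
  have ab: "\<bar>cmod (f x) * cmod (g x)\<bar> \<le> (cmod (f x))\<^sup>2 + (cmod (g x))\<^sup>2" for x
  proof -
    have "0 \<le> cmod (f x) * cmod (g x)" by simp
    then show ?thesis using sum_squares_bound[of "cmod (f x)" "cmod (g x)"] by linarith
  qed
  show i: "integrable M (\<lambda>x. cmod (f x) * cmod (g x))"
    by (rule Bochner_Integration.integrable_bound[OF Bochner_Integration.integrable_add[OF f2 g2]])
      (use ab in auto)
  show i': "integrable M (\<lambda>x. f x * g x)"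
    by (rule Bochner_Integration.integrable_bound[OF i]) (auto simp: norm_mult)
  let ?I = "LINT x|M. cmod (f x) * cmod (g x)"
  have "(\<integral>\<^sup>+x. ennreal (cmod (f x)) * ennreal (cmod (g x)) \<partial>M)\<^sup>2
      \<le> (\<integral>\<^sup>+x. (ennreal (cmod (f x)))\<^sup>2 \<partial>M) * (\<integral>\<^sup>+x. (ennreal (cmod (g x)))\<^sup>2 \<partial>M)"
    by (rule Cauchy_Schwarz_nn_integral) auto
  then have "(ennreal ?I)\<^sup>2 \<le> ennreal ((norm2 M f)\<^sup>2) * ennreal ((norm2 M g)\<^sup>2)"
    using i f2 g2 by (simp add: norm2_sq nn_integral_eq_integral ennreal_mult[symmetric] ennreal_power)
  then have "?I\<^sup>2 \<le> (norm2 M f * norm2 M g)\<^sup>2"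
    by (simp add: ennreal_mult[symmetric] ennreal_power power_mult_distrib)
  then show le: "?I \<le> norm2 M f * norm2 M g"
    by (rule power2_le_imp_le) simp
  have "cmod (LINT x|M. f x * g x) \<le> (LINT x|M. cmod (f x * g x))" by (rule integral_norm_bound)
  then show "cmod (LINT x|M. f x * g x) \<le> norm2 M f * norm2 M g"
    using le by (simp add: norm_mult)
qed

lemma square_integrable_add:
  assumes f: "square_integrable M f" and g: "square_integrable M g"
  shows "square_integrable M (\<lambda>x. f x + g x)" and norm2_triangle: "norm2 M (\<lambda>x. f x + g x) \<le> norm2 M f + norm2 M g"
proof -
  have f2: "integrable M (\<lambda>x. (cmod (f x))\<^sup>2)" and g2: "integrable M (\<lambda>x. (cmod (g x))\<^sup>2)"
    and [measurable]: "f \<in> borel_measurable M" "g \<in> borel_measurable M"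
    using f g by (auto simp: square_integrable_def)
  note fg = Cauchy_Schwarz_integral(2,3)[OF f g]
  let ?u = "\<lambda>x. (cmod (f x))\<^sup>2 + (cmod (g x))\<^sup>2 + 2 * (cmod (f x) * cmod (g x))"
  have u: "integrable M ?u" by (intro Bochner_Integration.integrable_add f2 g2 integrable_mult_right fg)
  have le: "(cmod (f x + g x))\<^sup>2 \<le> ?u x" for x
    using power_mono[OF norm_triangle_ineq[of "f x" "g x"], of 2] by (simp add: power2_sum)
  have s: "integrable M (\<lambda>x. (cmod (f x + g x))\<^sup>2)"
    by (rule Bochner_Integration.integrable_bound[OF u]) (use le in \<open>auto intro: order_trans[OF _ abs_ge_self]\<close>)
  then show "square_integrable M (\<lambda>x. f x + g x)" by (simp add: square_integrable_def)
  have "(norm2 M (\<lambda>x. f x + g x))\<^sup>2 \<le> (LINT x|M. ?u x)"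
    unfolding norm2_sq by (rule integral_mono[OF s u le])
  also have "\<dots> = (norm2 M f)\<^sup>2 + (norm2 M g)\<^sup>2 + 2 * (LINT x|M. cmod (f x) * cmod (g x))"
    using f2 g2 fg(1) by (simp add: norm2_sq)
  also have "\<dots> \<le> (norm2 M f + norm2 M g)\<^sup>2" using fg(2) by (simp add: power2_sum)
  finally show "norm2 M (\<lambda>x. f x + g x) \<le> norm2 M f + norm2 M g"
    by (rule power2_le_imp_le) simp
qed

lemma square_integrable_diff:
  assumes f: "square_integrable M f" and g: "square_integrable M g"
  shows "square_integrable M (\<lambda>x. f x - g x)" and "norm2 M (\<lambda>x. f x - g x) \<le> norm2 M f + norm2 M g"
  using square_integrable_add[OF f square_integrable_cmult[OF g, of "-1"]]
    norm2_triangle[OF f square_integrable_cmult[OF g, of "-1"]] norm2_cmult[of M "-1" g] by auto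

lemma norm2_minus_commute: "norm2 M (\<lambda>x. f x - g x) = norm2 M (\<lambda>x. g x - f x)"
  by (simp add: norm2_def norm_minus_commute)

lemma norm2_diff_triangle:
  assumes "square_integrable M f" "square_integrable M g" "square_integrable M h"
  shows "norm2 M (\<lambda>x. f x - h x) \<le> norm2 M (\<lambda>x. f x - g x) + norm2 M (\<lambda>x. g x - h x)"
  using norm2_triangle[OF square_integrable_diff(1)[OF assms(1,2)] square_integrable_diff(1)[OF assms(2,3)]]
  by simp

lemma norm2_eq_0_iff:
  assumes "square_integrable M f"
  shows "norm2 M f = 0 \<longleftrightarrow> (AE x in M. f x = 0)"
  using assms integral_nonneg_eq_0_iff_AE[of M "\<lambda>x. (cmod (f x))\<^sup>2"]
  by (simp add: norm2_def square_integrable_def)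

lemma square_integrable_bounded_support:
  assumes "f \<in> borel_measurable lborel" "\<And>x. cmod (f x) \<le> B" "\<And>x. x \<notin> {a..b} \<Longrightarrow> f x = 0"
  shows "square_integrable lborel f"
proof -
  have "integrable lborel (\<lambda>x. indicator {a..b} x * B\<^sup>2)"
    by (intro integrable_mult_left integrable_real_indicator) (auto simp: emeasure_lborel_Icc_eq)
  then have "integrable lborel (\<lambda>x. (cmod (f x))\<^sup>2)"
    by (rule Bochner_Integration.integrable_bound)
      (use assms in \<open>auto simp: indicator_def intro!: power_mono\<close>)
  then show ?thesis using assms(1) by (simp add: square_integrable_def)
qed

lemma norm2_tendsto_0_dominated:
  assumes "\<And>n. F n \<in> borel_measurable M" "f \<in> borel_measurable M" "square_integrable M w"
    and "AE x in M. (\<lambda>n. F n x) \<longlonglongrightarrow> f x" "\<And>n. AE x in M. cmod (F n x - f x) \<le> cmod (w x)"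
  shows "(\<lambda>n. norm2 M (\<lambda>x. F n x - f x)) \<longlonglongrightarrow> 0"
proof -
  have "(\<lambda>n. LINT x|M. (cmod (F n x - f x))\<^sup>2) \<longlonglongrightarrow> (LINT x|M. 0)"
  proof (rule integral_dominated_convergence)
    show "integrable M (\<lambda>x. (cmod (w x))\<^sup>2)" using assms(3) by (simp add: square_integrable_def)
    show "AE x in M. (\<lambda>n. (cmod (F n x - f x))\<^sup>2) \<longlonglongrightarrow> 0"
      using assms(4)
    proof eventually_elim
      case (elim x)
      then have "(\<lambda>n. (cmod (F n x - f x))\<^sup>2) \<longlonglongrightarrow> (cmod (f x - f x))\<^sup>2"
        by (intro tendsto_intros)
      then show ?case by simp
    qed
    show "AE x in M. norm ((cmod (F n x - f x))\<^sup>2) \<le> (cmod (w x))\<^sup>2" for n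
      using assms(5)[of n] by eventually_elim (simp add: power_mono)
  qed (use assms(1,2) in auto)
  then show ?thesis unfolding norm2_def using tendsto_real_sqrt by fastforce
qed

text \<open>Step functions are dense: simple functions are, and sets of finite measure are reached from intervals by
  the \<open>\<pi>\<close>-\<open>\<lambda>\<close> theorem.\<close>

lemma square_integrable_induct [consumes 1, case_names interval add cmult limit]:
  fixes P :: "(real \<Rightarrow> complex) \<Rightarrow> bool"
  assumes f: "square_integrable lborel f"
    and int: "\<And>a b. a \<le> b \<Longrightarrow> P (indicator {a<..b})"
    and add: "\<And>f g. square_integrable lborel f \<Longrightarrow> square_integrable lborel g \<Longrightarrow> P f \<Longrightarrow> P g \<Longrightarrow> P (\<lambda>x. f x + g x)"
    and cm: "\<And>f c. square_integrable lborel f \<Longrightarrow> P f \<Longrightarrow> P (\<lambda>x. c * f x)"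
    and lim: "\<And>F f. \<lbrakk>\<And>n::nat. square_integrable lborel (F n); \<And>n. P (F n); square_integrable lborel f;
        (\<lambda>n. norm2 lborel (\<lambda>x. F n x - f x)) \<longlonglongrightarrow> 0\<rbrakk> \<Longrightarrow> P f"
  shows "P f"
proof -
  have sq_ind: "square_integrable lborel (indicator A)" if "A \<in> sets borel" "emeasure lborel A < \<infinity>" for A
  proof -
    have "(\<lambda>x. (cmod (indicator A x))\<^sup>2) = (indicator A :: real \<Rightarrow> real)"
      by (auto simp: indicator_def)
    then show ?thesis using that by (simp add: square_integrable_def)
  qed
  have sqb: "square_integrable lborel (indicator (A \<inter> {a<..b}))" if "A \<in> sets borel" for A a b
    by (rule square_integrable_bounded_support[of _ 1 a b]) (use that in \<open>auto simp: indicator_def\<close>)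
  have zero': "P (indicator {})" using int[of 0 0] by simp
  then have zero: "P (\<lambda>x. 0)" by (simp add: indicator_def[abs_def])
  \<comment> \<open>bounded Borel sets, by the \<open>\<pi>\<close>-\<open>\<lambda>\<close> theorem\<close>
  have bdd: "P (indicator (A \<inter> {a<..b}))" if "A \<in> sets borel" "a \<le> b" for A a b
  proof -
    have "A \<in> sigma_sets UNIV (range (\<lambda>(a::real,b). {a<..b}))"
      using that(1) by (simp add: borel_sigma_sets_Ioc)
    then show ?thesis
    proof (rule sigma_sets_induct_disjoint[where P = "\<lambda>A. P (indicator (A \<inter> {a<..b}))", rotated 2])
      show "Int_stable (range (\<lambda>(a::real, b). {a<..b}))"
        by (auto simp: Int_stable_def)
      show "range (\<lambda>(a::real, b). {a<..b}) \<subseteq> Pow UNIV" by simp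
      fix A :: "real set" assume "A \<in> range (\<lambda>(a, b). {a<..b})"
      then obtain c d where A: "A = {c<..d}" by auto
      have "A \<inter> {a<..b} = {max a c<..max (max a c) (min b d)}" using A by auto
      then show "P (indicator (A \<inter> {a<..b}))" using int[of "max a c" "max (max a c) (min b d)"] by simp
    next
      show "P (indicator ({} \<inter> {a<..b}))" using zero' by simp
    next
      fix A :: "real set" assume A: "A \<in> sigma_sets UNIV (range (\<lambda>(a::real,b). {a<..b}))"
        and PA: "P (indicator (A \<inter> {a<..b}))"
      then have [measurable]: "A \<in> sets borel" by (simp add: borel_sigma_sets_Ioc)
      have "(indicator ((UNIV - A) \<inter> {a<..b}) :: real \<Rightarrow> complex) = (\<lambda>x. indicator {a<..b} x + (-1) * indicator (A \<inter> {a<..b}) x)"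
        by (auto simp: indicator_def)
      moreover have "P (\<lambda>x. indicator {a<..b} x + (-1) * indicator (A \<inter> {a<..b}) x)"
      proof (rule add)
        show "square_integrable lborel (indicator {a<..b} :: real \<Rightarrow> complex)"
          using sqb[of UNIV a b] by simp
        show "square_integrable lborel (\<lambda>x. (-1) * indicator (A \<inter> {a<..b}) x :: complex)"
          by (rule square_integrable_cmult[OF sqb]) fact
        show "P (\<lambda>x. (-1) * indicator (A \<inter> {a<..b}) x)"
          by (rule cm[OF sqb PA]) fact
      qed (rule int[OF \<open>a \<le> b\<close>])
      ultimately show "P (indicator ((UNIV - A) \<inter> {a<..b}))" by simp
    next
      fix A :: "nat \<Rightarrow> real set" assume dj: "disjoint_family A"
        and A: "range A \<subseteq> sigma_sets UNIV (range (\<lambda>(a::real,b). {a<..b}))"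
        and PA: "\<And>i. P (indicator (A i \<inter> {a<..b}))"
      then have [measurable]: "A i \<in> sets borel" for i by (auto simp: borel_sigma_sets_Ioc)
      let ?F = "\<lambda>n. indicator (\<Union>i<n. A i \<inter> {a<..b}) :: real \<Rightarrow> complex"
      have Feq: "?F (Suc n) = (\<lambda>x. ?F n x + indicator (A n \<inter> {a<..b}) x)" for n
      proof
        fix x
        have "x \<notin> A i" if "i < n" "x \<in> A n" for i
          using dj that unfolding disjoint_family_on_def by (metis IntI UNIV_I emptyE nat_neq_iff)
        then show "?F (Suc n) x = ?F n x + indicator (A n \<inter> {a<..b}) x"
          by (cases "x \<in> A n") (auto simp: indicator_def less_Suc_eq)
      qed
      have Fsq: "square_integrable lborel (?F n)" for n
        by (rule square_integrable_bounded_support[of _ 1 a b]) (auto simp: indicator_def)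
      have FP: "P (?F n)" for n
      proof (induction n)
        case 0 show ?case using zero by simp
      next
        case (Suc n) show ?case unfolding Feq by (rule add[OF Fsq sqb Suc PA]) auto
      qed
      show "P (indicator (\<Union> (range A) \<inter> {a<..b}))"
      proof (rule lim[OF Fsq FP])
        show "square_integrable lborel (indicator (\<Union> (range A) \<inter> {a<..b}) :: real \<Rightarrow> complex)" by (rule sqb) auto
        show "(\<lambda>n. norm2 lborel (\<lambda>x. ?F n x - indicator (\<Union> (range A) \<inter> {a<..b}) x)) \<longlonglongrightarrow> 0"
        proof (rule norm2_tendsto_0_dominated)
          show "square_integrable lborel (indicator {a<..b} :: real \<Rightarrow> complex)" using sqb[of UNIV a b] by simp
          have "(\<lambda>n. ?F n x) \<longlonglongrightarrow> indicator (\<Union> (range A) \<inter> {a<..b}) x" for x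
          proof (cases "x \<in> \<Union> (range A) \<inter> {a<..b}")
            case True
            then obtain i where "x \<in> A i" "x \<in> {a<..b}" by auto
            then have "\<forall>\<^sub>F n in sequentially. ?F n x = 1"
              by (intro eventually_mono[OF eventually_gt_at_top[of i]]) (auto simp: indicator_def)
            then have "(\<lambda>n. ?F n x) \<longlonglongrightarrow> 1" by (rule tendsto_eventually)
            then show ?thesis using True by (simp add: indicator_def)
          qed (auto simp: indicator_def)
          then show "AE x in lborel. (\<lambda>n. ?F n x) \<longlonglongrightarrow> indicator (\<Union> (range A) \<inter> {a<..b}) x" by simp
        qed (auto simp: indicator_def)
      qed
    qed
  qed
  \<comment> \<open>sets of finite measure\<close>
  have fin: "P (indicator A)" if A: "A \<in> sets borel" "emeasure lborel A < \<infinity>" for A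
  proof (rule lim[of "\<lambda>n. indicator (A \<inter> {- real n<..real n})"])
    show "square_integrable lborel (indicator A :: real \<Rightarrow> complex)" by (rule sq_ind[OF that])
    show "(\<lambda>n. norm2 lborel (\<lambda>x. indicator (A \<inter> {- real n<..real n}) x - indicator A x)) \<longlonglongrightarrow> 0"
    proof (rule norm2_tendsto_0_dominated[OF _ _ sq_ind[OF that]])
      have "(\<lambda>n. indicator (A \<inter> {- real n<..real n}) x) \<longlonglongrightarrow> (indicator A x :: complex)" for x
      proof (rule tendsto_eventually)
        have "\<forall>\<^sub>F n in sequentially. \<bar>x\<bar> < real n"
          using filterlim_real_sequentially by (simp add: filterlim_at_top_dense)
        then show "\<forall>\<^sub>F n in sequentially. indicator (A \<inter> {- real n<..real n}) x = (indicator A x :: complex)"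
          by eventually_elim (auto simp: indicator_def)
      qed
      then show "AE x in lborel. (\<lambda>n. indicator (A \<inter> {- real n<..real n}) x) \<longlonglongrightarrow> (indicator A x :: complex)" by simp
    qed (use A in \<open>auto simp: indicator_def\<close>)
  qed (use bdd sqb A in auto)
  have fm: "f \<in> borel_measurable lborel" using f by auto
  obtain F where F: "\<And>i::nat. simple_function lborel (F i)" "\<And>x. (\<lambda>i. F i x) \<longlonglongrightarrow> f x"
    "\<And>i x. cmod (F i x) \<le> 2 * cmod (f x)"
    using borel_measurable_implies_sequence_metric[OF fm, of 0] by (auto simp: dist_norm)
  have Fsq: "square_integrable lborel (F i)" for i
    by (rule square_integrable_dominated(1)[OF square_integrable_cmult[OF f, of 2]])
      (use F(3) borel_measurable_simple_function[OF F(1)] in \<open>auto simp: norm_mult\<close>)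
  show ?thesis
  proof (rule lim[OF Fsq _ f])
    show "(\<lambda>n. norm2 lborel (\<lambda>x. F n x - f x)) \<longlonglongrightarrow> 0"
    proof (rule norm2_tendsto_0_dominated[OF _ fm square_integrable_cmult[OF f, of 3]])
      show "AE x in lborel. cmod (F n x - f x) \<le> cmod (3 * f x)" for n
      proof (rule AE_I2)
        fix x show "cmod (F n x - f x) \<le> cmod (3 * f x)"
          using norm_triangle_ineq4[of "F n x" "f x"] F(3)[of n x] by (simp add: norm_mult)
      qed
    qed (use F borel_measurable_simple_function[OF F(1)] in auto)
    fix n
    note sf = F(1)[of n]
    have fF: "finite (F n ` UNIV)" using sf by (simp add: simple_function_def)
    have lev: "F n -` {y} \<in> sets borel" for y
      using simple_functionD(2)[OF sf, of "{y}"] by simp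
    have levf: "emeasure lborel (F n -` {y}) < \<infinity>" if "y \<noteq> 0" for y
    proof -
      have "integrable lborel (\<lambda>x. (cmod (F n x))\<^sup>2)" using Fsq by (simp add: square_integrable_def)
      then have "integrable lborel (\<lambda>x. indicator (F n -` {y}) x * (cmod y)\<^sup>2)"
      proof (rule Bochner_Integration.integrable_bound)
        have [measurable]: "F n -` {y} \<in> sets lborel" using lev by simp
        show "(\<lambda>x. indicator (F n -` {y}) x * (cmod y)\<^sup>2) \<in> borel_measurable lborel" by measurable
      qed (auto simp: indicator_def)
      then have "integrable lborel (\<lambda>x. indicator (F n -` {y}) x :: real)" using that by simp
      then show ?thesis using integrable_indicator_iff[of lborel "F n -` {y}"] lev
        by (simp add: top.not_eq_extremum)
    qed
    have "square_integrable lborel (\<lambda>x. \<Sum>y\<in>Y. y * indicator (F n -` {y}) x) \<and> P (\<lambda>x. \<Sum>y\<in>Y. y * indicator (F n -` {y}) x)"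
      if "finite Y" "0 \<notin> Y" for Y
      using that
    proof (induction Y rule: finite_induct)
      case empty then show ?case using zero by (simp add: square_integrable_def)
    next
      case (insert y Y)
      have "square_integrable lborel (\<lambda>x. y * indicator (F n -` {y}) x)" "P (\<lambda>x. y * indicator (F n -` {y}) x)"
        using insert.prems lev levf sq_ind fin by (auto intro!: square_integrable_cmult cm)
      moreover have "square_integrable lborel (\<lambda>x. \<Sum>y\<in>Y. y * indicator (F n -` {y}) x)"
        "P (\<lambda>x. \<Sum>y\<in>Y. y * indicator (F n -` {y}) x)" using insert by auto
      ultimately show ?case
        unfolding sum.insert[OF insert.hyps] by (intro conjI square_integrable_add(1) add)
    qed
    from this[of "F n ` UNIV - {0}"] have "P (\<lambda>x. \<Sum>y\<in>F n ` UNIV - {0}. y * indicator (F n -` {y}) x)"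
      using fF by simp
    moreover have "(\<Sum>y\<in>F n ` UNIV - {0}. y * indicator (F n -` {y}) x) = F n x" for x
    proof -
      have "(\<Sum>y\<in>F n ` UNIV - {0}. y * indicator (F n -` {y}) x) = (\<Sum>y\<in>F n ` UNIV - {0}. if y = F n x then y else 0)"
        by (rule sum.cong) (auto simp: indicator_def)
      then show ?thesis using fF by (auto simp: sum.delta)
    qed
    ultimately show "P (F n)" by simp
  qed
qed

lemma square_integrable_affine:
  assumes "square_integrable lborel f" "c \<noteq> 0"
  shows "square_integrable lborel (\<lambda>x. f (t + c * x))"
proof -
  have [measurable]: "f \<in> borel_measurable borel" and "integrable lborel (\<lambda>x. (cmod (f x))\<^sup>2)"
    using assms(1) by (auto simp: square_integrable_def)
  then have "integrable lborel (\<lambda>x. (cmod (f (t + c * x)))\<^sup>2)"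
    using lborel_integrable_real_affine[of "\<lambda>x. (cmod (f x))\<^sup>2" c t] assms(2) by simp
  then show ?thesis by (simp add: square_integrable_def)
qed

lemma norm2_translate: "norm2 lborel (\<lambda>x. f (t + x)) = norm2 lborel f"
  unfolding norm2_def using lborel_integral_real_affine[of 1 "\<lambda>x. (cmod (f x))\<^sup>2" t] by simp

lemma norm2_reflect: "norm2 lborel (\<lambda>x. f (t - x)) = norm2 lborel f"
  unfolding norm2_def using lborel_integral_real_affine[of "-1" "\<lambda>x. (cmod (f x))\<^sup>2" t] by simp

lemma AE_lborel_affine:
  fixes c t :: real
  assumes "AE x in lborel. P x" "c \<noteq> 0"
  shows "AE x in lborel. P (t + c * x)"
proof -
  obtain N where N: "{x. \<not> P x} \<subseteq> N" "emeasure lborel N = 0" "N \<in> sets lborel"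
    using AE_E[OF assms(1)] by auto
  have "AE x in lborel. x \<notin> N"
    using N(2,3) by (intro AE_not_in) (auto simp: null_sets_def)
  then have "AE x in lborel. t + c * x \<notin> N"
    by (intro AE_borel_affine assms(2)) (use N(3) in auto)
  then show ?thesis by eventually_elim (use N(1) in auto)
qed

lemma norm2_translate_interval:
  fixes a b h :: real
  shows "(norm2 lborel (\<lambda>x. indicator {a<..b} (x + h) - indicator {a<..b} x))\<^sup>2 \<le> 4 * \<bar>h\<bar>"
proof -
  let ?A = "{a - \<bar>h\<bar>..a + \<bar>h\<bar>}" and ?B = "{b - \<bar>h\<bar>..b + \<bar>h\<bar>}"
  have i: "integrable lborel (\<lambda>x. indicator ?A x + indicator ?B x :: real)"
    by (intro Bochner_Integration.integrable_add integrable_real_indicator) (auto simp: emeasure_lborel_Icc_eq)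
  have le: "(cmod (indicator {a<..b} (x + h) - indicator {a<..b} x))\<^sup>2 \<le> indicator ?A x + indicator ?B x" for x
    by (auto simp: indicator_def)
  have "(norm2 lborel (\<lambda>x. indicator {a<..b} (x + h) - indicator {a<..b} x))\<^sup>2
      \<le> (LBINT x. indicator ?A x + indicator ?B x)"
    unfolding norm2_sq
    by (rule integral_mono[OF Bochner_Integration.integrable_bound[OF i] i le]) (use le in auto)
  also have "\<dots> = 4 * \<bar>h\<bar>"
    by (subst Bochner_Integration.integral_add) (auto simp: emeasure_lborel_Icc_eq)
  finally show ?thesis .
qed

text \<open>The property is stable under linear combinations and limits in the mean, because translations are
  isometries; for an interval the two functions differ on a set of measure at most \<open>4 |h|\<close>.\<close>

lemma norm2_translation_continuous:
  assumes "square_integrable lborel f"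
  shows "((\<lambda>h. norm2 lborel (\<lambda>x. f (x + h) - f x)) \<longlongrightarrow> 0) (at 0)"
  using assms
proof (induction rule: square_integrable_induct)
  case (interval a b)
  have "((\<lambda>h. norm2 lborel (\<lambda>x. indicator {a<..b} (x + h) - indicator {a<..b} x)) \<longlongrightarrow> 0) (at 0)"
  proof (rule tendsto_sandwich[OF _ _ tendsto_const])
    show "\<forall>\<^sub>F h in at 0. norm2 lborel (\<lambda>x. indicator {a<..b} (x + h) - indicator {a<..b} x) \<le> sqrt (4 * \<bar>h\<bar>)"
      using norm2_translate_interval by (intro always_eventually allI real_le_rsqrt) auto
    show "((\<lambda>h::real. sqrt (4 * \<bar>h\<bar>)) \<longlongrightarrow> 0) (at 0)"
      by (rule tendsto_eq_intros refl | simp)+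
  qed simp
  then show ?case .
next
  case (add f g)
  have sf: "square_integrable lborel (\<lambda>x. f (x + h) - f x)" for h
    using square_integrable_affine[OF add.hyps(1), of 1 h] by (intro square_integrable_diff add.hyps) (simp add: add.commute)
  have sg: "square_integrable lborel (\<lambda>x. g (x + h) - g x)" for h
    using square_integrable_affine[OF add.hyps(2), of 1 h] by (intro square_integrable_diff add.hyps) (simp add: add.commute)
  show ?case
  proof (rule tendsto_sandwich[OF _ _ tendsto_const])
    show "((\<lambda>h. norm2 lborel (\<lambda>x. f (x + h) - f x) + norm2 lborel (\<lambda>x. g (x + h) - g x)) \<longlongrightarrow> 0) (at 0)"
      using tendsto_add[OF add.IH] by simp
    show "\<forall>\<^sub>F h in at 0. norm2 lborel (\<lambda>x. f (x + h) + g (x + h) - (f x + g x))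
        \<le> norm2 lborel (\<lambda>x. f (x + h) - f x) + norm2 lborel (\<lambda>x. g (x + h) - g x)"
      using norm2_triangle[OF sf sg] by (intro always_eventually allI) (simp add: algebra_simps)
  qed auto
next
  case (cmult f c)
  have "norm2 lborel (\<lambda>x. c * f (x + h) - c * f x) = cmod c * norm2 lborel (\<lambda>x. f (x + h) - f x)" for h
    using norm2_cmult[of lborel c "\<lambda>x. f (x + h) - f x"] by (simp add: algebra_simps)
  then show ?case using tendsto_mult_right_zero[OF cmult.IH, of "cmod c"] by simp
next
  case (limit F f)
  show ?case
  proof (rule tendstoI)
    fix e :: real assume e: "e > 0"
    obtain n where n: "norm2 lborel (\<lambda>x. F n x - f x) < e / 3"
      using order_tendstoD(2)[OF limit.hyps(3), of "e/3"] e by (auto simp: eventually_sequentially)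
    have tr: "square_integrable lborel (\<lambda>x. u (x + h))" if "square_integrable lborel u" for u h
      using square_integrable_affine[OF that, of 1 h] by (simp add: add.commute)
    have "\<forall>\<^sub>F h in at 0. norm2 lborel (\<lambda>x. F n (x + h) - F n x) < e / 3"
      using order_tendstoD(2)[OF limit.IH, of "e/3" n] e by simp
    then show "\<forall>\<^sub>F h in at 0. dist (norm2 lborel (\<lambda>x. f (x + h) - f x)) 0 < e"
    proof eventually_elim
      case (elim h)
      have "norm2 lborel (\<lambda>x. f (x + h) - F n (x + h)) = norm2 lborel (\<lambda>x. f x - F n x)"
        using norm2_translate[of "\<lambda>x. f x - F n x" h] by (simp add: add.commute)
      then have 1: "norm2 lborel (\<lambda>x. f (x + h) - F n (x + h)) < e / 3"
        using n by (simp add: norm2_minus_commute)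
      show ?case
        using norm2_diff_triangle[OF tr[OF limit.hyps(2)] tr[OF limit.hyps(1)] limit.hyps(2), of h n h]
          norm2_diff_triangle[OF tr[OF limit.hyps(1)] limit.hyps(1) limit.hyps(2), of n h n] 1 n elim by simp
    qed
  qed
qed

text \<open>Intervals test the vanishing of square integrable functions: by density they test it against
  the complex conjugate of the function itself.\<close>

lemma AE_eq_0_if_interval_integrals:
  assumes g: "square_integrable lborel g"
    and int: "\<And>a b. a \<le> b \<Longrightarrow> (LBINT x. indicator {a<..b} x * g x) = 0"
  shows "AE x in lborel. g x = 0"
proof -
  have all: "(LBINT x. f x * g x) = 0" if "square_integrable lborel f" for f
    using that
  proof (induction rule: square_integrable_induct)
    case (add u v)
    then show ?case using Cauchy_Schwarz_integral(1)[OF _ g] by (simp add: distrib_right)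
  next
    case (limit F f)
    have "cmod (LBINT x. f x * g x) \<le> norm2 lborel (\<lambda>x. F n x - f x) * norm2 lborel g" for n
    proof -
      have "(LBINT x. (F n x - f x) * g x) = (LBINT x. F n x * g x) - (LBINT x. f x * g x)"
        unfolding left_diff_distrib
        by (rule Bochner_Integration.integral_diff) (rule Cauchy_Schwarz_integral(1)[OF _ g], fact limit.hyps)+
      then show ?thesis
        using Cauchy_Schwarz_integral(4)[OF square_integrable_diff(1)[OF limit.hyps(1,2)] g, of n] limit.IH[of n]
        by simp
    qed
    moreover have "(\<lambda>n. norm2 lborel (\<lambda>x. F n x - f x) * norm2 lborel g) \<longlonglongrightarrow> 0"
      using tendsto_mult_left_zero[OF limit.hyps(3)] .
    ultimately have "cmod (LBINT x. f x * g x) \<le> 0"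
      by (intro LIMSEQ_le_const[of _ 0]) auto
    then show ?case by simp
  qed (auto simp: int mult.assoc)
  have c: "square_integrable lborel (\<lambda>x. cnj (g x))"
    using g
  proof (rule square_integrable_dominated(1))
    have "cnj \<in> borel_measurable borel" by (intro borel_measurable_continuous_onI continuous_intros)
    then show "(\<lambda>x. cnj (g x)) \<in> borel_measurable lborel"
      using measurable_compose square_integrable_measurable[OF g] by blast
  qed simp
  have "(LBINT x. cnj (g x) * g x) = of_real (LBINT x. (cmod (g x))\<^sup>2)"
    by (subst integral_complex_of_real[symmetric]) (simp only: complex_norm_square mult.commute)
  then have "norm2 lborel g = 0" using all[OF c] by (simp add: norm2_def)
  then show ?thesis using norm2_eq_0_iff[OF g] by simp
qed

section \<open>Causal functions and their convolution\<close>

definition cutoff :: "real \<Rightarrow> (real \<Rightarrow> complex) \<Rightarrow> real \<Rightarrow> complex" where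
  "cutoff b f x = (if x \<le> b then f x else 0)"

text \<open>Locally square integrable functions form an algebra under convolution, and the products are continuous.
  No growth at infinity is imposed, so that the algebra applies to functions without a Laplace transform.\<close>

definition causal :: "(real \<Rightarrow> complex) set" where
  "causal = {f \<in> borel_measurable borel. (\<forall>x\<le>0. f x = 0) \<and> (\<forall>b. square_integrable lborel (cutoff b f))}"

definition conv :: "(real \<Rightarrow> complex) \<Rightarrow> (real \<Rightarrow> complex) \<Rightarrow> real \<Rightarrow> complex" where
  "conv f g t = (LBINT x. f (t - x) * g x)"

definition unit_step :: "real \<Rightarrow> complex" where
  "unit_step x = (if 0 < x then 1 else 0)"

definition exp_step :: "real \<Rightarrow> complex" where
  "exp_step x = (if 0 < x then of_real (exp (- x)) else 0)"

lemma causalD: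
  assumes "f \<in> causal"
  shows "f \<in> borel_measurable borel" "x \<le> 0 \<Longrightarrow> f x = 0" "square_integrable lborel (cutoff b f)"
  using assms by (auto simp: causal_def)

lemma cutoff_measurable [measurable]:
  assumes [measurable]: "f \<in> borel_measurable borel"
  shows "cutoff b f \<in> borel_measurable borel"
proof -
  have "cutoff b f = (\<lambda>x. indicator {..b} x * f x)" by (auto simp: cutoff_def)
  then show ?thesis by simp
qed

lemma causalI_bounded:
  assumes "f \<in> borel_measurable borel" "\<And>x. x \<le> 0 \<Longrightarrow> f x = 0" "\<And>b. \<exists>B. \<forall>x\<le>b. cmod (f x) \<le> B"
  shows "f \<in> causal"
proof -
  have "square_integrable lborel (cutoff b f)" for b
  proof -
    obtain B where B: "\<And>x. x \<le> b \<Longrightarrow> cmod (f x) \<le> B" using assms(3)[of b] by auto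
    have "0 \<le> B" using B[of b] norm_ge_zero order_trans by blast
    then show ?thesis
      by (intro square_integrable_bounded_support[of _ B 0 b])
        (use assms(1,2) B in \<open>auto simp: cutoff_def intro!: cutoff_measurable\<close>)
  qed
  then show ?thesis using assms(1,2) by (simp add: causal_def)
qed

lemma causal_add: "f \<in> causal \<Longrightarrow> g \<in> causal \<Longrightarrow> (\<lambda>x. f x + g x) \<in> causal"
proof -
  assume f: "f \<in> causal" and g: "g \<in> causal"
  have "cutoff b (\<lambda>x. f x + g x) = (\<lambda>x. cutoff b f x + cutoff b g x)" for b by (auto simp: cutoff_def)
  then show ?thesis using f g square_integrable_add(1) by (auto simp: causal_def)
qed

lemma unit_step_causal [simp]: "unit_step \<in> causal"
proof (rule causalI_bounded)
  show "unit_step \<in> borel_measurable borel" unfolding unit_step_def[abs_def] by measurable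
  show "\<exists>B. \<forall>x\<le>b. cmod (unit_step x) \<le> B" for b
    by (rule exI[of _ 1]) (auto simp: unit_step_def)
qed (simp add: unit_step_def)

lemma exp_step_causal [simp]: "exp_step \<in> causal"
proof (rule causalI_bounded)
  show "exp_step \<in> borel_measurable borel" unfolding exp_step_def[abs_def] by measurable
  show "\<exists>B. \<forall>x\<le>b. cmod (exp_step x) \<le> B" for b
    by (rule exI[of _ 1]) (auto simp: exp_step_def)
qed (simp add: exp_step_def)

lemma conv_eq_cutoff:
  assumes f: "f \<in> causal" and g: "g \<in> causal" and "t \<le> b"
  shows "f (t - x) * g x = cutoff b f (t - x) * cutoff b g x"
  using causalD(2)[OF f, of "t - x"] causalD(2)[OF g, of x] \<open>t \<le> b\<close> by (auto simp: cutoff_def)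

lemma conv_integrable:
  assumes f: "f \<in> causal" and g: "g \<in> causal"
  shows "integrable lborel (\<lambda>x. f (t - x) * g x)"
    and "t \<le> b \<Longrightarrow> (LBINT x. cmod (f (t - x) * g x)) \<le> norm2 lborel (cutoff b f) * norm2 lborel (cutoff b g)"
proof -
  have sf: "square_integrable lborel (\<lambda>x. cutoff b f (t - x))" for b
    using square_integrable_affine[OF causalD(3)[OF f], of "-1"] by simp
  show "integrable lborel (\<lambda>x. f (t - x) * g x)"
    using Cauchy_Schwarz_integral(1)[OF sf causalD(3)[OF g], of t] by (simp add: conv_eq_cutoff[OF f g order_refl])
  assume "t \<le> b"
  then show "(LBINT x. cmod (f (t - x) * g x)) \<le> norm2 lborel (cutoff b f) * norm2 lborel (cutoff b g)"
    using Cauchy_Schwarz_integral(3)[OF sf causalD(3)[OF g], of b b]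
    by (simp add: conv_eq_cutoff[OF f g] norm2_reflect norm_mult)
qed

lemma conv_bound:
  assumes f: "f \<in> causal" and g: "g \<in> causal" and "t \<le> b"
  shows "cmod (conv f g t) \<le> norm2 lborel (cutoff b f) * norm2 lborel (cutoff b g)"
  unfolding conv_def by (rule order_trans[OF integral_norm_bound conv_integrable(2)[OF assms]])

lemma conv_nonpos:
  assumes f: "f \<in> causal" and g: "g \<in> causal" and "t \<le> 0"
  shows "conv f g t = 0"
proof -
  have "f (t - x) * g x = 0" for x
    using causalD(2)[OF f, of "t - x"] causalD(2)[OF g, of x] \<open>t \<le> 0\<close> by (cases "x \<le> 0") auto
  then have "(\<lambda>x. f (t - x) * g x) = (\<lambda>x. 0)" by (rule ext)
  then show ?thesis unfolding conv_def by (simp only: Bochner_Integration.integral_zero)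
qed

lemma conv_measurable [measurable]:
  assumes [measurable]: "f \<in> borel_measurable borel" "g \<in> borel_measurable borel"
  shows "conv f g \<in> borel_measurable borel"
  unfolding conv_def[abs_def] by measurable

lemma conv_causal [simp]:
  assumes f: "f \<in> causal" and g: "g \<in> causal"
  shows "conv f g \<in> causal"
proof (rule causalI_bounded)
  show "conv f g \<in> borel_measurable borel" by (rule conv_measurable) (rule causalD[OF f] causalD[OF g])+
  show "\<exists>B. \<forall>x\<le>b. cmod (conv f g x) \<le> B" for b using conv_bound[OF f g] by blast
qed (rule conv_nonpos[OF f g])

lemma conv_commute: "conv f g = conv g f"
proof
  fix t show "conv f g t = conv g f t"
    unfolding conv_def using lborel_integral_real_affine[of "-1" "\<lambda>x. f (t - x) * g x" t]
    by (simp add: mult.commute)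
qed

lemma conv_add_left:
  assumes "f \<in> causal" "g \<in> causal" "h \<in> causal"
  shows "conv (\<lambda>x. f x + g x) h = (\<lambda>t. conv f h t + conv g h t)"
  using conv_integrable(1)[OF assms(1,3)] conv_integrable(1)[OF assms(2,3)]
  by (auto simp: conv_def distrib_right)

lemma causal_locally_integrable:
  assumes f: "f \<in> causal"
  shows "integrable lborel (cutoff b f)"
proof -
  have "square_integrable lborel (indicator {0..b} :: real \<Rightarrow> complex)"
    by (rule square_integrable_bounded_support[of _ 1 0 b]) (auto simp: indicator_def)
  from Cauchy_Schwarz_integral(1)[OF this causalD(3)[OF f], of b]
  have "integrable lborel (\<lambda>x. indicator {0..b} x * cutoff b f x)" .
  moreover have "indicator {0..b} x * cutoff b f x = cutoff b f x" for x
    using causalD(2)[OF f, of x] by (auto simp: cutoff_def indicator_def)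
  ultimately show ?thesis by simp
qed

text \<open>Fubini applies to \<open>f(t - u) g(u - y) h(y)\<close> because the inner integral over \<open>u\<close> is bounded by Cauchy-Schwarz,
  uniformly for \<open>y \<le> t\<close>, and \<open>h\<close> is locally integrable.\<close>

lemma conv_assoc:
  assumes f: "f \<in> causal" and g: "g \<in> causal" and h: "h \<in> causal"
  shows "conv (conv f g) h = conv f (conv g h)"
proof
  fix t
  note [measurable] = causalD(1)[OF f] causalD(1)[OF g] causalD(1)[OF h]
  let ?F = "\<lambda>y u. f (t - u) * (g (u - y) * h y)"
  let ?B = "norm2 lborel (cutoff t f) * norm2 lborel (cutoff t g)"
  have shift: "(LBINT u. F (t - u) (u - y)) = (LBINT v. F (t - y - v) v)" for F :: "real \<Rightarrow> real \<Rightarrow> 'b::{banach,second_countable_topology}" and y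
    using lborel_integral_real_affine[of 1 "\<lambda>u. F (t - u) (u - y)" y] by (simp add: algebra_simps)
  have inner: "(LBINT u. cmod (?F y u)) \<le> ?B * cmod (cutoff t h y)" for y
  proof -
    have "(LBINT u. cmod (?F y u)) = (LBINT v. cmod (f (t - y - v) * g v)) * cmod (h y)"
    proof -
      have "(LBINT u. cmod (?F y u)) = (LBINT u. cmod (f (t - u) * g (u - y)) * cmod (h y))"
        by (simp add: norm_mult mult.assoc)
      then show ?thesis using shift[of "\<lambda>a b. cmod (f a * g b)" y] by simp
    qed
    also have "\<dots> \<le> ?B * cmod (cutoff t h y)"
    proof (cases "0 < y \<and> y \<le> t")
      case True
      then show ?thesis using conv_integrable(2)[OF f g, of "t - y" t]
        by (simp add: cutoff_def mult_right_mono)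
    next
      case False
      have "cmod (f (t - y - v) * g v) = 0" if "t < y" for v
        using causalD(2)[OF f, of "t - y - v"] causalD(2)[OF g, of v] that by (cases "v \<le> 0") auto
      then have "(LBINT v. cmod (f (t - y - v) * g v)) = 0" if "t < y"
        using that by (simp only: Bochner_Integration.integral_zero)
      then show ?thesis using False causalD(2)[OF h, of y] by (cases "y \<le> 0") auto
    qed
    finally show ?thesis .
  qed
  have "integrable (lborel \<Otimes>\<^sub>M lborel) (\<lambda>(y, u). ?F y u)"
  proof (rule lborel_pair.Fubini_integrable)
    show "(\<lambda>(y, u). ?F y u) \<in> borel_measurable (lborel \<Otimes>\<^sub>M lborel)" by measurable
    have "integrable lborel (\<lambda>y. ?B * cmod (cutoff t h y))"
      using causal_locally_integrable[OF h, of t] by (intro integrable_mult_right integrable_norm)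
    then show "integrable lborel (\<lambda>y. LBINT u. norm (case (y, u) of (y, u) \<Rightarrow> ?F y u))"
      by (rule Bochner_Integration.integrable_bound) (use inner in \<open>auto intro: order_trans[OF _ abs_ge_self]\<close>)
    have "integrable lborel (\<lambda>u. ?F y u)" for y
    proof -
      have "integrable lborel (\<lambda>v. f (t - y - v) * g v * h y)"
        by (intro integrable_mult_left conv_integrable(1)[OF f g])
      then show ?thesis
        using lborel_integrable_real_affine_iff[of 1 "?F y" y] by (simp add: algebra_simps)
    qed
    then show "AE y in lborel. integrable lborel (\<lambda>u. case (y, u) of (y, u) \<Rightarrow> ?F y u)" by simp
  qed
  then have swap: "(LBINT y. LBINT u. ?F y u) = (LBINT u. LBINT y. ?F y u)"
    by (rule lborel_pair.Fubini_integral[symmetric])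
  have "(LBINT u. ?F y u) = conv f g (t - y) * h y" for y
  proof -
    have "(LBINT u. ?F y u) = (LBINT u. f (t - u) * g (u - y) * h y)" by (simp add: mult.assoc)
    then show ?thesis using shift[of "\<lambda>a b. f a * g b" y] by (simp add: conv_def)
  qed
  then have "conv (conv f g) h t = (LBINT y. LBINT u. ?F y u)"
    by (simp add: conv_def[of "conv f g"])
  also have "\<dots> = conv f (conv g h) t" unfolding swap by (simp add: conv_def)
  finally show "conv (conv f g) h t = conv f (conv g h) t" .
qed

text \<open>By Cauchy-Schwarz the modulus of continuity is bounded by the \<open>L\<^sup>2\<close> modulus of continuity of translations.\<close>

lemma conv_continuous:
  assumes f: "f \<in> causal" and g: "g \<in> causal"
  shows "continuous_on UNIV (conv f g)"
proof (rule continuous_at_imp_continuous_on, rule ballI)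
  fix t :: real
  let ?f = "cutoff (t + 1) f" and ?g = "cutoff (t + 1) g"
  have sf: "square_integrable lborel (\<lambda>x. ?f (s - x))" for s
    using square_integrable_affine[OF causalD(3)[OF f], of "-1"] by simp
  have bound: "cmod (conv f g (t + h) - conv f g t) \<le> norm2 lborel (\<lambda>x. ?f (x + h) - ?f x) * norm2 lborel ?g"
    if "h < 1" "h > -1" for h
  proof -
    have "conv f g (t + h) - conv f g t = (LBINT x. ?f (t + h - x) * ?g x) - (LBINT x. ?f (t - x) * ?g x)"
      using that by (simp add: conv_def conv_eq_cutoff[OF f g, of _ "t + 1"])
    also have "\<dots> = (LBINT x. (?f (t + h - x) - ?f (t - x)) * ?g x)"
      unfolding left_diff_distrib
      by (rule Bochner_Integration.integral_diff[symmetric]) (rule Cauchy_Schwarz_integral(1)[OF sf causalD(3)[OF g]])+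
    finally have "cmod (conv f g (t + h) - conv f g t) \<le> norm2 lborel (\<lambda>x. ?f (t + h - x) - ?f (t - x)) * norm2 lborel ?g"
      using Cauchy_Schwarz_integral(4)[OF square_integrable_diff(1)[OF sf sf] causalD(3)[OF g]] by simp
    also have "norm2 lborel (\<lambda>x. ?f (t + h - x) - ?f (t - x)) = norm2 lborel (\<lambda>x. ?f (x + h) - ?f x)"
      using norm2_reflect[of "\<lambda>x. ?f (x + h) - ?f x" t] by (simp add: algebra_simps)
    finally show ?thesis .
  qed
  have "((\<lambda>h. conv f g (t + h) - conv f g t) \<longlongrightarrow> 0) (at 0)"
  proof (rule Lim_null_comparison)
    show "((\<lambda>h. norm2 lborel (\<lambda>x. ?f (x + h) - ?f x) * norm2 lborel ?g) \<longlongrightarrow> 0) (at 0)"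
      by (rule tendsto_mult_left_zero[OF norm2_translation_continuous[OF causalD(3)[OF f]]])
    show "\<forall>\<^sub>F h in at 0. norm (conv f g (t + h) - conv f g t) \<le> norm2 lborel (\<lambda>x. ?f (x + h) - ?f x) * norm2 lborel ?g"
      unfolding eventually_at using bound by (intro exI[of _ 1]) (auto simp: dist_real_def)
  qed
  then show "isCont (conv f g) t"
    unfolding isCont_def using LIM_offset_zero_iff[of t "conv f g"] by (simp add: LIM_zero_iff)
qed

lemma causal_cmult: "f \<in> causal \<Longrightarrow> (\<lambda>x. c * f x) \<in> causal"
proof -
  assume f: "f \<in> causal"
  have "cutoff b (\<lambda>x. c * f x) = (\<lambda>x. c * cutoff b f x)" for b by (auto simp: cutoff_def)
  then show ?thesis using f square_integrable_cmult by (auto simp: causal_def)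
qed

lemma conv_add_right:
  assumes "f \<in> causal" "g \<in> causal" "h \<in> causal"
  shows "conv f (\<lambda>x. g x + h x) = (\<lambda>t. conv f g t + conv f h t)"
  using conv_add_left[OF assms(2,3,1)] by (simp add: conv_commute)

lemma conv_vanish:
  assumes "g \<in> causal" "\<And>s. s \<le> S \<Longrightarrow> f s = 0" "t \<le> S"
  shows "conv f g t = 0"
proof -
  have "f (t - x) * g x = 0" for x
    using causalD(2)[OF assms(1), of x] assms(2)[of "t - x"] assms(3) by (cases "x \<le> 0") auto
  then have "(\<lambda>x. f (t - x) * g x) = (\<lambda>x. 0)" by (rule ext)
  then show ?thesis unfolding conv_def by (simp only: Bochner_Integration.integral_zero)
qed

lemma conv_unit_step:
  assumes g: "g \<in> causal" and t: "0 \<le> t" and gf: "\<And>x. 0 < x \<Longrightarrow> x \<le> t \<Longrightarrow> g x = f x"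
    and F: "\<And>x. 0 \<le> x \<Longrightarrow> x \<le> t \<Longrightarrow> (F has_vector_derivative f x) (at x within {0..t})"
    and f: "continuous_on {0..t} f"
  shows "conv unit_step g t = F t - F 0"
proof -
  have "conv unit_step g t = (LBINT x. indicator {0..t} x *\<^sub>R f x)"
    unfolding conv_def
  proof (rule integral_cong_AE)
    have "(\<lambda>x. indicator {0..t} x *\<^sub>R f x) = (\<lambda>x. if x \<in> {0..t} then f x else 0)" by auto
    then show "(\<lambda>x. indicator {0..t} x *\<^sub>R f x) \<in> borel_measurable lborel"
      using borel_measurable_continuous_on_if[OF _ f continuous_on_const] by simp
    show "(\<lambda>x. unit_step (t - x) * g x) \<in> borel_measurable lborel"
      using conv_integrable(1)[OF unit_step_causal g] by auto
    show "AE x in lborel. unit_step (t - x) * g x = indicator {0..t} x *\<^sub>R f x"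
      using AE_lborel_singleton[of 0] AE_lborel_singleton[of t]
      by eventually_elim (use causalD(2)[OF g] gf in \<open>auto simp: unit_step_def indicator_def\<close>)
  qed
  then show ?thesis using integral_FTC_Icc[OF t F f] by simp
qed

lemma conv_unit_exp: "0 \<le> t \<Longrightarrow> conv unit_step exp_step t = 1 - of_real (exp (- t))"
  by (subst conv_unit_step[where f = "\<lambda>x. of_real (exp (- x))" and F = "\<lambda>x. - of_real (exp (- x))"])
    (auto simp: exp_step_def intro!: derivative_eq_intros continuous_intros)

lemma conv_unit_unit: "0 \<le> t \<Longrightarrow> conv unit_step unit_step t = of_real t"
  by (subst conv_unit_step[where f = "\<lambda>x. 1" and F = "\<lambda>x. of_real x"])
    (auto simp: unit_step_def intro!: derivative_eq_intros continuous_intros)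

lemma conv_unit_unit_unit: "0 \<le> t \<Longrightarrow> conv unit_step (conv unit_step unit_step) t = of_real (t\<^sup>2 / 2)"
proof (subst conv_unit_step[where f = "\<lambda>x. of_real x" and F = "\<lambda>x. of_real (x\<^sup>2 / 2)"])
  fix x :: real
  have "((\<lambda>x. x\<^sup>2 / 2) has_vector_derivative x) (at x within {0..t})"
    by (auto intro!: derivative_eq_intros simp: has_real_derivative_iff_has_vector_derivative[symmetric])
  then show "((\<lambda>x. complex_of_real (x\<^sup>2 / 2)) has_vector_derivative of_real x) (at x within {0..t})"
    by (rule bounded_linear.has_vector_derivative[OF bounded_linear_of_real])
qed (auto simp: conv_unit_unit intro!: continuous_intros)

text \<open>In terms of convolution operators, \<open>e\<^bsup>-t\<^esup>\<close> is \<open>1\<close> divided by \<open>\<delta> + 1\<close>.\<close>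

lemma exp_step_resolvent: "(\<lambda>x. exp_step x + conv unit_step exp_step x) = unit_step"
proof
  fix x show "exp_step x + conv unit_step exp_step x = unit_step x"
    using conv_unit_exp[of x] conv_nonpos[OF unit_step_causal exp_step_causal, of x]
    by (cases "x \<le> 0") (auto simp: exp_step_def unit_step_def)
qed

text \<open>The set where \<open>f\<close> does not vanish is open, so it has positive measure to the left of each of its points.\<close>

lemma continuous_AE_eq_0:
  fixes f :: "real \<Rightarrow> complex"
  assumes "continuous_on UNIV f" "AE x in lborel. x < S \<longrightarrow> f x = 0" "x \<le> S"
  shows "f x = 0"
proof (rule ccontr)
  assume "f x \<noteq> 0"
  have "open (f -` (- {0}))"
    using assms(1) by (intro open_vimage) auto
  moreover have "x \<in> f -` (- {0})" using \<open>f x \<noteq> 0\<close> by simp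
  ultimately obtain e where e: "e > 0" "ball x e \<subseteq> f -` (- {0})"
    by (rule openE)
  have "AE y in lborel. y \<notin> {x - e<..<x}"
    using assms(2) by eventually_elim (use e(2) assms(3) in \<open>auto simp: subset_iff dist_real_def\<close>)
  then have "emeasure lborel {x - e<..<x} = 0"
    using AE_iff_measurable[of "{x - e<..<x}" lborel "\<lambda>y. y \<notin> {x - e<..<x}"] by (simp del: greaterThanLessThan_iff)
  then show False using e(1) by simp
qed

text \<open>Convolution with the unit step is integration from \<open>0\<close>, so all integrals of \<open>W\<close> over subintervals of
  \<open>(-\<infinity>, S]\<close> vanish.\<close>

lemma conv_step_injective:
  assumes W: "W \<in> causal" and z: "\<And>t. t \<le> S \<Longrightarrow> conv W unit_step t = 0"
  shows "AE x in lborel. x < S \<longrightarrow> W x = 0"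
proof -
  have "AE x in lborel. cutoff S W x = 0"
  proof (rule AE_eq_0_if_interval_integrals[OF causalD(3)[OF W]])
    fix a b :: real assume "a \<le> b"
    define p q where "p = min a S" and "q = min b S"
    have i: "integrable lborel (\<lambda>x. unit_step (t - x) * W x)" for t
      by (rule conv_integrable(1)[OF unit_step_causal W])
    have zero: "(LBINT x. unit_step (t - x) * W x) = 0" if "t \<le> S" for t
      using z[OF that] by (simp add: conv_commute[of W] conv_def)
    have "(LBINT x. indicator {a<..b} x * cutoff S W x)
        = (LBINT x. unit_step (q - x) * W x - unit_step (p - x) * W x)"
    proof (rule integral_cong_AE)
      show "(\<lambda>x. indicator {a<..b} x * cutoff S W x) \<in> borel_measurable lborel"
        using causalD(1)[OF W] by simp
      show "(\<lambda>x. unit_step (q - x) * W x - unit_step (p - x) * W x) \<in> borel_measurable lborel"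
        using i by auto
      show "AE x in lborel. indicator {a<..b} x * cutoff S W x = unit_step (q - x) * W x - unit_step (p - x) * W x"
        using AE_lborel_singleton[of p] AE_lborel_singleton[of q]
        by eventually_elim
          (use \<open>a \<le> b\<close> in \<open>auto simp: p_def q_def unit_step_def cutoff_def indicator_def min_def split: if_splits\<close>)
    qed
    also have "\<dots> = 0"
      by (subst Bochner_Integration.integral_diff[OF i i]) (simp add: zero p_def q_def)
    finally show "(LBINT x. indicator {a<..b} x * cutoff S W x) = 0" .
  qed
  then show ?thesis by eventually_elim (auto simp: cutoff_def split: if_splits)
qed

text \<open>Convolving with \<open>D\<close> turns \<open>Z * q = 0\<close> into \<open>Z * (1 - e\<^bsup>-t\<^esup>) = 0\<close>, and the resolvent identity
  \<open>exp + 1 * exp = 1\<close> turns this into \<open>Z * 1 * 1 = 0\<close>, from which \<open>Z\<close> is recovered by differentiation.\<close>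

lemma conv_injective:
  assumes Z: "Z \<in> causal" and q: "q \<in> causal" and D: "D \<in> causal"
    and qD: "conv q D = conv unit_step exp_step" and z: "\<And>t. t \<le> S \<Longrightarrow> conv Z q t = 0"
  shows "AE x in lborel. x < S \<longrightarrow> Z x = 0"
proof -
  \<comment> \<open>it suffices to show \<open>V * 1 = 0\<close> for \<open>V = Z * 1\<close>, and then to differentiate twice\<close>
  let ?V = "conv Z unit_step"
  have V: "?V \<in> causal" using Z by simp
  have "conv (conv Z q) D = conv ?V exp_step"
    using Z q D by (simp add: conv_assoc qD)
  then have e: "conv ?V exp_step t = 0" if "t \<le> S" for t
    using conv_vanish[of D S "conv Z q" t, OF D z that] by simp
  have "conv ?V unit_step = (\<lambda>t. conv ?V exp_step t + conv (conv ?V exp_step) unit_step t)"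
    using V by (subst exp_step_resolvent[symmetric])
      (simp add: conv_add_right conv_assoc conv_commute[of unit_step exp_step])
  then have "conv ?V unit_step t = 0" if "t \<le> S" for t
    using e[OF that] conv_vanish[OF unit_step_causal e that] by simp
  then have "AE x in lborel. x < S \<longrightarrow> ?V x = 0" by (rule conv_step_injective[OF V])
  then have "?V t = 0" if "t \<le> S" for t
    using continuous_AE_eq_0[OF conv_continuous[OF Z unit_step_causal] _ that] by simp
  then show ?thesis by (rule conv_step_injective[OF Z])
qed

section \<open>The Laplace transform on the real axis\<close>

text \<open>Real arguments suffice both for uniqueness and for recognising real functions.\<close>

definition real_laplace :: "(real \<Rightarrow> complex) \<Rightarrow> real \<Rightarrow> complex \<Rightarrow> bool" where
  "real_laplace f z w \<longleftrightarrow> integrable lborel (\<lambda>x. f x * of_real (exp (- z * x))) \<and>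
     (LBINT x. f x * of_real (exp (- z * x))) = w"

lemma real_laplace_unit_step:
  assumes "0 < z" shows "real_laplace unit_step z (1 / of_real z)"
proof -
  have h: "((\<lambda>x. exp (- z * x)) has_integral exp (- z * 0) / z) {0..}"
    by (rule has_integral_exp_minus_to_infinity[OF assms])
  then have "(\<lambda>x. exp (- z * x)) absolutely_integrable_on {0..}"
    by (intro nonnegative_absolutely_integrable_1) (auto simp: integrable_on_def)
  then have i: "set_integrable lborel {0..} (\<lambda>x. exp (- z * x))"
    unfolding set_integrable_def by (subst (asm) integrable_completion) auto
  then have I: "(LBINT x:{0..}. exp (- z * x)) = 1 / z"
    using set_borel_integral_eq_integral(2)[OF i] h by (simp add: integral_unique)
  have ae: "AE x in lborel. unit_step x * of_real (exp (- z * x)) = of_real (indicator {0..} x *\<^sub>R exp (- z * x))"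
    using AE_lborel_singleton[of 0] by eventually_elim (auto simp: unit_step_def indicator_def)
  have m: "(\<lambda>x. unit_step x * of_real (exp (- z * x))) \<in> borel_measurable lborel"
    using causalD(1)[OF unit_step_causal] by simp
  have i': "integrable lborel (\<lambda>x. complex_of_real (indicator {0..} x *\<^sub>R exp (- z * x)))"
    using i unfolding set_integrable_def by (rule integrable_of_real)
  then have "integrable lborel (\<lambda>x. unit_step x * of_real (exp (- z * x)))"
    using integrable_cong_AE[OF m _ ae] by auto
  moreover have "(LBINT x. unit_step x * of_real (exp (- z * x))) = 1 / of_real z"
    using integral_cong_AE[OF m _ ae] i' I unfolding set_lebesgue_integral_def
    by (simp del: of_real_mult real_scaleR_def add: borel_measurable_integrable)
  ultimately show ?thesis by (simp add: real_laplace_def)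
qed

lemma real_laplace_exp_step:
  assumes "0 < z" shows "real_laplace exp_step z (1 / (1 + of_real z))"
proof -
  have "exp_step x * of_real (exp (- z * x)) = unit_step x * of_real (exp (- (1 + z) * x))" for x
    by (auto simp: exp_step_def unit_step_def of_real_mult[symmetric] exp_add[symmetric] algebra_simps
        simp del: of_real_mult)
  then show ?thesis using real_laplace_unit_step[of "1 + z"] assms by (simp add: real_laplace_def)
qed

lemma real_laplace_conv:
  assumes f: "f \<in> causal" and g: "g \<in> causal" and lf: "real_laplace f z u" and lg: "real_laplace g z v"
  shows "real_laplace (conv f g) z (u * v)"
proof -
  note [measurable] = causalD(1)[OF f] causalD(1)[OF g]
  let ?F = "\<lambda>x. f x * of_real (exp (- z * x))" and ?G = "\<lambda>x. g x * of_real (exp (- z * x))"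
  have F: "integrable lborel ?F" "(LBINT x. ?F x) = u" and G: "integrable lborel ?G" "(LBINT x. ?G x) = v"
    using lf lg by (auto simp: real_laplace_def)
  have shift: "integrable lborel (\<lambda>t. ?F (t - x))" "(LBINT t. ?F (t - x)) = u"
    "(LBINT t. cmod (?F (t - x))) = (LBINT t. cmod (?F t))" for x
    using lborel_integrable_real_affine[OF F(1), of 1 "- x"] lborel_integral_real_affine[of 1 ?F "- x"]
      lborel_integral_real_affine[of 1 "\<lambda>t. cmod (?F t)" "- x"] F(2) by (simp_all add: algebra_simps)
  have int: "integrable (lborel \<Otimes>\<^sub>M lborel) (\<lambda>(x, t). ?F (t - x) * ?G x)"
  proof (rule lborel_pair.Fubini_integrable)
    show "(\<lambda>(x, t). ?F (t - x) * ?G x) \<in> borel_measurable (lborel \<Otimes>\<^sub>M lborel)" by measurable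
    have "(LBINT t. norm (?F (t - x) * ?G x)) = (LBINT t. cmod (?F t)) * cmod (?G x)" for x
      unfolding norm_mult[of "?F (_ - x)"] by (simp only: integral_mult_left_zero shift(3))
    then show "integrable lborel (\<lambda>x. LBINT t. norm (case (x, t) of (x, t) \<Rightarrow> ?F (t - x) * ?G x))"
      using G(1) by (simp del: norm_mult of_real_exp) 
    show "AE x in lborel. integrable lborel (\<lambda>t. case (x, t) of (x, t) \<Rightarrow> ?F (t - x) * ?G x)"
      using shift(1) by (intro AE_I2) (simp only: prod.case integrable_mult_left)
  qed
  have eq: "(LBINT x. ?F (t - x) * ?G x) = conv f g t * of_real (exp (- z * t))" for t
  proof -
    have "?F (t - x) * ?G x = f (t - x) * g x * of_real (exp (- z * t))" for x
    proof -
      have "exp (- z * (t - x)) * exp (- z * x) = exp (- z * t)"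
        by (simp add: exp_add[symmetric] algebra_simps)
      then have "complex_of_real (exp (- z * (t - x))) * of_real (exp (- z * x)) = of_real (exp (- z * t))"
        by (simp only: of_real_mult[symmetric])
      then show ?thesis by (simp add: algebra_simps del: of_real_exp)
    qed
    then have "(\<lambda>x. ?F (t - x) * ?G x) = (\<lambda>x. f (t - x) * g x * of_real (exp (- z * t)))" by (rule ext)
    then show ?thesis by (simp only: conv_def integral_mult_left_zero)
  qed
  have "integrable lborel (\<lambda>t. LBINT x. ?F (t - x) * ?G x)"
    using lborel_pair.integrable_snd[OF int] by simp
  moreover have "(LBINT t. LBINT x. ?F (t - x) * ?G x) = (LBINT x. LBINT t. ?F (t - x) * ?G x)"
    by (rule lborel_pair.Fubini_integral[OF int])
  moreover have "(LBINT x. LBINT t. ?F (t - x) * ?G x) = u * v"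
    by (simp only: integral_mult_left_zero integral_mult_right_zero shift(2) G(2))
  ultimately show ?thesis unfolding real_laplace_def eq by simp
qed

text \<open>Weierstrass approximation of \<open>F\<close> on \<open>[0, 1]\<close>, the range of \<open>e\<^bsup>-x\<^esup>\<close> for \<open>x \<ge> 0\<close>.\<close>

lemma integral_polynomial_exp_eq_0:
  assumes g: "integrable lborel g" "\<And>x. x \<le> 0 \<Longrightarrow> g x = (0::complex)"
    and pow: "\<And>n::nat. (LBINT x. g x * of_real (exp (- x) ^ n)) = 0"
    and F: "continuous_on UNIV (F :: real \<Rightarrow> real)"
  shows "(LBINT x. g x * of_real (F (exp (- x)))) = 0"
proof -
  have [measurable]: "g \<in> borel_measurable borel" using g(1) by auto
  have [measurable]: "F \<in> borel_measurable borel" using F by (rule borel_measurable_continuous_onI)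
  have bdd: "integrable lborel (\<lambda>x. g x * of_real (u (exp (- x))))"
    if u: "continuous_on UNIV (u :: real \<Rightarrow> real)" for u
  proof -
    have [measurable]: "u \<in> borel_measurable borel" using u by (rule borel_measurable_continuous_onI)
    have "bounded (u ` {0..1})"
      by (intro compact_imp_bounded compact_continuous_image continuous_on_subset[OF u]) auto
    then obtain B where B: "\<And>y. y \<in> {0..1} \<Longrightarrow> \<bar>u y\<bar> \<le> B"
      unfolding bounded_iff by (metis imageI real_norm_def)
    show ?thesis
    proof (rule Bochner_Integration.integrable_bound)
      show "integrable lborel (\<lambda>x. g x * of_real B)" using g(1) by simp
      show "AE x in lborel. norm (g x * of_real (u (exp (- x)))) \<le> norm (g x * of_real B)"
      proof (rule AE_I2)
        fix x
        show "norm (g x * of_real (u (exp (- x)))) \<le> norm (g x * of_real B)"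
          using g(2)[of x] B[of "exp (- x)"] by (cases "x \<le> 0") (auto simp: norm_mult intro!: mult_left_mono)
      qed
    qed measurable
  qed
  have poly: "(LBINT x. g x * of_real (p (exp (- x)))) = 0" if p: "real_polynomial_function p" for p
  proof -
    obtain a n where p: "p = (\<lambda>x. \<Sum>i\<le>n. a i * x ^ i)"
      using p by (auto simp: real_polynomial_function_iff_sum)
    have i: "integrable lborel (\<lambda>x. of_real (a i) * (g x * of_real (exp (- x) ^ i)))" for i
      by (intro integrable_mult_right bdd continuous_intros)
    have "(LBINT x. g x * of_real (p (exp (- x)))) = (LBINT x. \<Sum>i\<le>n. of_real (a i) * (g x * of_real (exp (- x) ^ i)))"
      by (intro Bochner_Integration.integral_cong) (auto simp: p sum_distrib_left algebra_simps)
    also have "\<dots> = (\<Sum>i\<le>n. LBINT x. of_real (a i) * (g x * of_real (exp (- x) ^ i)))"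
      by (rule Bochner_Integration.integral_sum) (rule i)
    also have "\<dots> = 0" by (simp only: integral_mult_right_zero pow mult_zero_right sum.neutral_const)
    finally show ?thesis .
  qed
  let ?I = "LBINT x. g x * of_real (F (exp (- x)))"
  have "cmod ?I \<le> e * (LBINT x. cmod (g x))" if e: "e > 0" for e
  proof -
    obtain p where p: "real_polynomial_function p" "\<And>x. x \<in> {0..1} \<Longrightarrow> \<bar>F x - p x\<bar> < e"
      using Stone_Weierstrass_real_polynomial_function[of "{0..1::real}" F e] continuous_on_subset[OF F] e
      by auto
    have cp: "continuous_on UNIV p"
      using continuous_real_polymonial_function[OF p(1)] by (simp add: continuous_at_imp_continuous_on)
    have "?I = (LBINT x. g x * of_real (F (exp (- x)))) - (LBINT x. g x * of_real (p (exp (- x))))"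
      using poly[OF p(1)] by simp
    also have "\<dots> = (LBINT x. g x * of_real (F (exp (- x)) - p (exp (- x))))"
      using Bochner_Integration.integral_diff[OF bdd[OF F] bdd[OF cp]] by (simp add: right_diff_distrib)
    also have "cmod \<dots> \<le> (LBINT x. cmod (g x * of_real (F (exp (- x)) - p (exp (- x)))))"
      by (rule integral_norm_bound)
    also have "\<dots> \<le> (LBINT x. e * cmod (g x))"
    proof (rule integral_mono)
      show "integrable lborel (\<lambda>x. cmod (g x * of_real (F (exp (- x)) - p (exp (- x)))))"
        using bdd[OF continuous_on_diff[OF F cp]] by (rule integrable_norm)
      show "integrable lborel (\<lambda>x. e * cmod (g x))" using g(1) by simp
      fix x
      show "cmod (g x * of_real (F (exp (- x)) - p (exp (- x)))) \<le> e * cmod (g x)"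
      proof (cases "x \<le> 0")
        case False
        then have "\<bar>F (exp (- x)) - p (exp (- x))\<bar> \<le> e" using p(2)[of "exp (- x)"] by simp
        then have "cmod (g x) * \<bar>F (exp (- x)) - p (exp (- x))\<bar> \<le> cmod (g x) * e"
          by (rule mult_left_mono) simp
        then show ?thesis by (simp add: norm_mult mult.commute del: of_real_diff)
      qed (simp add: g(2))
    qed
    finally show ?thesis by simp
  qed
  note small = this
  show ?thesis
  proof (rule ccontr)
    assume nz: "?I \<noteq> 0"
    define K where "K = (LBINT x. cmod (g x))"
    have K: "0 \<le> K" unfolding K_def by (rule Bochner_Integration.integral_nonneg) simp
    have pos: "0 < cmod ?I / (2 * (K + 1))" using nz K by (intro divide_pos_pos) auto
    from small[OF pos] have "cmod ?I \<le> cmod ?I / (2 * (K + 1)) * K" unfolding K_def .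
    also have "\<dots> = cmod ?I * (K / (2 * (K + 1)))" by simp
    also have "\<dots> < cmod ?I * 1" using nz K by (intro mult_strict_left_mono) (auto simp: field_simps)
    finally show False by simp
  qed
qed

text \<open>The indicator of \<open>e\<^bsup>-x\<^esup> < c\<close> is the pointwise limit of the ramps \<open>min 1 (max 0 (n (c - e\<^bsup>-x\<^esup>)))\<close>.\<close>

lemma integral_superlevel_eq_0:
  assumes g: "integrable lborel g" "\<And>x. x \<le> 0 \<Longrightarrow> g x = (0::complex)"
    and pow: "\<And>n::nat. (LBINT x. g x * of_real (exp (- x) ^ n)) = 0"
  shows "(LBINT x. g x * of_real (if exp (- x) < c then 1 else 0)) = 0"
proof -
  have [measurable]: "g \<in> borel_measurable borel" using g(1) by auto
  let ?r = "\<lambda>n u. min 1 (max 0 (real n * (c - u)))"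
  have "(\<lambda>n. LBINT x. g x * of_real (?r n (exp (- x)))) \<longlonglongrightarrow> (LBINT x. g x * of_real (if exp (- x) < c then 1 else 0))"
  proof (rule integral_dominated_convergence)
    show "integrable lborel (\<lambda>x. cmod (g x))" using g(1) by simp
    have "(\<lambda>n. ?r n u) \<longlonglongrightarrow> (if u < c then 1 else 0)" for u
    proof (cases "u < c")
      case True
      obtain N :: nat where N: "1 / (c - u) < real N" using reals_Archimedean2 by blast
      have "?r n u = 1" if "N \<le> n" for n
      proof -
        have "1 / (c - u) < real n" using N that by simp
        then have "1 < real n * (c - u)" using True by (simp add: pos_divide_less_eq)
        then show ?thesis by simp
      qed
      then have "(\<lambda>n. ?r n u) \<longlonglongrightarrow> 1"
        by (intro tendsto_eventually) (auto simp: eventually_sequentially)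
      then show ?thesis using True by simp
    next
      case False
      then have "real n * (c - u) \<le> 0" for n by (intro mult_nonneg_nonpos) auto
      then have "?r n u = 0" for n by (simp add: max_absorb1)
      then show ?thesis using False by simp
    qed
    then show "AE x in lborel. (\<lambda>n. g x * of_real (?r n (exp (- x)))) \<longlonglongrightarrow> g x * of_real (if exp (- x) < c then 1 else 0)"
      by (intro AE_I2 tendsto_intros)
    show "AE x in lborel. norm (g x * of_real (?r n (exp (- x)))) \<le> cmod (g x)" for n
      by (intro AE_I2) (auto simp: norm_mult intro!: mult_left_le)
  qed measurable
  moreover have "(LBINT x. g x * of_real (?r n (exp (- x)))) = 0" for n
    by (rule integral_polynomial_exp_eq_0[OF g pow, where F = "?r n"]) (auto intro!: continuous_intros)
  ultimately show ?thesis by (simp only: tendsto_const_iff LIMSEQ_const_iff)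
qed

text \<open>Vanishing of the Laplace transform at \<open>a + 1, a + 2, \<dots>\<close> says that \<open>f(x) e\<^bsup>-(a+1)x\<^esup>\<close> is orthogonal to
  all polynomials in \<open>e\<^bsup>-x\<^esup>\<close>, hence by Weierstrass to all continuous functions of \<open>e\<^bsup>-x\<^esup>\<close> and to intervals.\<close>

lemma real_laplace_eq_0:
  assumes f: "f \<in> causal" and l: "\<And>z. a < z \<Longrightarrow> real_laplace f z 0"
  shows "AE x in lborel. f x = 0"
proof -
  note [measurable] = causalD(1)[OF f]
  define g where "g x = f x * of_real (exp (- (a + 1) * x))" for x
  have g: "integrable lborel g" "\<And>x. x \<le> 0 \<Longrightarrow> g x = 0"
    using l[of "a + 1"] causalD(2)[OF f] by (auto simp: real_laplace_def g_def[abs_def])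
  have pow: "(LBINT x. g x * of_real (exp (- x) ^ n)) = 0" for n :: nat
  proof -
    have "exp (- (a + 1) * x) * exp (- x) ^ n = exp (- (a + 1 + real n) * x)" for x
      by (simp add: exp_of_nat_mult[symmetric] exp_add[symmetric] algebra_simps)
    then have "g x * of_real (exp (- x) ^ n) = f x * of_real (exp (- (a + 1 + real n) * x))" for x
      unfolding g_def mult.assoc of_real_mult[symmetric] by (simp only:)
    then show ?thesis using l[of "a + 1 + real n"] by (simp only: real_laplace_def)
  qed
  have "AE x in lborel. cutoff (real S) g x = 0" for S :: nat
  proof (rule AE_eq_0_if_interval_integrals)
    show "square_integrable lborel (cutoff (real S) g)"
    proof (rule square_integrable_dominated(1)[OF square_integrable_cmult[OF causalD(3)[OF f]]])
      show "cutoff (real S) g \<in> borel_measurable lborel" using g(1) by auto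
      show "AE x in lborel. cmod (cutoff (real S) g x) \<le> cmod (of_real (exp (\<bar>a + 1\<bar> * real S)) * cutoff (real S) f x)"
      proof (rule AE_I2)
        fix x
        have "exp (- (a + 1) * x) \<le> exp (\<bar>a + 1\<bar> * real S)" if "0 < x" "x \<le> real S"
        proof -
          have "- (a + 1) * x \<le> \<bar>a + 1\<bar> * x" using that by (intro mult_right_mono) auto
          also have "\<dots> \<le> \<bar>a + 1\<bar> * real S" using that by (intro mult_left_mono) auto
          finally show ?thesis by simp
        qed
        then show "cmod (cutoff (real S) g x) \<le> cmod (of_real (exp (\<bar>a + 1\<bar> * real S)) * cutoff (real S) f x)"
          using causalD(2)[OF f, of x]
          by (cases "x \<le> 0") (auto simp: cutoff_def g_def norm_mult mult.commute intro!: mult_left_mono)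
      qed
    qed
    fix \<alpha> \<beta> :: real assume "\<alpha> \<le> \<beta>"
    define p q where "p = min \<alpha> (real S)" and "q = min \<beta> (real S)"
    let ?L = "\<lambda>c x. g x * of_real (if exp (- x) < exp (- c) then 1 else 0)"
    have i: "integrable lborel (?L c)" for c
      by (rule Bochner_Integration.integrable_bound[OF g(1)]) (use g(1) in auto)
    have "indicator {\<alpha><..\<beta>} x * cutoff (real S) g x = ?L p x - ?L q x" for x
      using \<open>\<alpha> \<le> \<beta>\<close> by (auto simp: p_def q_def cutoff_def indicator_def min_def)
    then have "(LBINT x. indicator {\<alpha><..\<beta>} x * cutoff (real S) g x) = (LBINT x. ?L p x) - (LBINT x. ?L q x)"
      using Bochner_Integration.integral_diff[OF i i] by presburger
    then show "(LBINT x. indicator {\<alpha><..\<beta>} x * cutoff (real S) g x) = 0"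
      by (simp only: integral_superlevel_eq_0[OF g pow] diff_self)
  qed
  then have "AE x in lborel. \<forall>S::nat. cutoff (real S) g x = 0" by (simp only: AE_all_countable) blast
  then show ?thesis
  proof eventually_elim
    case (elim x)
    obtain S :: nat where "x \<le> real S" using real_arch_simple by blast
    with elim have "g x = 0" by (auto simp: cutoff_def dest: spec[of _ S])
    then show ?case by (simp add: g_def)
  qed
qed

lemma real_laplace_unique:
  assumes f: "f \<in> causal" and g: "g \<in> causal"
    and l: "\<And>z. a < z \<Longrightarrow> real_laplace f z (w z)" "\<And>z. a < z \<Longrightarrow> real_laplace g z (w z)"
  shows "AE x in lborel. f x = g x"
proof -
  have "AE x in lborel. f x + (-1) * g x = 0"
  proof (rule real_laplace_eq_0[OF causal_add[OF f causal_cmult[OF g]]])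
    fix z assume "a < z"
    then show "real_laplace (\<lambda>x. f x + (-1) * g x) z 0"
      using l[of z] by (simp add: real_laplace_def left_diff_distrib)
  qed
  then show ?thesis by eventually_elim simp
qed

section \<open>Functions on the half line\<close>

lemma AE_halfline: "(AE x in halfline. P x) \<longleftrightarrow> (AE x in lborel. 0 < x \<longrightarrow> P x)"
  by (subst AE_restrict_space_iff) (auto simp: AE_completion_iff)

lemma ae_eq_iff: "ae_eq f g \<longleftrightarrow> (AE x in lborel. 0 < x \<longrightarrow> f x = g x)"
  by (simp add: ae_eq_def AE_halfline)

lemma ae_eq_sym:
  assumes "ae_eq f g" shows "ae_eq g f"
  using assms unfolding ae_eq_def by eventually_elim simp

lemma ae_eq_trans:
  assumes "ae_eq f g" "ae_eq g h" shows "ae_eq f h"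
  using assms unfolding ae_eq_def by eventually_elim simp

lemma borel_measurable_halfline: "f \<in> borel_measurable borel \<Longrightarrow> f \<in> borel_measurable halfline"
  by (intro measurable_restrict_space1 measurable_completion) simp

text \<open>Convolutions need Borel functions: for a merely Lebesgue measurable \<open>f\<close>, the function \<open>(x, t) \<mapsto> f(t - x)\<close>
  may fail to be measurable for the product \<open>\<sigma>\<close>-algebra.\<close>

lemma borel_representative:
  fixes f :: "real \<Rightarrow> complex"
  assumes "f \<in> borel_measurable halfline"
  obtains f0 where "f0 \<in> borel_measurable borel" "\<And>x. x \<le> 0 \<Longrightarrow> f0 x = 0" "ae_eq f f0"
proof -
  have "(\<lambda>x. if x \<in> {0<..} then f x else 0) \<in> borel_measurable lebesgue"
    using assms by (subst borel_measurable_if) auto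
  then have "(\<lambda>x. Re (if x \<in> {0<..} then f x else 0)) \<in> borel_measurable (completion lborel)"
    "(\<lambda>x. Im (if x \<in> {0<..} then f x else 0)) \<in> borel_measurable (completion lborel)"
    by simp_all
  from this[THEN completion_ex_borel_measurable_real] obtain u v
    where uv: "u \<in> borel_measurable lborel" "AE x in lborel. Re (if x \<in> {0<..} then f x else 0) = u x"
      "v \<in> borel_measurable lborel" "AE x in lborel. Im (if x \<in> {0<..} then f x else 0) = v x" by blast
  define g where "g x = Complex (u x) (v x)" for x
  have g: "g \<in> borel_measurable lborel" "AE x in lborel. (if x \<in> {0<..} then f x else 0) = g x"
  proof -
    show "g \<in> borel_measurable lborel"
      unfolding g_def[abs_def] Complex_eq using uv(1,3) by simp
    show "AE x in lborel. (if x \<in> {0<..} then f x else 0) = g x"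
      using uv(2,4) by eventually_elim (simp add: g_def complex_eq_iff)
  qed
  show ?thesis
  proof (rule that)
    have "(\<lambda>x. if x \<in> {0<..} then g x else 0) = (\<lambda>x. indicator {0<..} x * g x)" by auto
    then show "(\<lambda>x. if x \<in> {0<..} then g x else 0) \<in> borel_measurable borel" using g(1) by simp
    show "ae_eq f (\<lambda>x. if x \<in> {0<..} then g x else 0)"
      unfolding ae_eq_iff using g(2) by eventually_elim auto
  qed auto
qed

lemma integral_halfline:
  fixes f :: "real \<Rightarrow> 'b::{banach, second_countable_topology}"
  assumes "f \<in> borel_measurable borel" "\<And>x. x \<le> 0 \<Longrightarrow> f x = 0"
  shows "(LINT x|halfline. f x) = (LBINT x. f x)" and "integrable halfline f \<longleftrightarrow> integrable lborel f"
proof -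
  have eq: "(\<lambda>x. indicator {0<..} x *\<^sub>R f x) = f"
    using assms(2) by (auto simp: indicator_def fun_eq_iff)
  show "(LINT x|halfline. f x) = (LBINT x. f x)"
    using assms(1) by (subst integral_restrict_space) (simp_all add: eq integral_completion)
  show "integrable halfline f \<longleftrightarrow> integrable lborel f"
    using assms(1) by (subst integrable_restrict_space) (simp_all add: set_integrable_def eq integrable_completion)
qed

lemma square_integrable_halfline:
  assumes "f \<in> borel_measurable borel" "\<And>x. x \<le> 0 \<Longrightarrow> f x = 0"
  shows "square_integrable halfline f \<longleftrightarrow> square_integrable lborel f" and "norm2 halfline f = norm2 lborel f"
  using integral_halfline[of "\<lambda>x. (cmod (f x))\<^sup>2"] assms borel_measurable_halfline[OF assms(1)]
  by (auto simp: square_integrable_def norm2_def)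

lemma square_integrable_cong_AE:
  assumes "square_integrable M f" "g \<in> borel_measurable M" "AE x in M. f x = g x"
  shows "square_integrable M g"
  by (rule square_integrable_dominated(1)[OF assms(1,2)]) (use assms(3) in \<open>eventually_elim, simp\<close>)

lemma L2_representative:
  assumes "f \<in> L2"
  obtains f0 where "f0 \<in> causal" "square_integrable lborel f0" "ae_eq f f0"
proof -
  have f: "square_integrable halfline f" using assms by (simp add: L2_iff)
  obtain f0 where f0: "f0 \<in> borel_measurable borel" "\<And>x. x \<le> 0 \<Longrightarrow> f0 x = 0" "ae_eq f f0"
    using borel_representative[OF square_integrable_measurable[OF f]] by blast
  have "square_integrable halfline f0"
    using square_integrable_cong_AE[OF f borel_measurable_halfline[OF f0(1)]] f0(3) by (simp add: ae_eq_def)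
  then have s: "square_integrable lborel f0" by (simp add: square_integrable_halfline[OF f0(1,2)])
  have "square_integrable lborel (cutoff b f0)" for b
    by (rule square_integrable_dominated(1)[OF s]) (use f0(1) in \<open>auto simp: cutoff_def\<close>)
  then show ?thesis using that f0 s by (auto simp: causal_def)
qed

lemma causal_L2:
  assumes "f \<in> causal" "square_integrable lborel f" shows "f \<in> L2"
  using assms square_integrable_halfline(1)[OF causalD(1)[OF assms(1)] causalD(2)[OF assms(1)]]
  by (simp add: L2_iff)

lemma L2_add: "f \<in> L2 \<Longrightarrow> g \<in> L2 \<Longrightarrow> (\<lambda>x. f x + g x) \<in> L2"
  by (simp add: L2_iff square_integrable_add)

lemma L2_diff: "f \<in> L2 \<Longrightarrow> g \<in> L2 \<Longrightarrow> (\<lambda>x. f x - g x) \<in> L2"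
  by (simp add: L2_iff square_integrable_diff)

lemma L2_cmult: "f \<in> L2 \<Longrightarrow> (\<lambda>x. c * f x) \<in> L2"
  by (simp add: L2_iff square_integrable_cmult)

lemma L2_measurable: "f \<in> L2 \<Longrightarrow> f \<in> borel_measurable halfline"
  by (simp add: L2_def)

lemma L2_norm_cong:
  "f \<in> L2 \<Longrightarrow> g \<in> L2 \<Longrightarrow> ae_eq f g \<Longrightarrow> L2_norm f = L2_norm g"
  unfolding L2_norm_eq by (intro norm2_cong_AE) (auto simp: L2_measurable ae_eq_def)

lemma L2_norm_zero_iff: "f \<in> L2 \<Longrightarrow> L2_norm f = 0 \<longleftrightarrow> ae_eq f (\<lambda>x. 0)"
  by (simp add: L2_norm_eq L2_iff norm2_eq_0_iff ae_eq_def)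

lemma L2_norm_triangle: "f \<in> L2 \<Longrightarrow> g \<in> L2 \<Longrightarrow> L2_norm (\<lambda>x. f x + g x) \<le> L2_norm f + L2_norm g"
  by (simp add: L2_norm_eq L2_iff norm2_triangle)

lemma L2_norm_diff_triangle:
  "f \<in> L2 \<Longrightarrow> g \<in> L2 \<Longrightarrow> h \<in> L2 \<Longrightarrow>
    L2_norm (\<lambda>x. f x - h x) \<le> L2_norm (\<lambda>x. f x - g x) + L2_norm (\<lambda>x. g x - h x)"
  by (simp add: L2_norm_eq L2_iff norm2_diff_triangle)

lemma pairing_bound:
  assumes "f \<in> L2" "g \<in> L2" shows "cmod (pairing f g) \<le> L2_norm f * L2_norm g"
  using Cauchy_Schwarz_integral(4)[of halfline f g] assms by (simp add: pairing_def L2_norm_eq L2_iff)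

lemma pairing_integrable:
  assumes "f \<in> L2" "g \<in> L2" shows "integrable halfline (\<lambda>x. f x * g x)"
  using Cauchy_Schwarz_integral(1)[of halfline f g] assms by (simp add: L2_iff)

lemma pairing_linear:
  assumes "f \<in> L2" "g \<in> L2" "q \<in> L2"
  shows "pairing (\<lambda>x. f x + g x) q = pairing f q + pairing g q"
    and "pairing (\<lambda>x. f x - g x) q = pairing f q - pairing g q"
    and "pairing (\<lambda>x. c * f x) q = c * pairing f q"
  using pairing_integrable[OF assms(1,3)] pairing_integrable[OF assms(2,3)]
  by (simp_all add: pairing_def distrib_right left_diff_distrib mult.assoc)

lemma pairing_cong:
  assumes "f \<in> L2" "g \<in> L2" "f' \<in> L2" "g' \<in> L2" "ae_eq f f'" "ae_eq g g'"
  shows "pairing f g = pairing f' g'"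
  unfolding pairing_def
proof (rule integral_cong_AE)
  show "AE x in halfline. f x * g x = f' x * g' x"
    using assms(5,6) unfolding ae_eq_def by eventually_elim simp
qed (intro borel_measurable_times L2_measurable assms)+

lemma pairing_borel:
  assumes "f \<in> borel_measurable borel" "g \<in> borel_measurable borel" "\<And>x. x \<le> 0 \<Longrightarrow> f x * g x = 0"
  shows "pairing f g = (LBINT x. f x * g x)"
  unfolding pairing_def by (rule integral_halfline(1)) (use assms in auto)

section \<open>Absolutely continuous functions\<close>

lemma division_sum_over_tags:
  fixes h :: "real \<Rightarrow> complex"
  assumes p: "p tagged_partial_division_of {a..b}"
  shows "(\<Sum>(x, K)\<in>p. cmod (h (Sup K) - h (Inf K))) = (\<Sum>K\<in>snd ` p. cmod (h (Sup K) - h (Inf K)))"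
proof -
  define d where "d K = (if measure lborel K = 0 then 0 else cmod (h (Sup K) - h (Inf K)))" for K :: "real set"
  have d: "cmod (h (Sup K) - h (Inf K)) = d K" if "(x, K) \<in> p" for x K
  proof -
    obtain u v where K: "K = cbox u v" "x \<in> K"
      using p \<open>(x, K) \<in> p\<close> unfolding tagged_partial_division_of_def by blast
    then have "u \<le> v" by auto
    then show ?thesis using K by (auto simp: d_def)
  qed
  have "(\<Sum>(x, K)\<in>p. cmod (h (Sup K) - h (Inf K))) = (\<Sum>(x, K)\<in>p. d K)"
    by (rule sum.cong) (use d in auto)
  also have "\<dots> = sum d (snd ` p)"
    by (rule sum.over_tagged_division_lemma[OF tagged_partial_division_of_Union_self[OF p]])
      (simp add: d_def content_eq_0_interior)
  also have "\<dots> = (\<Sum>K\<in>snd ` p. cmod (h (Sup K) - h (Inf K)))"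
    by (rule sum.cong) (use d in auto)
  finally show ?thesis .
qed

text \<open>The fundamental theorem of calculus for absolutely continuous functions: in a fine tagged
  division, the intervals whose tags lie in the exceptional null set are contained in an open set
  of small measure, so absolute continuity controls their contribution; the others satisfy the
  straddle estimate.\<close>

lemma absolutely_cont_FTC:
  assumes ac: "absolutely_cont_on {0..b} h"
    and der: "AE x in halfline. (h has_vector_derivative f x) (at x)"
    and ab: "0 \<le> a" "a \<le> b"
  shows "(f has_integral (h b - h a)) {a..b}"
proof -
  obtain N0 where N0: "{x. \<not> (0 < x \<longrightarrow> (h has_vector_derivative f x) (at x))} \<subseteq> N0"
    "emeasure lborel N0 = 0" "N0 \<in> sets lborel"
    using AE_E[OF der[unfolded AE_halfline]] by auto
  define N where "N = insert 0 N0"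
  have neg: "negligible N"
    using N0(2,3) by (simp add: N_def negligible_iff_null_sets[of N0] null_sets_completionI null_setsI)
  have derN: "(h has_vector_derivative f x) (at x)" if "x \<notin> N" "0 \<le> x" for x
    using N0(1) that by (auto simp: N_def less_le)
  define g where "g x = (if x \<in> N then 0 else f x)" for x
  have "(g has_integral (h b - h a)) {a..b}"
    unfolding has_integral_real
  proof (intro allI impI)
    fix e :: real assume e: "e > 0"
    have "\<exists>\<delta>>0. \<forall>D. D division_of \<Union>D \<and> \<Union>D \<subseteq> {0..b} \<and> (\<Sum>I\<in>D. Sup I - Inf I) < \<delta> \<longrightarrow>
        (\<Sum>I\<in>D. cmod (h (Sup I) - h (Inf I))) < e / 2"
      using ac half_gt_zero[OF e] unfolding absolutely_cont_on_def by blast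
    then obtain \<delta> where \<delta>: "\<delta> > 0" "\<And>D. D division_of \<Union>D \<Longrightarrow> \<Union>D \<subseteq> {0..b} \<Longrightarrow> (\<Sum>I\<in>D. Sup I - Inf I) < \<delta> \<Longrightarrow>
        (\<Sum>I\<in>D. cmod (h (Sup I) - h (Inf I))) < e / 2"
      by blast
    obtain U where U: "open U" "N \<subseteq> U" "U - N \<in> lmeasurable" "emeasure lebesgue (U - N) < ennreal \<delta>"
      using sets_lebesgue_outer_open[of N \<delta>] neg \<delta>(1) negligible_imp_sets by blast
    have Um: "U \<in> lmeasurable" "measure lebesgue U < \<delta>"
    proof -
      have "U = (U - N) \<union> N" using U(2) by auto
      then show "U \<in> lmeasurable"
        using fmeasurable.Un[OF U(3) negligible_imp_measurable[OF neg]] by simp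
      have "measure lebesgue (U - N) < \<delta>"
        using U(4) \<delta>(1) by (simp add: emeasure_eq_measure2[OF U(3)] ennreal_less_iff)
      moreover have "measure lebesgue U = measure lebesgue (U - N)"
        using measure_Un_null_set[OF fmeasurableD[OF U(3)] neg[unfolded negligible_iff_null_sets]]
          \<open>U = (U - N) \<union> N\<close> by simp
      ultimately show "measure lebesgue U < \<delta>" by simp
    qed
    define \<eta> where "\<eta> = e / (4 * (b - a + 1))"
    have \<eta>: "\<eta> > 0" "\<eta> * (b - a) < e / 2"
    proof -
      show "\<eta> > 0" using e ab by (simp add: \<eta>_def)
      have "\<eta> * (b - a) = e / 4 * ((b - a) / (b - a + 1))" by (simp add: \<eta>_def)
      also have "\<dots> \<le> e / 4 * 1" using e ab by (intro mult_left_mono) auto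
      finally show "\<eta> * (b - a) < e / 2" using e by simp
    qed
    have "\<exists>r>0. (x \<in> N \<longrightarrow> ball x r \<subseteq> U) \<and> (x \<notin> N \<and> 0 \<le> x \<longrightarrow>
        (\<forall>y. \<bar>y - x\<bar> < r \<longrightarrow> cmod (h y - h x - (y - x) *\<^sub>R f x) \<le> \<eta> * \<bar>y - x\<bar>))" for x
    proof (cases "x \<in> N")
      case True
      then obtain r where "r > 0" "ball x r \<subseteq> U" using U(1,2) openE by blast
      then show ?thesis using True by (intro exI[of _ r]) auto
    next
      case False
      show ?thesis
      proof (cases "0 \<le> x")
        case True
        then have "(h has_derivative (\<lambda>y. y *\<^sub>R f x)) (at x)"
          using derN[OF False] by (simp add: has_vector_derivative_def)
        then obtain d where "d > 0" "\<And>y. norm (y - x) < d \<Longrightarrow> cmod (h y - h x - (y - x) *\<^sub>R f x) \<le> \<eta> * norm (y - x)"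
          using \<eta>(1) unfolding has_derivative_at_alt by blast
        then show ?thesis using False by (intro exI[of _ d]) auto
      next
        case False
        then show ?thesis using \<open>x \<notin> N\<close> by (intro exI[of _ 1]) auto
      qed
    qed
    then obtain r where r: "\<And>x. r x > 0" "\<And>x. x \<in> N \<Longrightarrow> ball x (r x) \<subseteq> U"
      "\<And>x y. x \<notin> N \<Longrightarrow> 0 \<le> x \<Longrightarrow> \<bar>y - x\<bar> < r x \<Longrightarrow> cmod (h y - h x - (y - x) *\<^sub>R f x) \<le> \<eta> * \<bar>y - x\<bar>"
      by metis
    show "\<exists>\<gamma>. gauge \<gamma> \<and> (\<forall>p. p tagged_division_of {a..b} \<and> \<gamma> fine p \<longrightarrow>
        norm ((\<Sum>(x, k)\<in>p. measure lborel k *\<^sub>R g x) - (h b - h a)) < e)"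
    proof (intro exI conjI allI impI)
      show "gauge (\<lambda>x. ball x (r x))" using r(1) by (simp add: gauge_ball_dependent)
      fix p assume "p tagged_division_of {a..b} \<and> (\<lambda>x. ball x (r x)) fine p"
      then have p: "p tagged_division_of {a..b}" and fine: "\<And>x K. (x, K) \<in> p \<Longrightarrow> K \<subseteq> ball x (r x)"
        by (auto simp: fine_def)
      have fin: "finite p" using p by (rule tagged_division_of_finite)
      have K: "\<exists>u v. K = {u..v} \<and> u \<le> x \<and> x \<le> v \<and> a \<le> u \<and> v \<le> b" if xK: "(x, K) \<in> p" for x K
      proof -
        obtain u v where uv: "K = cbox u v" using tagged_division_ofD(4)[OF p xK] by blast
        then have "u \<le> x" "x \<le> v" using tagged_division_ofD(2)[OF p xK] by auto
        then show ?thesis using uv tagged_division_ofD(3)[OF p xK] by auto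
      qed
      \<comment> \<open>the intervals with tags in the exceptional set\<close>
      define A where "A = {(x, K) \<in> p. x \<in> N}"
      have A: "A \<subseteq> p" by (auto simp: A_def)
      have pA: "A tagged_partial_division_of {a..b}"
        by (rule tagged_partial_division_subset[OF _ A]) (use p in \<open>simp add: tagged_division_of_def\<close>)
      have "(\<Sum>(x, K)\<in>A. cmod (h (Sup K) - h (Inf K))) < e / 2"
        unfolding division_sum_over_tags[OF pA]
      proof (rule \<delta>(2))
        show div: "snd ` A division_of \<Union> (snd ` A)" by (rule partial_division_of_tagged_division[OF pA])
        show "\<Union> (snd ` A) \<subseteq> {0..b}"
        proof (rule Union_least)
          fix I assume "I \<in> snd ` A"
          then obtain x where "(x, I) \<in> p" using A by auto
          with K obtain u v where "I = {u..v}" "a \<le> u" "v \<le> b" by blast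
          then show "I \<subseteq> {0..b}" using ab(1) by auto
        qed
        have "(\<Sum>I\<in>snd ` A. Sup I - Inf I) = (\<Sum>I\<in>snd ` A. measure lebesgue I)"
        proof (rule sum.cong[OF refl])
          fix I assume "I \<in> snd ` A"
          then obtain x where "(x, I) \<in> p" using A by auto
          with K obtain u v where "I = {u..v}" "u \<le> x" "x \<le> v" by blast
          then show "Sup I - Inf I = measure lebesgue I" by (simp add: measure_completion)
        qed
        also have "\<dots> = measure lebesgue (\<Union> (snd ` A))"
          using content_division[OF div] by simp
        also have "\<dots> \<le> measure lebesgue U"
        proof (rule measure_mono_fmeasurable)
          show "\<Union> (snd ` A) \<subseteq> U"
          proof (rule Union_least)
            fix I assume "I \<in> snd ` A"
            then obtain x where "(x, I) \<in> p" "x \<in> N" by (auto simp: A_def)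
            then show "I \<subseteq> U" using fine[of x I] r(2)[of x] by blast
          qed
          show "\<Union> (snd ` A) \<in> sets lebesgue"
            using lmeasurable_division[OF div] by (simp add: fmeasurableD)
        qed (rule Um(1))
        finally show "(\<Sum>I\<in>snd ` A. Sup I - Inf I) < \<delta>" using Um(2) by simp
      qed
      moreover have "(\<Sum>(x, K)\<in>p - A. cmod (measure lborel K *\<^sub>R g x - (h (Sup K) - h (Inf K)))) \<le> \<eta> * (b - a)"
      proof -
        have "(\<Sum>(x, K)\<in>p - A. cmod (measure lborel K *\<^sub>R g x - (h (Sup K) - h (Inf K)))) \<le> (\<Sum>(x, K)\<in>p - A. \<eta> * measure lborel K)"
        proof (rule sum_mono, clarify)
          fix x K assume xK: "(x, K) \<in> p" "(x, K) \<notin> A"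
          then obtain u v where uv: "K = {u..v}" "u \<le> x" "x \<le> v" "a \<le> u" using K by blast
          have xN: "x \<notin> N" "0 \<le> x" using xK uv ab by (auto simp: A_def)
          have "u \<in> ball x (r x)" "v \<in> ball x (r x)"
            using fine[OF xK(1)] uv by (auto simp del: mem_ball)
          then have "\<bar>u - x\<bar> < r x" "\<bar>v - x\<bar> < r x"
            by (simp_all add: dist_real_def abs_minus_commute)
          then have "cmod (h u - h x - (u - x) *\<^sub>R f x) \<le> \<eta> * \<bar>u - x\<bar>" "cmod (h v - h x - (v - x) *\<^sub>R f x) \<le> \<eta> * \<bar>v - x\<bar>"
            using r(3)[OF xN] by auto
          then have "cmod ((h u - h x - (u - x) *\<^sub>R f x) - (h v - h x - (v - x) *\<^sub>R f x)) \<le> \<eta> * (x - u) + \<eta> * (v - x)"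
            using uv by (intro order_trans[OF norm_triangle_ineq4]) auto
          moreover have "(h u - h x - (u - x) *\<^sub>R f x) - (h v - h x - (v - x) *\<^sub>R f x) = (v - u) *\<^sub>R f x - (h v - h u)"
            by (simp add: algebra_simps)
          ultimately show "cmod (measure lborel K *\<^sub>R g x - (h (Sup K) - h (Inf K))) \<le> \<eta> * measure lborel K"
            using uv xN by (simp add: g_def algebra_simps)
        qed
        also have "\<dots> \<le> (\<Sum>(x, K)\<in>p. \<eta> * measure lborel K)"
          using \<eta>(1) by (intro sum_mono2 fin) auto
        also have "\<dots> = \<eta> * (\<Sum>(x, K)\<in>p. measure lborel K)" by (simp add: sum_distrib_left case_prod_unfold)
        also have "\<dots> = \<eta> * (b - a)"
          using additive_content_tagged_division[of p a b] p ab(2) by simp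
        finally show ?thesis .
      qed
      moreover have "(\<Sum>(x, K)\<in>p. measure lborel K *\<^sub>R g x) - (h b - h a)
          = (\<Sum>(x, K)\<in>p. measure lborel K *\<^sub>R g x - (h (Sup K) - h (Inf K)))"
        using additive_tagged_division_1[OF ab(2) p, of h] by (simp add: sum_subtractf case_prod_unfold)
      moreover have "\<dots> = (\<Sum>(x, K)\<in>p - A. measure lborel K *\<^sub>R g x - (h (Sup K) - h (Inf K)))
          + (\<Sum>(x, K)\<in>A. measure lborel K *\<^sub>R g x - (h (Sup K) - h (Inf K)))"
        by (rule sum.subset_diff[OF A fin])
      moreover have "cmod (\<Sum>(x, K)\<in>A. measure lborel K *\<^sub>R g x - (h (Sup K) - h (Inf K))) \<le> (\<Sum>(x, K)\<in>A. cmod (h (Sup K) - h (Inf K)))"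
        by (rule sum_norm_le) (auto simp: A_def g_def norm_minus_commute)
      moreover have "cmod (\<Sum>(x, K)\<in>p - A. measure lborel K *\<^sub>R g x - (h (Sup K) - h (Inf K)))
          \<le> (\<Sum>(x, K)\<in>p - A. cmod (measure lborel K *\<^sub>R g x - (h (Sup K) - h (Inf K))))"
        by (rule sum_norm_le) auto
      ultimately show "norm ((\<Sum>(x, k)\<in>p. measure lborel k *\<^sub>R g x) - (h b - h a)) < e"
        using \<eta>(2) norm_triangle_ineq[of "\<Sum>(x, K)\<in>p - A. measure lborel K *\<^sub>R g x - (h (Sup K) - h (Inf K))"
            "\<Sum>(x, K)\<in>A. measure lborel K *\<^sub>R g x - (h (Sup K) - h (Inf K))"] by simp
    qed
  qed
  then show ?thesis
    by (rule has_integral_spike[OF neg, rotated]) (simp add: g_def)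
qed

text \<open>The primitive is expressed through convolution with the unit step, which makes its continuity available.\<close>

lemma loc_abs_cont_primitive:
  assumes l: "loc_abs_cont_deriv f f'" and f': "ae_eq f' g" and g: "g \<in> causal"
  obtains c where "ae_eq f (\<lambda>x. c + conv unit_step g x)"
proof -
  obtain h where h: "ae_eq f h" "\<And>b. b > 0 \<Longrightarrow> absolutely_cont_on {0..b} h"
    "AE x in halfline. (h has_vector_derivative f' x) (at x)"
    using l unfolding loc_abs_cont_deriv_def by auto
  have der: "AE x in halfline. (h has_vector_derivative g x) (at x)"
    using h(3) f' unfolding ae_eq_def by eventually_elim simp
  have "h x = h 0 + conv unit_step g x" if x: "0 < x" for x
  proof -
    have "(g has_integral (h x - h 0)) {0..x}"
      using absolutely_cont_FTC[OF h(2)[OF x] der order_refl] x by simp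
    moreover have "set_integrable lborel {0..x} g"
    proof -
      have "(\<lambda>y. indicator {0..x} y *\<^sub>R g y) = cutoff x g"
        using causalD(2)[OF g] by (auto simp: cutoff_def indicator_def fun_eq_iff)
      then show ?thesis using causal_locally_integrable[OF g, of x] by (simp add: set_integrable_def)
    qed
    ultimately have "(LBINT y:{0..x}. g y) = h x - h 0"
      using set_borel_integral_eq_integral(2)[of "{0..x}" g] by (simp add: integral_unique)
    moreover have "conv unit_step g x = (LBINT y:{0..x}. g y)"
      unfolding conv_def set_lebesgue_integral_def
    proof (rule integral_cong_AE)
      show "AE y in lborel. unit_step (x - y) * g y = indicator {0..x} y *\<^sub>R g y"
        using AE_lborel_singleton[of x]
        by eventually_elim (use causalD(2)[OF g] in \<open>auto simp: unit_step_def indicator_def\<close>)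
    qed (use causalD(1)[OF g] causalD(1)[OF unit_step_causal] in auto)
    ultimately show ?thesis by simp
  qed
  then have "ae_eq f (\<lambda>x. h 0 + conv unit_step g x)"
    using h(1) unfolding ae_eq_iff by (auto elim!: eventually_mono)
  then show ?thesis by (rule that)
qed

section \<open>Right continuous curves\<close>

text \<open>The supremum of the times up to which \<open>|\<phi>(s) - \<phi>(a)| \<le> e (s - a)\<close> holds is \<open>b\<close>: by continuity the bound holds at
  the supremum, and the right derivative extends it beyond.\<close>

lemma zero_right_derivative_imp_const:
  fixes \<phi> :: "real \<Rightarrow> complex"
  assumes cont: "continuous_on {a..b} \<phi>" and ab: "a \<le> b"
    and der: "\<And>t e. a \<le> t \<Longrightarrow> t < b \<Longrightarrow> 0 < e \<Longrightarrow> \<exists>d>0. \<forall>h. 0 < h \<and> h < d \<longrightarrow> cmod (\<phi> (t + h) - \<phi> t) \<le> e * h"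
  shows "\<phi> b = \<phi> a"
proof -
  have "cmod (\<phi> b - \<phi> a) \<le> e * (b - a)" if e: "e > 0" for e
  proof -
    define \<psi> where "\<psi> s = cmod (\<phi> s - \<phi> a) - e * (s - a)" for s
    have c\<psi>: "continuous_on {a..b} \<psi>" unfolding \<psi>_def by (intro continuous_intros cont)
    define S where "S = {t. a \<le> t \<and> t \<le> b \<and> (\<forall>s. a \<le> s \<and> s \<le> t \<longrightarrow> \<psi> s \<le> 0)}"
    have aS: "a \<in> S" using ab by (auto simp: S_def \<psi>_def)
    have bS: "bdd_above S" by (rule bdd_aboveI[of _ b]) (auto simp: S_def)
    define c where "c = Sup S"
    have c: "a \<le> c" "c \<le> b"
      using aS bS by (auto simp: c_def S_def intro: cSup_upper cSup_least)
    have below: "\<psi> s \<le> 0" if s: "a \<le> s" "s < c" for s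
    proof -
      obtain t where "t \<in> S" "s < t" using s(2) less_cSup_iff[OF _ bS, of s] aS unfolding c_def by blast
      then show ?thesis using s(1) by (auto simp: S_def)
    qed
    have "\<psi> c \<le> 0"
    proof (cases "c = a")
      case True then show ?thesis by (simp add: \<psi>_def)
    next
      case False
      then have "a < c" using c by simp
      have "(\<psi> \<longlongrightarrow> \<psi> c) (at c within {a..b})"
        using c\<psi> c by (simp add: continuous_on_def)
      then have "(\<psi> \<longlongrightarrow> \<psi> c) (at c within {a..<c})"
        by (rule tendsto_within_subset) (use c in auto)
      moreover have "at c within {a..<c} \<noteq> bot"
        using \<open>a < c\<close> by (simp add: trivial_limit_within islimpt_greaterThanLessThan2[THEN islimpt_subset])
      moreover have "\<forall>\<^sub>F s in at c within {a..<c}. \<psi> s \<le> 0"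
        unfolding eventually_at_filter by (intro always_eventually) (use below in auto)
      ultimately show ?thesis by (intro tendsto_upperbound)
    qed
    then have cS: "c \<in> S" using c below by (auto simp: S_def less_le)
    have "c = b"
    proof (rule ccontr)
      assume "c \<noteq> b"
      then have "c < b" using c by simp
      then obtain d where d: "d > 0" "\<And>h. 0 < h \<Longrightarrow> h < d \<Longrightarrow> cmod (\<phi> (c + h) - \<phi> c) \<le> e * h"
        using der[of c e] c e by auto
      define k where "k = min (d / 2) (b - c)"
      have k: "0 < k" "k < d" "c + k \<le> b" using d(1) \<open>c < b\<close> by (auto simp: k_def)
      have "\<psi> s \<le> 0" if "a \<le> s" "s \<le> c + k" for s
      proof (cases "s \<le> c")
        case True then show ?thesis using cS that by (auto simp: S_def)
      next
        case False
        have "cmod (\<phi> s - \<phi> a) \<le> cmod (\<phi> s - \<phi> c) + cmod (\<phi> c - \<phi> a)"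
          using norm_triangle_ineq[of "\<phi> s - \<phi> c" "\<phi> c - \<phi> a"] by simp
        then show ?thesis
          using d(2)[of "s - c"] False that k \<open>\<psi> c \<le> 0\<close> by (simp add: \<psi>_def algebra_simps)
      qed
      then have "c + k \<in> S" using k c by (auto simp: S_def)
      then show False using cSup_upper[OF _ bS, of "c + k"] k by (simp add: c_def)
    qed
    then show ?thesis using \<open>\<psi> c \<le> 0\<close> by (simp add: \<psi>_def)
  qed
  note small = this
  have "cmod (\<phi> b - \<phi> a) \<le> 0 + e" if "e > 0" for e
  proof -
    have "cmod (\<phi> b - \<phi> a) \<le> e / (b - a + 1) * (b - a)"
      by (rule small) (use that ab in auto)
    also have "\<dots> \<le> e" using that ab by (simp add: field_simps)
    finally show ?thesis by simp
  qed
  then have "cmod (\<phi> b - \<phi> a) \<le> 0" by (rule field_le_epsilon)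
  then show ?thesis by simp
qed

text \<open>Right continuity yields, inside any interval, a smaller one on which the oscillation is as small as desired;
  the common point of a nested sequence of such intervals is a point of continuity.\<close>

lemma right_continuous_imp_continuity_point:
  fixes m :: "real \<Rightarrow> real \<Rightarrow> real"
  assumes tri: "\<And>x y z. m x y \<le> m z x + m z y"
    and right: "\<And>t e. a \<le> t \<Longrightarrow> 0 < e \<Longrightarrow> \<exists>d>0. \<forall>h. 0 < h \<and> h < d \<longrightarrow> m t (t + h) < e"
    and ab: "a < b"
  obtains t0 where "a < t0" "t0 < b" "\<And>e. 0 < e \<Longrightarrow> \<exists>d>0. \<forall>s. \<bar>s - t0\<bar> < d \<longrightarrow> m s t0 < e"
proof -
  define P where "P n I \<longleftrightarrow> a < fst I \<and> fst I < snd I \<and> snd I < b \<and>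
    (\<forall>x y. fst I \<le> x \<and> x \<le> snd I \<and> fst I \<le> y \<and> y \<le> snd I \<longrightarrow> m x y < 1 / real (Suc n))" for n :: nat and I
  have step: "\<exists>J. P n J \<and> c < fst J \<and> snd J < c'" if c: "a \<le> c" "c < c'" "c' \<le> b" for c c' n
  proof -
    define w where "w = 1 / real (Suc n)"
    have "0 < w" by (simp add: w_def)
    obtain d where d: "d > 0" "\<And>h. 0 < h \<Longrightarrow> h < d \<Longrightarrow> m c (c + h) < w / 2"
      using right[of c "w / 2"] c \<open>0 < w\<close> by auto
    define k where "k = min d (c' - c)"
    have k: "k > 0" "k \<le> d" "c + k \<le> c'" using d c by (auto simp: k_def)
    have "m x y < 1 / real (Suc n)" if "c + k / 3 \<le> x" "x \<le> c + k / 2" "c + k / 3 \<le> y" "y \<le> c + k / 2" for x y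
    proof -
      have "m c x < w / 2" "m c y < w / 2" using d(2)[of "x - c"] d(2)[of "y - c"] that k by simp_all
      then have "m x y < w" using tri[of x y c] by linarith
      then show ?thesis unfolding w_def .
    qed
    then show ?thesis using k c by (intro exI[of _ "(c + k / 3, c + k / 2)"]) (auto simp: P_def)
  qed
  obtain I where I: "\<And>n. P n (I n)" "\<And>n. fst (I n) < fst (I (Suc n)) \<and> snd (I (Suc n)) < snd (I n)"
  proof (rule dependent_nat_choice[of P "\<lambda>n I J. fst I < fst J \<and> snd J < snd I", THEN exE])
    show "\<exists>J. P 0 J" using step[of a b 0] ab by auto
    show "\<exists>J. P (Suc n) J \<and> fst I < fst J \<and> snd J < snd I" if "P n I" for I n
      using step[of "fst I" "snd I" "Suc n"] that by (auto simp: P_def)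
  qed (use that in blast)
  have inc: "fst (I n) \<le> fst (I k)" "snd (I k) \<le> snd (I n)" if "n \<le> k" for n k
    using lift_Suc_mono_le[of "\<lambda>n. fst (I n)" n k] lift_Suc_antimono_le[of "\<lambda>n. snd (I n)" n k]
      that I(2) by (auto simp: less_imp_le)
  have lr: "fst (I n) \<le> snd (I k)" for n k
  proof -
    have "fst (I n) \<le> fst (I (max n k))" "snd (I (max n k)) \<le> snd (I k)" using inc by auto
    moreover have "fst (I (max n k)) < snd (I (max n k))" using I(1) by (auto simp: P_def)
    ultimately show ?thesis by simp
  qed
  define t0 where "t0 = (SUP n. fst (I n))"
  have bd: "bdd_above (range (\<lambda>n. fst (I n)))" using lr by (intro bdd_aboveI[of _ "snd (I 0)"]) auto
  have t0: "fst (I n) \<le> t0" "t0 \<le> snd (I n)" for n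
    using lr bd by (auto simp: t0_def intro: cSUP_upper cSUP_least)
  have t0': "fst (I n) < t0" "t0 < snd (I n)" for n
    using t0[of "Suc n"] I(2)[of n] by auto
  show ?thesis
  proof (rule that)
    show "a < t0" "t0 < b" using t0'[of 0] I(1)[of 0] by (auto simp: P_def)
    fix e :: real assume "0 < e"
    then obtain n where n: "1 / real (Suc n) < e" using nat_approx_posE by blast
    have "m s t0 < e" if "\<bar>s - t0\<bar> < min (t0 - fst (I n)) (snd (I n) - t0)" for s
    proof -
      have "fst (I n) \<le> s" "s \<le> snd (I n)" using that by (auto simp: abs_less_iff)
      then have "m s t0 < 1 / real (Suc n)" using I(1)[of n] t0[of n] unfolding P_def by blast
      then show ?thesis using n by simp
    qed
    then show "\<exists>d>0. \<forall>s. \<bar>s - t0\<bar> < d \<longrightarrow> m s t0 < e"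
      using t0'[of n] by (intro exI[of _ "min (t0 - fst (I n)) (snd (I n) - t0)"]) auto
  qed
qed

section \<open>Semigroups generated by a transport operator\<close>

definition window :: "real \<Rightarrow> real \<Rightarrow> real \<Rightarrow> complex" where
  "window p r x = (if p < x \<and> x \<le> r then 1 else 0)"

lemma window_measurable [measurable]: "window p r \<in> borel_measurable borel"
proof -
  have "window p r = indicator {p<..r}" by (auto simp: window_def indicator_def)
  then show ?thesis by simp
qed

lemma window_L2:
  assumes "0 \<le> p" "p \<le> r"
  shows "window p r \<in> L2" and "L2_norm (window p r) = sqrt (r - p)"
proof -
  have w: "window p r x = 0" if "x \<le> 0" for x using that assms by (simp add: window_def)
  have s: "square_integrable lborel (window p r)"
    by (rule square_integrable_bounded_support[of _ 1 p r]) (auto simp: window_def)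
  then show "window p r \<in> L2"
    using square_integrable_halfline(1)[of "window p r"] w by (simp add: L2_iff)
  have "(\<lambda>x. (cmod (window p r x))\<^sup>2) = indicator {p<..r}" by (auto simp: window_def indicator_def)
  then have "norm2 lborel (window p r) = sqrt (r - p)"
    using assms(2) by (simp add: norm2_def)
  then show "L2_norm (window p r) = sqrt (r - p)"
    using square_integrable_halfline(2)[of "window p r"] w by (simp add: L2_norm_eq)
qed

lemma pairing_window_continuous:
  assumes u: "u \<in> L2" and U: "ae_eq u U" "continuous_on UNIV U" and pr: "0 \<le> p" "p \<le> r"
  shows "pairing u (window p r) = integral {p..r} U"
proof -
  have [measurable]: "U \<in> borel_measurable borel" using U(2) by (rule borel_measurable_continuous_onI)
  have "pairing u (window p r) = pairing U (window p r)"
    unfolding pairing_def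
  proof (rule integral_cong_AE)
    show "AE x in halfline. u x * window p r x = U x * window p r x"
      using U(1) unfolding ae_eq_def by eventually_elim simp
    show "(\<lambda>x. u x * window p r x) \<in> borel_measurable halfline"
      by (intro borel_measurable_times L2_measurable[OF u] borel_measurable_halfline window_measurable)
    show "(\<lambda>x. U x * window p r x) \<in> borel_measurable halfline"
      by (intro borel_measurable_halfline) measurable
  qed
  also have "\<dots> = (LBINT x. U x * window p r x)"
    by (rule pairing_borel) (use pr in \<open>auto simp: window_def\<close>)
  also have "\<dots> = (LBINT x:{p..r}. U x)"
    unfolding set_lebesgue_integral_def
  proof (rule integral_cong_AE)
    show "AE x in lborel. U x * window p r x = indicator {p..r} x *\<^sub>R U x"
      using AE_lborel_singleton[of p] by eventually_elim (auto simp: window_def indicator_def)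
  qed measurable
  also have "\<dots> = integral {p..r} U"
    by (rule set_borel_integral_eq_integral(2))
      (rule borel_integrable_atLeastAtMost', rule continuous_on_subset[OF U(2)], simp)
  finally show ?thesis .
qed

lemma pairing_window_causal:
  assumes v: "v \<in> L2" and G: "ae_eq v G" "G \<in> causal" and pr: "0 \<le> p" "p \<le> r"
  shows "pairing v (window p r) = conv unit_step G r - conv unit_step G p"
proof -
  note [measurable] = causalD(1)[OF G(2)] causalD(1)[OF unit_step_causal]
  have "pairing v (window p r) = pairing G (window p r)"
    unfolding pairing_def
  proof (rule integral_cong_AE)
    show "AE x in halfline. v x * window p r x = G x * window p r x"
      using G(1) unfolding ae_eq_def by eventually_elim simp
    show "(\<lambda>x. v x * window p r x) \<in> borel_measurable halfline"
      by (intro borel_measurable_times L2_measurable[OF v] borel_measurable_halfline window_measurable)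
    show "(\<lambda>x. G x * window p r x) \<in> borel_measurable halfline"
      by (intro borel_measurable_halfline) measurable
  qed
  also have "\<dots> = (LBINT x. G x * window p r x)"
    by (rule pairing_borel) (use causalD(2)[OF G(2)] in auto)
  also have "\<dots> = (LBINT x. unit_step (r - x) * G x - unit_step (p - x) * G x)"
  proof (rule integral_cong_AE)
    show "AE x in lborel. G x * window p r x = unit_step (r - x) * G x - unit_step (p - x) * G x"
      using AE_lborel_singleton[of p] AE_lborel_singleton[of r]
      by eventually_elim (use pr in \<open>auto simp: window_def unit_step_def\<close>)
  qed measurable
  also have "\<dots> = conv unit_step G r - conv unit_step G p"
    unfolding conv_def by (rule Bochner_Integration.integral_diff) (rule conv_integrable(1)[OF unit_step_causal G(2)])+
  finally show ?thesis .
qed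

lemma integral_right_derivative:
  assumes U: "continuous_on UNIV (U :: real \<Rightarrow> complex)" and e: "0 < e"
  shows "\<exists>d>0. \<forall>h. 0 < h \<and> h < d \<longrightarrow> cmod (integral {c..c + h} U - of_real h * U c) \<le> e * h"
proof -
  have "((\<lambda>y. integral {c..y} U) has_vector_derivative U c) (at c within {c..c + 1})"
    by (rule integral_has_vector_derivative[OF continuous_on_subset[OF U]]) auto
  then obtain d where d: "d > 0" "\<And>y. y \<in> {c..c + 1} \<Longrightarrow> norm (y - c) < d \<Longrightarrow>
      cmod (integral {c..y} U - integral {c..c} U - (y - c) *\<^sub>R U c) \<le> e * norm (y - c)"
    using e unfolding has_vector_derivative_def has_derivative_within_alt by blast
  show ?thesis
    by (rule exI[of _ "min d 1"]) (use d(1) d(2)[of "c + h" for h] in \<open>auto simp: scaleR_conv_of_real\<close>)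
qed

lemma integral_window_shift:
  assumes U: "continuous_on UNIV (U :: real \<Rightarrow> complex)" and "p \<le> r" "0 \<le> h"
  shows "integral {p + h..r + h} U - integral {p..r} U = integral {r..r + h} U - integral {p..p + h} U"
proof -
  have i: "U integrable_on {a..b}" for a b
    by (rule integrable_continuous_interval[OF continuous_on_subset[OF U]]) simp
  have "integral {p..r} U + integral {r..r + h} U = integral {p..r + h} U"
    "integral {p..p + h} U + integral {p + h..r + h} U = integral {p..r + h} U"
    using assms(2,3) by (intro Henstock_Kurzweil_Integration.integral_combine i; simp)+
  then show ?thesis by (simp add: algebra_simps)
qed

locale L2_semigroup =
  fixes T :: "real \<Rightarrow> (real \<Rightarrow> complex) \<Rightarrow> (real \<Rightarrow> complex)"
  assumes C0: "C0_semigroup T"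
begin

lemma T_op: "0 \<le> t \<Longrightarrow> L2_operator (T t)"
  using C0 by (simp add: C0_semigroup_def)

lemma T_L2: "0 \<le> t \<Longrightarrow> f \<in> L2 \<Longrightarrow> T t f \<in> L2"
  using T_op by (auto simp: L2_operator_def)

lemma T_add: "0 \<le> t \<Longrightarrow> f \<in> L2 \<Longrightarrow> g \<in> L2 \<Longrightarrow> ae_eq (T t (\<lambda>x. f x + g x)) (\<lambda>x. T t f x + T t g x)"
  using T_op by (auto simp: L2_operator_def)

lemma T_cmult: "0 \<le> t \<Longrightarrow> f \<in> L2 \<Longrightarrow> ae_eq (T t (\<lambda>x. c * f x)) (\<lambda>x. c * T t f x)"
  using T_op by (auto simp: L2_operator_def)

lemma T_zero: "f \<in> L2 \<Longrightarrow> ae_eq (T 0 f) f"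
  using C0 by (simp add: C0_semigroup_def)

lemma T_time_add: "0 \<le> s \<Longrightarrow> 0 \<le> t \<Longrightarrow> f \<in> L2 \<Longrightarrow> ae_eq (T (s + t) f) (T s (T t f))"
  using C0 by (simp add: C0_semigroup_def)

lemma T_bound:
  assumes "0 \<le> t"
  shows "\<exists>C>0. \<forall>f\<in>L2. L2_norm (T t f) \<le> C * L2_norm f"
proof -
  obtain C where C: "\<forall>f\<in>L2. L2_norm (T t f) \<le> C * L2_norm f"
    using T_op[OF assms] unfolding L2_operator_def by blast
  have "L2_norm (T t f) \<le> (\<bar>C\<bar> + 1) * L2_norm f" if "f \<in> L2" for f
  proof -
    have "C * L2_norm f \<le> (\<bar>C\<bar> + 1) * L2_norm f"
      by (intro mult_right_mono) (auto simp: L2_norm_eq)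
    then show ?thesis using C that by fastforce
  qed
  then show ?thesis by (intro exI[of _ "\<bar>C\<bar> + 1"]) auto
qed

lemma T_diff:
  assumes "0 \<le> t" "f \<in> L2" "g \<in> L2"
  shows "ae_eq (T t (\<lambda>x. f x - g x)) (\<lambda>x. T t f x - T t g x)"
proof -
  have 1: "ae_eq (T t (\<lambda>x. f x + (-1) * g x)) (\<lambda>x. T t f x + T t (\<lambda>x. (-1) * g x) x)"
    by (rule T_add[OF assms(1,2) L2_cmult[OF assms(3)]])
  have 2: "ae_eq (T t (\<lambda>x. (-1) * g x)) (\<lambda>x. (-1) * T t g x)"
    by (rule T_cmult[OF assms(1,3)])
  have "ae_eq (T t (\<lambda>x. f x + (-1) * g x)) (\<lambda>x. T t f x - T t g x)"
    using 1 2 unfolding ae_eq_def by eventually_elim simp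
  then show ?thesis by simp
qed

lemma T_diff_norm:
  assumes "0 \<le> t" "f \<in> L2" "g \<in> L2"
  shows "L2_norm (\<lambda>x. T t f x - T t g x) = L2_norm (T t (\<lambda>x. f x - g x))"
  by (rule L2_norm_cong[OF _ _ ae_eq_sym[OF T_diff[OF assms]]]) (intro L2_diff T_L2 assms)+

lemma T_cong:
  assumes "0 \<le> t" "f \<in> L2" "g \<in> L2" "ae_eq f g"
  shows "ae_eq (T t f) (T t g)"
proof -
  obtain C where C: "0 < C" "\<And>f. f \<in> L2 \<Longrightarrow> L2_norm (T t f) \<le> C * L2_norm f" using T_bound[OF assms(1)] by blast
  have "ae_eq (\<lambda>x. f x - g x) (\<lambda>x. 0)" using assms(4) unfolding ae_eq_def by eventually_elim simp
  then have "L2_norm (\<lambda>x. f x - g x) = 0" using L2_norm_zero_iff[OF L2_diff[OF assms(2,3)]] by simp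
  then have "L2_norm (\<lambda>x. T t f x - T t g x) \<le> 0"
    using C(2)[OF L2_diff[OF assms(2,3)]] by (simp add: T_diff_norm[OF assms(1-3)])
  then have "L2_norm (\<lambda>x. T t f x - T t g x) = 0" by (simp add: L2_norm_eq order_antisym)
  then have "ae_eq (\<lambda>x. T t f x - T t g x) (\<lambda>x. 0)"
    using L2_norm_zero_iff[OF L2_diff[OF T_L2 T_L2]] assms by simp
  then show ?thesis unfolding ae_eq_def by eventually_elim simp
qed

lemma T_time_diff_norm:
  assumes "0 \<le> s" "0 \<le> t" "0 \<le> t'" "f \<in> L2"
  shows "L2_norm (\<lambda>x. T (s + t) f x - T (s + t') f x) = L2_norm (T s (\<lambda>x. T t f x - T t' f x))"
proof (rule L2_norm_cong)
  show "ae_eq (\<lambda>x. T (s + t) f x - T (s + t') f x) (T s (\<lambda>x. T t f x - T t' f x))"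
    using T_time_add[OF assms(1,2,4)] T_time_add[OF assms(1,3,4)] T_diff[OF assms(1) T_L2[OF assms(2,4)] T_L2[OF assms(3,4)]]
    unfolding ae_eq_def by eventually_elim simp
qed (use assms in \<open>auto intro!: L2_diff T_L2\<close>)

lemma T_right_continuous:
  assumes "0 \<le> t" "f \<in> L2" "0 < e"
  shows "\<exists>d>0. \<forall>h. 0 < h \<and> h < d \<longrightarrow> L2_norm (\<lambda>x. T t f x - T (t + h) f x) < e"
proof -
  obtain C where C: "0 < C" "\<And>f. f \<in> L2 \<Longrightarrow> L2_norm (T t f) \<le> C * L2_norm f" using T_bound[OF assms(1)] by blast
  have "((\<lambda>t. L2_norm (\<lambda>x. T t f x - f x)) \<longlongrightarrow> 0) (at_right 0)"
    using C0 assms(2) by (simp add: C0_semigroup_def)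
  then have "\<forall>\<^sub>F h in at_right 0. L2_norm (\<lambda>x. T h f x - f x) < e / C"
    by (rule order_tendstoD(2)) (use C assms in simp)
  then obtain d where d: "d > 0" "\<And>h. 0 < h \<Longrightarrow> h < d \<Longrightarrow> L2_norm (\<lambda>x. T h f x - f x) < e / C"
    unfolding eventually_at_right_field by auto
  have "L2_norm (\<lambda>x. T t f x - T (t + h) f x) < e" if "0 < h" "h < d" for h
  proof -
    have "L2_norm (\<lambda>x. T t f x - T (t + h) f x) = L2_norm (\<lambda>x. T (t + h) f x - T (t + 0) f x)"
      by (simp add: L2_norm_eq norm2_minus_commute)
    also have "\<dots> = L2_norm (T t (\<lambda>x. T h f x - T 0 f x))"
      by (rule T_time_diff_norm) (use assms that in auto)
    also have "\<dots> \<le> C * L2_norm (\<lambda>x. T h f x - T 0 f x)"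
      by (intro C L2_diff T_L2) (use assms that in auto)
    also have "L2_norm (\<lambda>x. T h f x - T 0 f x) = L2_norm (\<lambda>x. T h f x - f x)"
    proof (rule L2_norm_cong)
      show "ae_eq (\<lambda>x. T h f x - T 0 f x) (\<lambda>x. T h f x - f x)"
        using T_zero[OF assms(2)] unfolding ae_eq_def by eventually_elim simp
    qed (use assms that in \<open>auto intro!: L2_diff T_L2\<close>)
    also have "C * \<dots> < e" using d(2)[OF that] C(1) by (simp add: field_simps)
    finally show ?thesis .
  qed
  then show ?thesis using d(1) by blast
qed

text \<open>Right continuity provides a point of continuity \<open>t\<^sub>0\<close> close to \<open>0\<close>, and applying the bounded operator
  \<open>T (t - t\<^sub>0)\<close> carries two-sided continuity from \<open>t\<^sub>0\<close> to \<open>t\<close>.\<close>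

lemma T_continuous:
  assumes t: "0 \<le> t" and f: "f \<in> L2" and e: "0 < e"
  shows "\<exists>d>0. \<forall>s. 0 \<le> s \<and> \<bar>s - t\<bar> < d \<longrightarrow> L2_norm (\<lambda>x. T s f x - T t f x) < e"
proof (cases "t = 0")
  case True
  obtain d where d: "d > 0" "\<And>h. 0 < h \<Longrightarrow> h < d \<Longrightarrow> L2_norm (\<lambda>x. T t f x - T (t + h) f x) < e"
    using T_right_continuous[OF assms] by blast
  have "L2_norm (\<lambda>x. T s f x - T t f x) < e" if "0 \<le> s" "\<bar>s - t\<bar> < d" for s
    using d(2)[of s] that True e norm2_minus_commute[of halfline "T s f" "T t f"]
    by (cases "s = 0") (auto simp: L2_norm_eq norm2_def)
  then show ?thesis using d(1) by blast
next
  case False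
  \<comment> \<open>absolute values extend the orbit to negative times, where nothing is claimed\<close>
  define m where "m s r = L2_norm (\<lambda>x. T \<bar>s\<bar> f x - T \<bar>r\<bar> f x)" for s r
  have tri: "m x y \<le> m z x + m z y" for x y z
    using L2_norm_diff_triangle[of "T \<bar>x\<bar> f" "T \<bar>z\<bar> f" "T \<bar>y\<bar> f"] T_L2 f
    by (simp add: m_def L2_norm_eq norm2_minus_commute[of _ "T \<bar>z\<bar> f" "T \<bar>x\<bar> f"])
  have right: "\<exists>d>0. \<forall>h. 0 < h \<and> h < d \<longrightarrow> m r (r + h) < \<epsilon>" if "0 \<le> r" "0 < \<epsilon>" for r \<epsilon>
    using T_right_continuous[OF that(1) f that(2)] that by (auto simp: m_def)
  obtain t0 where t0: "0 < t0" "t0 < t" "\<And>\<epsilon>. 0 < \<epsilon> \<Longrightarrow> \<exists>d>0. \<forall>s. \<bar>s - t0\<bar> < d \<longrightarrow> m s t0 < \<epsilon>"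
    by (rule right_continuous_imp_continuity_point[of m 0 t, OF tri right]) (use t False in auto)
  define r where "r = t - t0"
  have r: "0 \<le> r" "t = r + t0" using t0 by (auto simp: r_def)
  obtain C where C: "0 < C" "\<And>f. f \<in> L2 \<Longrightarrow> L2_norm (T r f) \<le> C * L2_norm f" using T_bound[OF r(1)] by blast
  obtain d where d: "d > 0" "\<And>s. \<bar>s - t0\<bar> < d \<Longrightarrow> m s t0 < e / C" using t0(3)[of "e / C"] e C by auto
  have "L2_norm (\<lambda>x. T s f x - T t f x) < e" if "0 \<le> s" "\<bar>s - t\<bar> < min d t0" for s
  proof -
    have s: "0 \<le> s - r" "\<bar>(s - r) - t0\<bar> < d" using that r by auto
    have "L2_norm (\<lambda>x. T s f x - T t f x) = L2_norm (T r (\<lambda>x. T (s - r) f x - T t0 f x))"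
      using T_time_diff_norm[OF r(1) s(1) _ f, of t0] t0(1) r by simp
    also have "\<dots> \<le> C * L2_norm (\<lambda>x. T (s - r) f x - T t0 f x)"
      by (intro C L2_diff T_L2 f) (use s t0 in auto)
    also have "\<dots> < e" using d(2)[OF s(2)] C(1) s(1) t0(1) by (simp add: m_def field_simps)
    finally show ?thesis .
  qed
  then show ?thesis using d(1) t0(1) by (intro exI[of _ "min d t0"]) auto
qed

lemma generatorD: "(f, g) \<in> generator T \<Longrightarrow> f \<in> L2" "(f, g) \<in> generator T \<Longrightarrow> g \<in> L2"
  by (auto simp: generator_def)

text \<open>The right derivative at \<open>t\<close> is obtained from the one at \<open>0\<close> by applying the bounded operator \<open>T t\<close>.\<close>

lemma generator_step:
  assumes fg: "(f, g) \<in> generator T" and t: "0 \<le> t" and e: "0 < e"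
  shows "\<exists>d>0. \<forall>h. 0 < h \<and> h < d \<longrightarrow> L2_norm (\<lambda>x. T (t + h) f x - T t f x - of_real h * T t g x) \<le> e * h"
proof -
  note f = generatorD(1)[OF fg] and g = generatorD(2)[OF fg]
  obtain C where C: "0 < C" "\<And>f. f \<in> L2 \<Longrightarrow> L2_norm (T t f) \<le> C * L2_norm f" using T_bound[OF t] by blast
  have "((\<lambda>t. L2_norm (\<lambda>x. (T t f x - f x) / of_real t - g x)) \<longlongrightarrow> 0) (at_right 0)"
    using fg by (simp add: generator_def)
  then have "\<forall>\<^sub>F h in at_right 0. L2_norm (\<lambda>x. (T h f x - f x) / of_real h - g x) < e / C"
    by (rule order_tendstoD(2)) (use C e in simp)
  then obtain d where d: "d > 0" "\<And>h. 0 < h \<Longrightarrow> h < d \<Longrightarrow> L2_norm (\<lambda>x. (T h f x - f x) / of_real h - g x) < e / C"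
    unfolding eventually_at_right_field by auto
  have "L2_norm (\<lambda>x. T (t + h) f x - T t f x - of_real h * T t g x) \<le> e * h" if h: "0 < h" "h < d" for h
  proof -
    have Th: "T h f \<in> L2" using T_L2 h f by simp
    let ?w = "\<lambda>x. (T h f x - f x) - of_real h * g x"
    have w: "?w \<in> L2" by (intro L2_diff L2_cmult Th f g)
    have "ae_eq (\<lambda>x. T (t + h) f x - T t f x - of_real h * T t g x) (T t ?w)"
      using T_time_add[OF t less_imp_le[OF h(1)] f] T_diff[OF t Th f] T_cmult[OF t g, of "of_real h"]
        T_diff[OF t L2_diff[OF Th f] L2_cmult[OF g, of "of_real h"]]
      unfolding ae_eq_def by eventually_elim simp
    then have "L2_norm (\<lambda>x. T (t + h) f x - T t f x - of_real h * T t g x) = L2_norm (T t ?w)"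
      by (rule L2_norm_cong[rotated 2]) (use t h f g w in \<open>auto intro!: L2_diff L2_cmult T_L2\<close>)
    also have "\<dots> \<le> C * L2_norm ?w" by (rule C(2)[OF w])
    also have "?w = (\<lambda>x. of_real h * ((T h f x - f x) / of_real h - g x))"
      using h by (simp add: right_diff_distrib diff_divide_distrib)
    also have "L2_norm \<dots> = h * L2_norm (\<lambda>x. (T h f x - f x) / of_real h - g x)"
      using h by (simp add: L2_norm_eq norm2_cmult)
    also have "C * (h * L2_norm (\<lambda>x. (T h f x - f x) / of_real h - g x)) \<le> C * (h * (e / C))"
      using d(2)[OF h] C(1) h by (intro mult_left_mono) auto
    also have "\<dots> = e * h" using C(1) by simp
    finally show ?thesis .
  qed
  then show ?thesis using d(1) by blast
qed

lemma generator_invariant: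
  assumes fg: "(f, g) \<in> generator T" and t: "0 \<le> t"
  shows "(T t f, T t g) \<in> generator T"
proof -
  note f = generatorD(1)[OF fg] and g = generatorD(2)[OF fg]
  have "((\<lambda>h. L2_norm (\<lambda>x. (T h (T t f) x - T t f x) / of_real h - T t g x)) \<longlongrightarrow> 0) (at_right 0)"
  proof (rule tendstoI)
    fix e :: real assume e: "0 < e"
    obtain d where d: "d > 0" "\<And>h. 0 < h \<Longrightarrow> h < d \<Longrightarrow> L2_norm (\<lambda>x. T (t + h) f x - T t f x - of_real h * T t g x) \<le> e / 2 * h"
      using generator_step[OF fg t, of "e / 2"] e by auto
    have "L2_norm (\<lambda>x. (T h (T t f) x - T t f x) / of_real h - T t g x) < e" if h: "0 < h" "h < d" for h
    proof -
      have "ae_eq (\<lambda>x. (T h (T t f) x - T t f x) / of_real h - T t g x)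
          (\<lambda>x. of_real (1 / h) * (T (t + h) f x - T t f x - of_real h * T t g x))"
        using T_time_add[OF less_imp_le[OF h(1)] t f]
        unfolding ae_eq_def by eventually_elim (use h in \<open>simp add: field_simps add.commute\<close>)
      then have "L2_norm (\<lambda>x. (T h (T t f) x - T t f x) / of_real h - T t g x)
          = L2_norm (\<lambda>x. of_real (1 / h) * (T (t + h) f x - T t f x - of_real h * T t g x))"
      proof (rule L2_norm_cong[rotated 2])
        have "(\<lambda>x. of_real (1 / h) * (T h (T t f) x - T t f x) - T t g x) \<in> L2"
          using t h f g by (intro L2_diff L2_cmult T_L2) auto
        then show "(\<lambda>x. (T h (T t f) x - T t f x) / of_real h - T t g x) \<in> L2" by (simp add: field_simps)
        show "(\<lambda>x. of_real (1 / h) * (T (t + h) f x - T t f x - of_real h * T t g x)) \<in> L2"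
          by (intro L2_cmult L2_diff T_L2 f g) (use t h in auto)
      qed
      also have "\<dots> = (1 / h) * L2_norm (\<lambda>x. T (t + h) f x - T t f x - of_real h * T t g x)"
        using h norm2_cmult[of halfline "of_real (1 / h)"] by (simp add: L2_norm_eq norm_divide)
      also have "\<dots> \<le> (1 / h) * (e / 2 * h)" using d(2)[OF h] h by (intro mult_left_mono) auto
      also have "\<dots> < e" using h e by simp
      finally show ?thesis .
    qed
    then show "\<forall>\<^sub>F h in at_right 0. dist (L2_norm (\<lambda>x. (T h (T t f) x - T t f x) / of_real h - T t g x)) 0 < e"
      unfolding eventually_at_right_field using d(1) by (intro exI[of _ d]) (auto simp: L2_norm_eq)
  qed
  then show ?thesis using T_L2[OF t f] T_L2[OF t g] by (simp add: generator_def)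
qed

end

text \<open>What is needed of the generator \<open>A f = -f'\<close> to see that the semigroup moves functions to the right; the
  boundary condition enters only through the density of the domain.\<close>

locale transport_semigroup = L2_semigroup +
  assumes generator_transport:
      "(f, g) \<in> generator T \<Longrightarrow> \<exists>f'. f' \<in> L2 \<and> loc_abs_cont_deriv f f' \<and> ae_eq g (\<lambda>x. - f' x)"
    and generator_dense:
      "f \<in> L2 \<Longrightarrow> 0 < e \<Longrightarrow> \<exists>u v. (u, v) \<in> generator T \<and> L2_norm (\<lambda>x. f x - u x) < e"
begin

text \<open>Pairing with indicators of intervals turns the weak relation \<open>v = -u'\<close> into a difference of values of the continuous
  representative \<open>U\<close> of \<open>u\<close>.\<close>

lemma generator_windows:
  assumes uv: "(u, v) \<in> generator T"
  obtains U where "continuous_on UNIV U"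
    "\<And>p r. 0 \<le> p \<Longrightarrow> p \<le> r \<Longrightarrow> pairing u (window p r) = integral {p..r} U"
    "\<And>p r. 0 \<le> p \<Longrightarrow> p \<le> r \<Longrightarrow> pairing v (window p r) = U p - U r"
proof -
  note u = generatorD(1)[OF uv] and v = generatorD(2)[OF uv]
  obtain f' where f': "f' \<in> L2" "loc_abs_cont_deriv u f'" "ae_eq v (\<lambda>x. - f' x)"
    using generator_transport[OF uv] by blast
  obtain G where G: "G \<in> causal" "ae_eq f' G" using L2_representative[OF f'(1)] by blast
  obtain c where c: "ae_eq u (\<lambda>x. c + conv unit_step G x)"
    using loc_abs_cont_primitive[OF f'(2) G(2,1)] by blast
  have vG: "ae_eq v (\<lambda>x. (-1) * G x)" using f'(3) G(2) unfolding ae_eq_def by eventually_elim simp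
  have cm: "conv unit_step (\<lambda>x. (-1) * G x) p = - conv unit_step G p" for p by (simp add: conv_def)
  show ?thesis
  proof (rule that)
    show U: "continuous_on UNIV (\<lambda>x. c + conv unit_step G x)"
      by (intro continuous_on_add continuous_on_const conv_continuous unit_step_causal G)
    show "pairing u (window p r) = integral {p..r} (\<lambda>x. c + conv unit_step G x)" if "0 \<le> p" "p \<le> r" for p r
      by (rule pairing_window_continuous[OF u c U that])
    show "pairing v (window p r) = (c + conv unit_step G p) - (c + conv unit_step G r)" if "0 \<le> p" "p \<le> r" for p r
      using pairing_window_causal[OF v vG causal_cmult[OF G(1)] that] unfolding cm by simp
  qed
qed

text \<open>The mass of \<open>T t f\<close> in the moving window \<open>(t + a, t + b]\<close> has vanishing right derivative: the change of
  \<open>T t f\<close> by \<open>h T t g = - h (T t f)'\<close> is compensated by the motion of the window.\<close>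

lemma window_right_derivative:
  assumes fg: "(f, g) \<in> generator T" and t: "0 \<le> t" and ab: "0 \<le> a" "a \<le> b" and e: "0 < e"
  shows "\<exists>d>0. \<forall>h. 0 < h \<and> h < d \<longrightarrow>
    cmod (pairing (T (t + h) f) (window (t + h + a) (t + h + b)) - pairing (T t f) (window (t + a) (t + b))) \<le> e * h"
proof -
  note f = generatorD(1)[OF fg] and g = generatorD(2)[OF fg]
  define u v where "u = T t f" and "v = T t g"
  have uv: "(u, v) \<in> generator T" unfolding u_def v_def by (rule generator_invariant[OF fg t])
  note u = generatorD(1)[OF uv] and v = generatorD(2)[OF uv]
  obtain U where U: "continuous_on UNIV U"
    "\<And>p r. 0 \<le> p \<Longrightarrow> p \<le> r \<Longrightarrow> pairing u (window p r) = integral {p..r} U"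
    "\<And>p r. 0 \<le> p \<Longrightarrow> p \<le> r \<Longrightarrow> pairing v (window p r) = U p - U r"
    using generator_windows[OF uv] by blast
  define k where "k = e / (4 + sqrt (b - a))"
  have s0: "0 \<le> sqrt (b - a)" using ab by simp
  then have "0 < 4 + sqrt (b - a)" by linarith
  then have k: "0 < k" "k * (4 + sqrt (b - a)) = e"
    unfolding k_def using e by (rule divide_pos_pos[rotated], simp)
  obtain d1 where d1: "d1 > 0" "\<And>h. 0 < h \<Longrightarrow> h < d1 \<Longrightarrow> L2_norm (\<lambda>x. T (t + h) f x - u x - of_real h * v x) \<le> k * h"
    using generator_step[OF fg t k(1)] unfolding u_def v_def by blast
  obtain d2 where d2: "d2 > 0" "\<And>h. 0 < h \<Longrightarrow> h < d2 \<Longrightarrow> cmod (integral {t + a..t + a + h} U - of_real h * U (t + a)) \<le> k * h"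
    using integral_right_derivative[OF U(1) k(1)] by blast
  obtain d3 where d3: "d3 > 0" "\<And>h. 0 < h \<Longrightarrow> h < d3 \<Longrightarrow> cmod (integral {t + b..t + b + h} U - of_real h * U (t + b)) \<le> k * h"
    using integral_right_derivative[OF U(1) k(1)] by blast
  have cU: "\<exists>d>0. \<forall>h. 0 < h \<and> h < d \<longrightarrow> cmod (U (c + h) - U c) \<le> k" for c
  proof -
    have "isCont U c" using U(1) by (simp add: continuous_on_eq_continuous_at)
    then obtain d where "d > 0" "\<And>y. dist y c < d \<Longrightarrow> dist (U y) (U c) < k"
      using k(1) unfolding continuous_at_eps_delta by blast
    then show ?thesis by (intro exI[of _ d]) (auto simp: dist_norm less_imp_le)
  qed
  obtain d4 where d4: "d4 > 0" "\<And>h. 0 < h \<Longrightarrow> h < d4 \<Longrightarrow> cmod (U (t + a + h) - U (t + a)) \<le> k" using cU by blast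
  obtain d5 where d5: "d5 > 0" "\<And>h. 0 < h \<Longrightarrow> h < d5 \<Longrightarrow> cmod (U (t + b + h) - U (t + b)) \<le> k" using cU by blast
  define d where "d = min d1 (min d2 (min d3 (min d4 d5)))"
  have "cmod (pairing (T (t + h) f) (window (t + h + a) (t + h + b)) - pairing u (window (t + a) (t + b))) \<le> e * h"
    if h: "0 < h" "h < d" for h
  proof -
    have hd: "h < d1" "h < d2" "h < d3" "h < d4" "h < d5" using h by (auto simp: d_def)
    have p: "0 \<le> t + h + a" "t + h + a \<le> t + h + b" "0 \<le> t + a" "t + a \<le> t + b" using t ab h by auto
    let ?w = "window (t + h + a) (t + h + b)"
    note w = window_L2(1)[OF p(1,2)]
    let ?r = "\<lambda>x. T (t + h) f x - u x - of_real h * v x"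
    have Tf: "T (t + h) f \<in> L2" by (rule T_L2) (use t h f in auto)
    have r: "?r \<in> L2" by (intro L2_diff L2_cmult Tf u v)
    have "pairing ?r ?w = pairing (T (t + h) f) ?w - pairing u ?w - of_real h * pairing v ?w"
      by (simp add: pairing_linear(2)[OF L2_diff[OF Tf u] L2_cmult[OF v] w] pairing_linear(2)[OF Tf u w] pairing_linear(3)[OF v v w])
    then have eq: "pairing (T (t + h) f) ?w - pairing u (window (t + a) (t + b))
        = pairing ?r ?w + of_real h * pairing v ?w + (pairing u ?w - pairing u (window (t + a) (t + b)))" by simp
    have "pairing u ?w - pairing u (window (t + a) (t + b)) = integral {t + a + h..t + b + h} U - integral {t + a..t + b} U"
      using U(2)[OF p(1,2)] U(2)[OF p(3,4)] by (simp add: algebra_simps)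
    also have "\<dots> = integral {t + b..t + b + h} U - integral {t + a..t + a + h} U"
      by (rule integral_window_shift[OF U(1)]) (use ab h in auto)
    finally have split: "pairing (T (t + h) f) ?w - pairing u (window (t + a) (t + b))
        = pairing ?r ?w + of_real h * (U (t + a + h) - U (t + a)) - of_real h * (U (t + b + h) - U (t + b))
          + (integral {t + b..t + b + h} U - of_real h * U (t + b)) - (integral {t + a..t + a + h} U - of_real h * U (t + a))"
      unfolding eq U(3)[OF p(1,2)] by (simp add: algebra_simps)
    have tri: "cmod (A + B - C + D - E) \<le> cmod A + cmod B + cmod C + cmod D + cmod E" for A B C D E :: complex
      using norm_triangle_ineq4[of "A + B - C + D" E] norm_triangle_ineq[of "A + B - C" D]
        norm_triangle_ineq4[of "A + B" C] norm_triangle_ineq[of A B] by linarith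
    have r': "cmod (pairing ?r ?w) \<le> k * h * sqrt (b - a)"
    proof -
      have "cmod (pairing ?r ?w) \<le> L2_norm ?r * sqrt (b - a)"
        using pairing_bound[OF r w] window_L2(2)[OF p(1,2)] by simp
      also have "\<dots> \<le> k * h * sqrt (b - a)" by (rule mult_right_mono[OF d1(2)[OF h(1) hd(1)] s0])
      finally show ?thesis .
    qed
    have U': "cmod (of_real h * (U (t + a + h) - U (t + a))) \<le> k * h" "cmod (of_real h * (U (t + b + h) - U (t + b))) \<le> k * h"
      using d4(2)[OF h(1) hd(4)] d5(2)[OF h(1) hd(5)] h(1) by (simp_all add: norm_mult mult.commute mult_left_mono)
    have "cmod (pairing (T (t + h) f) ?w - pairing u (window (t + a) (t + b)))
        \<le> k * h * sqrt (b - a) + k * h + k * h + k * h + k * h"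
      unfolding split
      by (rule order_trans[OF tri]) (intro add_mono r' U' d2(2)[OF h(1) hd(2)] d3(2)[OF h(1) hd(3)])
    also have "\<dots> = e * h" unfolding k(2)[symmetric] by (simp add: algebra_simps)
    finally show ?thesis .
  qed
  moreover have "0 < d" using d1(1) d2(1) d3(1) d4(1) d5(1) by (simp add: d_def)
  ultimately show ?thesis unfolding u_def by blast
qed

lemma window_continuous:
  assumes fg: "(f, g) \<in> generator T" and ab: "0 \<le> a" "a \<le> b"
  shows "continuous_on {0..\<tau>} (\<lambda>s. pairing (T s f) (window (s + a) (s + b)))"
  unfolding continuous_on_def
proof
  fix t assume t: "t \<in> {0..\<tau>}"
  note f = generatorD(1)[OF fg]
  have uv: "(T t f, T t g) \<in> generator T" by (rule generator_invariant[OF fg]) (use t in auto)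
  obtain U where U: "continuous_on UNIV U"
    "\<And>p r. 0 \<le> p \<Longrightarrow> p \<le> r \<Longrightarrow> pairing (T t f) (window p r) = integral {p..r} U"
    "\<And>p r. 0 \<le> p \<Longrightarrow> p \<le> r \<Longrightarrow> pairing (T t g) (window p r) = U p - U r"
    by (rule generator_windows[OF uv]) blast
  let ?V = "\<lambda>x. integral {0..x} U"
  have i: "U integrable_on {p..r}" for p r
    by (rule integrable_continuous_interval[OF continuous_on_subset[OF U(1)]]) simp
  have K: "pairing (T t f) (window (s + a) (s + b)) = ?V (s + b) - ?V (s + a)" if "s \<in> {0..\<tau>}" for s
    using U(2)[of "s + a" "s + b"] Henstock_Kurzweil_Integration.integral_combine[of 0 "s + a" "s + b", OF _ _ i] that ab
    by (simp add: eq_diff_eq add.commute)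
  have cV: "continuous_on {0..\<tau>} (\<lambda>s. ?V (s + c))" if "0 \<le> c" for c
  proof (rule continuous_on_compose2[where g = ?V and f = "\<lambda>s. s + c"])
    show "continuous_on {0..\<tau> + c} ?V" by (rule indefinite_integral_continuous_1[OF i])
    show "continuous_on {0..\<tau>} (\<lambda>s. s + c)" by (intro continuous_intros)
  qed (use that in auto)
  have "continuous_on {0..\<tau>} (\<lambda>s. ?V (s + b) - ?V (s + a))"
    using ab by (intro continuous_on_diff cV) auto
  then have 1: "((\<lambda>s. ?V (s + b) - ?V (s + a)) \<longlongrightarrow> ?V (t + b) - ?V (t + a)) (at t within {0..\<tau>})"
    using t by (simp add: continuous_on_def)
  have 2: "((\<lambda>s. pairing (T s f) (window (s + a) (s + b)) - (?V (s + b) - ?V (s + a))) \<longlongrightarrow> 0) (at t within {0..\<tau>})"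
  proof (rule Lim_null_comparison)
    show "((\<lambda>s. L2_norm (\<lambda>x. T s f x - T t f x) * sqrt (b - a)) \<longlongrightarrow> 0) (at t within {0..\<tau>})"
    proof (rule tendsto_mult_left_zero, rule tendstoI)
      fix e :: real assume "0 < e"
      then obtain d where "d > 0" "\<And>s. 0 \<le> s \<Longrightarrow> \<bar>s - t\<bar> < d \<Longrightarrow> L2_norm (\<lambda>x. T s f x - T t f x) < e"
        using T_continuous[OF _ f, of t e] t by auto
      then show "\<forall>\<^sub>F s in at t within {0..\<tau>}. dist (L2_norm (\<lambda>x. T s f x - T t f x)) 0 < e"
        unfolding eventually_at by (intro exI[of _ d]) (auto simp: dist_real_def L2_norm_eq)
    qed
    have "cmod (pairing (T s f) (window (s + a) (s + b)) - (?V (s + b) - ?V (s + a))) \<le> L2_norm (\<lambda>x. T s f x - T t f x) * sqrt (b - a)"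
      if s: "s \<in> {0..\<tau>}" for s
    proof -
      have w: "window (s + a) (s + b) \<in> L2" "L2_norm (window (s + a) (s + b)) = sqrt (b - a)"
        using window_L2[of "s + a" "s + b"] s ab by auto
      have Ts: "T s f \<in> L2" "T t f \<in> L2" using T_L2 f s t by auto
      have "pairing (T s f) (window (s + a) (s + b)) - (?V (s + b) - ?V (s + a))
          = pairing (\<lambda>x. T s f x - T t f x) (window (s + a) (s + b))"
        using pairing_linear(2)[OF Ts w(1)] K[OF s] by simp
      then show ?thesis using pairing_bound[OF L2_diff[OF Ts] w(1)] w(2) by simp
    qed
    then show "\<forall>\<^sub>F s in at t within {0..\<tau>}. norm (pairing (T s f) (window (s + a) (s + b)) - (?V (s + b) - ?V (s + a)))
        \<le> L2_norm (\<lambda>x. T s f x - T t f x) * sqrt (b - a)"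
      by (auto simp: eventually_at_filter)
  qed
  show "((\<lambda>s. pairing (T s f) (window (s + a) (s + b))) \<longlongrightarrow> pairing (T t f) (window (t + a) (t + b))) (at t within {0..\<tau>})"
    using tendsto_add[OF 1 2] K[OF t] by simp
qed

lemma generator_window:
  assumes fg: "(f, g) \<in> generator T" and t: "0 \<le> t" and ab: "0 \<le> a" "a \<le> b"
  shows "pairing (T t f) (window (t + a) (t + b)) = pairing f (window a b)"
proof -
  note f = generatorD(1)[OF fg]
  have "pairing (T t f) (window (t + a) (t + b)) = pairing (T 0 f) (window (0 + a) (0 + b))"
    by (rule zero_right_derivative_imp_const[OF window_continuous[OF fg ab] t])
      (use window_right_derivative[OF fg _ ab] in auto)
  also have "\<dots> = pairing f (window a b)"
    using T_zero[OF f] by (intro pairing_cong) (use window_L2[of a b] ab f T_L2 in \<open>auto simp: ae_eq_def\<close>)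
  finally show ?thesis .
qed

text \<open>Both sides are bounded functionals of \<open>f\<close>, and the domain of the generator is dense.\<close>

lemma pairing_dense:
  assumes p: "p \<in> L2" "p' \<in> L2" and t: "0 \<le> t"
    and gen: "\<And>u v. (u, v) \<in> generator T \<Longrightarrow> pairing (T t u) p = pairing u p'" and f: "f \<in> L2"
  shows "pairing (T t f) p = pairing f p'"
proof -
  obtain C where C: "0 < C" "\<And>f. f \<in> L2 \<Longrightarrow> L2_norm (T t f) \<le> C * L2_norm f" using T_bound[OF t] by blast
  define K where "K = C * L2_norm p + L2_norm p'"
  have N: "0 \<le> L2_norm p" "0 \<le> L2_norm p'" by (simp_all add: L2_norm_eq)
  then have K: "0 \<le> K" using C(1) by (simp add: K_def)
  have Tf: "T t f \<in> L2" by (rule T_L2[OF t f])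
  have small: "cmod (pairing (T t f) p - pairing f p') \<le> K * e" if e: "0 < e" for e
  proof -
    obtain u v where uv: "(u, v) \<in> generator T" "L2_norm (\<lambda>x. f x - u x) < e" using generator_dense[OF f e] by blast
    note u = generatorD(1)[OF uv(1)]
    have Tu: "T t u \<in> L2" by (rule T_L2[OF t u])
    have "pairing (T t f) p - pairing f p' = pairing (\<lambda>x. T t f x - T t u x) p - pairing (\<lambda>x. f x - u x) p'"
      unfolding pairing_linear(2)[OF Tf Tu p(1)] pairing_linear(2)[OF f u p(2)] gen[OF uv(1)] by simp
    also have "cmod \<dots> \<le> cmod (pairing (\<lambda>x. T t f x - T t u x) p) + cmod (pairing (\<lambda>x. f x - u x) p')"
      by (rule norm_triangle_ineq4)
    also have "\<dots> \<le> C * e * L2_norm p + e * L2_norm p'"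
    proof (intro add_mono)
      have "L2_norm (\<lambda>x. T t f x - T t u x) \<le> C * L2_norm (\<lambda>x. f x - u x)"
        unfolding T_diff_norm[OF t f u] by (rule C(2)[OF L2_diff[OF f u]])
      also have "\<dots> \<le> C * e" using C(1) uv(2) by simp
      finally show "cmod (pairing (\<lambda>x. T t f x - T t u x) p) \<le> C * e * L2_norm p"
        using N by (intro order_trans[OF pairing_bound[OF L2_diff[OF Tf Tu] p(1)]]) (simp add: mult_right_mono)
      show "cmod (pairing (\<lambda>x. f x - u x) p') \<le> e * L2_norm p'"
        using uv(2) N by (intro order_trans[OF pairing_bound[OF L2_diff[OF f u] p(2)]]) (simp add: mult_right_mono)
    qed
    finally show ?thesis by (simp add: K_def algebra_simps)
  qed
  have "cmod (pairing (T t f) p - pairing f p') \<le> 0 + e" if "0 < e" for e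
  proof -
    have "cmod (pairing (T t f) p - pairing f p') \<le> K * (e / (K + 1))" by (rule small) (use that K in simp)
    also have "\<dots> \<le> e" using that K by (simp add: field_simps)
    finally show ?thesis by simp
  qed
  then have "cmod (pairing (T t f) p - pairing f p') \<le> 0" by (rule field_le_epsilon)
  then show ?thesis by simp
qed

text \<open>Comparing windows for all bounds shows that \<open>T t\<close> is the shift plus a function supported in \<open>(0, t)\<close>.\<close>

lemma left_shift:
  assumes f: "f \<in> L2" and t: "0 \<le> t"
  shows "AE x in lborel. 0 < x \<longrightarrow> T t f (x + t) = f x"
proof -
  have Tf: "T t f \<in> L2" by (rule T_L2[OF t f])
  have const: "pairing (T t f) (window (t + a) (t + b)) = pairing f (window a b)" if ab: "0 \<le> a" "a \<le> b" for a b
    by (rule pairing_dense[OF _ _ t generator_window[OF _ t ab] f]) (use window_L2 ab t in auto)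
  obtain F where F: "F \<in> causal" "square_integrable lborel F" "ae_eq (T t f) F" using L2_representative[OF Tf] .
  obtain f0 where f0: "f0 \<in> causal" "square_integrable lborel f0" "ae_eq f f0" using L2_representative[OF f] .
  note [measurable] = causalD(1)[OF F(1)] causalD(1)[OF f0(1)]
  define w where "w x = (if 0 < x then F (x + t) - f0 x else 0)" for x
  have Fs: "square_integrable lborel (\<lambda>x. F (x + t))"
    using square_integrable_affine[OF F(2), of 1 t] by (simp add: add.commute)
  have wm: "w \<in> borel_measurable borel" unfolding w_def[abs_def] by measurable
  have ws: "square_integrable lborel w"
    by (rule square_integrable_dominated(1)[OF square_integrable_diff(1)[OF Fs f0(2)]]) (use wm in \<open>auto simp: w_def\<close>)
  have "AE x in lborel. w x = 0"
  proof (rule AE_eq_0_if_interval_integrals[OF ws])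
    fix a b :: real assume "a \<le> b"
    define a' b' where "a' = max a 0" and "b' = max b 0"
    have ab: "0 \<le> a'" "a' \<le> b'" using \<open>a \<le> b\<close> by (auto simp: a'_def b'_def)
    have wi: "square_integrable lborel (window a' b')"
      by (rule square_integrable_bounded_support[of _ 1 a' b']) (auto simp: window_def)
    have i1: "integrable lborel (\<lambda>x. F (x + t) * window a' b' x)" and i2: "integrable lborel (\<lambda>x. f0 x * window a' b' x)"
      by (rule Cauchy_Schwarz_integral(1)[OF Fs wi] Cauchy_Schwarz_integral(1)[OF f0(2) wi])+
    have "(LBINT x. indicator {a<..b} x * w x) = (LBINT x. F (x + t) * window a' b' x - f0 x * window a' b' x)"
      by (rule Bochner_Integration.integral_cong) (auto simp: w_def a'_def b'_def window_def indicator_def max_def)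
    also have "\<dots> = (LBINT x. F (x + t) * window a' b' x) - (LBINT x. f0 x * window a' b' x)"
      by (rule Bochner_Integration.integral_diff[OF i1 i2])
    also have "(LBINT x. F (x + t) * window a' b' x) = (LBINT x. F x * window (t + a') (t + b') x)"
      using lborel_integral_real_affine[of 1 "\<lambda>x. F x * window (t + a') (t + b') x" t]
      by (simp add: window_def add.commute)
    also have "\<dots> = pairing (T t f) (window (t + a') (t + b'))"
    proof -
      have "pairing (T t f) (window (t + a') (t + b')) = pairing F (window (t + a') (t + b'))"
        by (rule pairing_cong) (use Tf F ab t window_L2 causal_L2 in \<open>auto simp: ae_eq_def\<close>)
      also have "\<dots> = (LBINT x. F x * window (t + a') (t + b') x)"
        by (rule pairing_borel) (use causalD(2)[OF F(1)] in auto)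
      finally show ?thesis by simp
    qed
    also have "(LBINT x. f0 x * window a' b' x) = pairing f (window a' b')"
    proof -
      have "pairing f (window a' b') = pairing f0 (window a' b')"
        by (rule pairing_cong) (use f f0 ab window_L2 causal_L2 in \<open>auto simp: ae_eq_def\<close>)
      also have "\<dots> = (LBINT x. f0 x * window a' b' x)"
        by (rule pairing_borel) (use causalD(2)[OF f0(1)] in auto)
      finally show ?thesis by simp
    qed
    finally show "(LBINT x. indicator {a<..b} x * w x) = 0" using const[OF ab] by simp
  qed
  moreover have "AE x in lborel. 0 < t + 1 * x \<longrightarrow> T t f (t + 1 * x) = F (t + 1 * x)"
    by (rule AE_lborel_affine[OF F(3)[unfolded ae_eq_iff]]) simp
  ultimately show ?thesis using f0(3)[unfolded ae_eq_iff]
    by eventually_elim (use t in \<open>auto simp: w_def add.commute\<close>)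
qed

end

lemma exp_times_one_minus:
  fixes h :: real
  assumes "0 \<le> h" "h \<le> 1"
  shows "\<bar>exp h * (1 - h) - 1\<bar> \<le> h\<^sup>2"
proof -
  have "exp h * (1 - h) \<le> exp h * exp (- h)"
    using exp_ge_add_one_self[of "- h"] by (intro mult_left_mono) auto
  then have "exp h * (1 - h) \<le> 1" by (simp add: exp_minus)
  moreover have "(1 + h) * (1 - h) \<le> exp h * (1 - h)"
    using assms by (intro mult_right_mono exp_ge_add_one_self) auto
  ultimately show ?thesis by (simp add: algebra_simps power2_eq_square abs_le_iff)
qed

lemma (in L2_semigroup) pairing_continuous:
  assumes f: "f \<in> L2" and q: "q \<in> L2"
  shows "continuous_on {0..\<tau>} (\<lambda>s. pairing (T s f) q)"
  unfolding continuous_on_iff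
proof (intro ballI allI impI)
  fix t e :: real assume t: "t \<in> {0..\<tau>}" and e: "0 < e"
  have N: "0 \<le> L2_norm q" by (simp add: L2_norm_eq)
  then obtain d where d: "d > 0" "\<And>s. 0 \<le> s \<and> \<bar>s - t\<bar> < d \<Longrightarrow> L2_norm (\<lambda>x. T s f x - T t f x) < e / (L2_norm q + 1)"
    using T_continuous[OF _ f, of t "e / (L2_norm q + 1)"] t e by (auto simp: divide_pos_pos)
  have "dist (pairing (T s f) q) (pairing (T t f) q) < e" if s: "s \<in> {0..\<tau>}" "dist s t < d" for s
  proof -
    have Ts: "T s f \<in> L2" "T t f \<in> L2" using T_L2 f s t by auto
    have "dist (pairing (T s f) q) (pairing (T t f) q) \<le> L2_norm (\<lambda>x. T s f x - T t f x) * L2_norm q"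
      using pairing_bound[OF L2_diff[OF Ts] q] pairing_linear(2)[OF Ts q] by (simp add: dist_norm)
    also have "\<dots> \<le> e / (L2_norm q + 1) * L2_norm q"
      using d(2)[of s] s N by (intro mult_right_mono) (auto simp: dist_real_def less_imp_le)
    also have "\<dots> < e" using N e by (simp add: field_simps)
    finally show ?thesis .
  qed
  then show "\<exists>d>0. \<forall>s\<in>{0..\<tau>}. dist s t < d \<longrightarrow> dist (pairing (T s f) q) (pairing (T t f) q) < e"
    using d(1) by blast
qed

text \<open>The boundary condition says that \<open>q\<close> is an eigenvector of the adjoint of the generator for the
  eigenvalue \<open>-1\<close>; hence \<open>e\<^bsup>t\<^esup> (T t f, q)\<close> has vanishing right derivative.\<close>

lemma (in L2_semigroup) generator_eigenfunctional:
  assumes q: "q \<in> L2" and bd: "\<And>f g. (f, g) \<in> generator T \<Longrightarrow> pairing (\<lambda>x. f x + g x) q = 0"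
    and fg: "(f, g) \<in> generator T" and t: "0 \<le> t"
  shows "pairing (T t f) q = of_real (exp (- t)) * pairing f q"
proof -
  note f = generatorD(1)[OF fg] and g = generatorD(2)[OF fg]
  define H where "H s = pairing (T s f) q" for s
  define \<phi> where "\<phi> s = of_real (exp s) * H s" for s
  have "\<phi> t = \<phi> 0"
  proof (rule zero_right_derivative_imp_const[OF _ t])
    show "continuous_on {0..t} \<phi>"
      unfolding \<phi>_def H_def by (intro continuous_intros pairing_continuous f q)
    fix s e :: real assume s: "0 \<le> s" "s < t" and e: "0 < e"
    define N where "N = L2_norm q"
    have N: "0 \<le> N" by (simp add: N_def L2_norm_eq)
    \<comment> \<open>\<open>k\<close> and the bound \<open>d2\<close> on \<open>h\<close> each account for half of \<open>e\<close>; the factor \<open>3\<close> in \<open>6\<close> bounds \<open>exp h\<close> for \<open>h \<le> 1\<close>\<close>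
    define k where "k = e / (6 * exp s * (N + 1))"
    have k: "0 < k" using e N by (simp add: k_def)
    obtain d1 where d1: "d1 > 0" "\<And>h. 0 < h \<Longrightarrow> h < d1 \<Longrightarrow> L2_norm (\<lambda>x. T (s + h) f x - T s f x - of_real h * T s g x) \<le> k * h"
      using generator_step[OF fg s(1) k] by blast
    define d2 where "d2 = e / (2 * exp s * (cmod (H s) + 1))"
    have d2: "0 < d2" using e by (simp add: d2_def add_nonneg_pos)
    have Ts: "T s f \<in> L2" "T s g \<in> L2" using T_L2 s f g by auto
    have "pairing (\<lambda>x. T s f x + T s g x) q = 0" by (rule bd[OF generator_invariant[OF fg s(1)]])
    then have gH: "pairing (T s g) q = - H s"
      unfolding pairing_linear(1)[OF Ts q] H_def by (simp add: add_eq_0_iff)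
    have "cmod (\<phi> (s + h) - \<phi> s) \<le> e * h" if h: "0 < h" "h < min d1 (min d2 1)" for h
    proof -
      let ?r = "\<lambda>x. T (s + h) f x - T s f x - of_real h * T s g x"
      have Th: "T (s + h) f \<in> L2" by (rule T_L2) (use s h f in auto)
      have r: "?r \<in> L2" by (intro L2_diff L2_cmult Th Ts)
      have req: "pairing ?r q = H (s + h) - of_real (1 - h) * H s"
        unfolding pairing_linear(2)[OF L2_diff[OF Th Ts(1)] L2_cmult[OF Ts(2)] q] pairing_linear(2)[OF Th Ts(1) q]
          pairing_linear(3)[OF Ts(2) Ts(2) q] gH H_def[symmetric] by (simp add: algebra_simps)
      have rb: "cmod (pairing ?r q) \<le> k * h * N"
      proof -
        have "cmod (pairing ?r q) \<le> L2_norm ?r * N" unfolding N_def by (rule pairing_bound[OF r q])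
        also have "\<dots> \<le> k * h * N" using d1(2)[of h] h N by (intro mult_right_mono) auto
        finally show ?thesis .
      qed
      have \<phi>eq: "\<phi> (s + h) - \<phi> s = of_real (exp s) * (of_real (exp h) * pairing ?r q + of_real (exp h * (1 - h) - 1) * H s)"
        unfolding \<phi>_def req by (simp add: exp_add algebra_simps)
      have "cmod (\<phi> (s + h) - \<phi> s) = exp s * cmod (of_real (exp h) * pairing ?r q + of_real (exp h * (1 - h) - 1) * H s)"
        unfolding \<phi>eq norm_mult[of "of_real (exp s)"] by (simp only: norm_of_real abs_exp_cancel)
      also have "\<dots> \<le> exp s * (3 * (k * h * N) + h\<^sup>2 * cmod (H s))"
      proof (rule mult_left_mono)
        have "exp h \<le> exp 1" using h by simp
        then have "exp h \<le> 3" using exp_le by linarith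
        then have "cmod (of_real (exp h) * pairing ?r q) \<le> 3 * (k * h * N)"
          unfolding norm_mult using rb by (intro mult_mono) auto
        moreover have "cmod (of_real (exp h * (1 - h) - 1) * H s) \<le> h\<^sup>2 * cmod (H s)"
          unfolding norm_mult norm_of_real using exp_times_one_minus[of h] h by (intro mult_right_mono) auto
        ultimately show "cmod (of_real (exp h) * pairing ?r q + of_real (exp h * (1 - h) - 1) * H s) \<le> 3 * (k * h * N) + h\<^sup>2 * cmod (H s)"
          by (intro order_trans[OF norm_triangle_ineq] add_mono)
      qed simp
      also have "\<dots> = (3 * exp s * k * N) * h + (exp s * cmod (H s) * h) * h" by (simp add: algebra_simps power2_eq_square)
      also have "\<dots> \<le> (e / 2) * h + (e / 2) * h"
      proof (intro add_mono mult_right_mono)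
        have "3 * exp s * (e / (6 * exp s * w)) * N = e / 2 * (N / w)" if "0 < w" for w :: real
          using that by (simp add: field_simps)
        from this[of "N + 1"] have "3 * exp s * k * N = e / 2 * (N / (N + 1))" using N by (simp add: k_def)
        also have "\<dots> \<le> e / 2 * 1" using e N by (intro mult_left_mono) auto
        finally show "3 * exp s * k * N \<le> e / 2" by simp
        have "exp s * cmod (H s) * h \<le> exp s * (cmod (H s) + 1) * d2"
          using h by (intro mult_mono) auto
        also have "\<dots> = e / 2"
        proof -
          have "exp s * w * (e / (2 * exp s * w)) = e / 2" if "0 < w" for w :: real
            using that by (simp add: field_simps)
          from this[of "cmod (H s) + 1"] show ?thesis unfolding d2_def by (simp only: add_nonneg_pos norm_ge_zero zero_less_one)
        qed
        finally show "exp s * cmod (H s) * h \<le> e / 2" .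
      qed (use h in auto)
      finally show ?thesis by simp
    qed
    moreover have "0 < min d1 (min d2 1)" using d1(1) d2 by simp
    ultimately show "\<exists>d>0. \<forall>h. 0 < h \<and> h < d \<longrightarrow> cmod (\<phi> (s + h) - \<phi> s) \<le> e * h" by blast
  qed
  moreover have "H 0 = pairing f q"
    unfolding H_def using T_zero[OF f] by (intro pairing_cong) (use f q T_L2 in \<open>auto simp: ae_eq_def\<close>)
  ultimately have eq: "of_real (exp t) * H t = pairing f q" by (simp add: \<phi>_def)
  have one: "complex_of_real (exp (- t)) * of_real (exp t) = 1"
    unfolding of_real_mult[symmetric] exp_add[symmetric] by simp
  have "of_real (exp (- t)) * pairing f q = (of_real (exp (- t)) * of_real (exp t)) * H t"
    by (simp only: eq[symmetric] mult.assoc)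
  then show ?thesis by (simp only: one mult_1_left H_def)
qed

lemma (in transport_semigroup) eigenfunctional:
  assumes q: "q \<in> L2" and bd: "\<And>f g. (f, g) \<in> generator T \<Longrightarrow> pairing (\<lambda>x. f x + g x) q = 0"
    and f: "f \<in> L2" and t: "0 \<le> t"
  shows "pairing (T t f) q = of_real (exp (- t)) * pairing f q"
proof -
  have scale: "pairing u (\<lambda>x. of_real (exp (- t)) * q x) = of_real (exp (- t)) * pairing u q" for u
    unfolding pairing_def integral_mult_right_zero[symmetric] by (simp add: mult.left_commute)
  have "pairing (T t f) q = pairing f (\<lambda>x. of_real (exp (- t)) * q x)"
    by (rule pairing_dense[OF q L2_cmult[OF q] t _ f])
      (unfold scale, rule generator_eigenfunctional[OF q bd _ t])
  then show ?thesis unfolding scale .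
qed

section \<open>Rigidity of reflected families\<close>

text \<open>Shift compatibility makes all \<open>R s\<close> reflections of one function: \<open>R s x = Z (s - x)\<close>. Then
  \<open>(R s, q) = (Z * q)(s)\<close>, and convolution with \<open>q\<close> is injective.\<close>

lemma shift_compatible_family_eq_0:
  assumes q: "q \<in> L2" "ae_eq q q0" "q0 \<in> causal" and D: "D \<in> causal"
    and qD: "conv q0 D = conv unit_step exp_step"
    and S: "0 < S" and R: "\<And>s. 0 < s \<Longrightarrow> s \<le> S \<Longrightarrow> R s \<in> L2"
    and supp: "AE x in lborel. S \<le> x \<longrightarrow> R S x = 0"
    and shift: "\<And>s. 0 < s \<Longrightarrow> s \<le> S \<Longrightarrow> AE x in lborel. 0 < x \<longrightarrow> R S (x + (S - s)) = R s x"
    and pair: "\<And>s. 0 < s \<Longrightarrow> s \<le> S \<Longrightarrow> pairing (R s) q = 0"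
  shows "ae_eq (R S) (\<lambda>x. 0)"
proof -
  have RS: "R S \<in> L2" using R S by simp
  obtain b where b: "b \<in> causal" "square_integrable lborel b" "ae_eq (R S) b" using L2_representative[OF RS] .
  note [measurable] = causalD(1)[OF b(1)] causalD(1)[OF q(3)]
  have b0: "AE x in lborel. S \<le> x \<longrightarrow> b x = 0"
    using supp b(3)[unfolded ae_eq_iff] by eventually_elim (use S in auto)
  \<comment> \<open>the reflection of the longest member \<open>R S\<close>, which contains all the others\<close>
  define Z where "Z y = (if 0 < y \<and> y < S then b (S - y) else 0)" for y
  have Zm [measurable]: "Z \<in> borel_measurable borel" unfolding Z_def[abs_def] by measurable
  have bs: "square_integrable lborel (\<lambda>y. b (S - y))" using square_integrable_affine[OF b(2), of "-1" S] by simp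
  have Z: "Z \<in> causal"
  proof -
    have "square_integrable lborel (cutoff c Z)" for c
      by (rule square_integrable_dominated(1)[OF bs]) (auto simp: cutoff_def Z_def)
    then show ?thesis using Zm by (auto simp: causal_def Z_def)
  qed
  have "conv Z q0 s = 0" if "s \<le> S" for s
  proof (cases "0 < s")
    case False then show ?thesis using conv_nonpos[OF Z q(3)] by simp
  next
    case True
    have eq: "AE x in halfline. R s x * q x = Z (s - x) * q0 x"
      unfolding AE_halfline
    proof -
      have "AE x in lborel. 0 < (S - s) + 1 * x \<longrightarrow> R S ((S - s) + 1 * x) = b ((S - s) + 1 * x)"
        by (rule AE_lborel_affine[OF b(3)[unfolded ae_eq_iff]]) simp
      moreover have "AE x in lborel. S \<le> (S - s) + 1 * x \<longrightarrow> b ((S - s) + 1 * x) = 0"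
        by (rule AE_lborel_affine[OF b0]) simp
      ultimately show "AE x in lborel. 0 < x \<longrightarrow> R s x * q x = Z (s - x) * q0 x"
        using shift[OF True that] q(2)[unfolded ae_eq_iff]
      proof eventually_elim
        case (elim x)
        show ?case
        proof
          assume x: "0 < x"
          then have "R s x = b (S - s + x)" using elim that by (simp add: add.commute)
          moreover have "Z (s - x) = (if x < s then b (S - s + x) else 0)"
            using x that True by (auto simp: Z_def algebra_simps)
          ultimately show "R s x * q x = Z (s - x) * q0 x" using elim x by auto
        qed
      qed
    qed
    have "conv Z q0 s = (LINT x|halfline. Z (s - x) * q0 x)"
      unfolding conv_def by (rule integral_halfline(1)[symmetric]) (use causalD(2)[OF q(3)] in auto)
    also have "\<dots> = pairing (R s) q"
      unfolding pairing_def
    proof (rule integral_cong_AE)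
      show "(\<lambda>x. Z (s - x) * q0 x) \<in> borel_measurable halfline" by (intro borel_measurable_halfline) measurable
      show "(\<lambda>x. R s x * q x) \<in> borel_measurable halfline"
        by (intro borel_measurable_times L2_measurable R True that q)
    qed (use eq in \<open>eventually_elim, simp\<close>)
    finally show ?thesis using pair[OF True that] by simp
  qed
  then have "AE x in lborel. x < S \<longrightarrow> Z x = 0" by (rule conv_injective[OF Z q(3) D qD])
  then have "AE x in lborel. S + (-1) * x < S \<longrightarrow> Z (S + (-1) * x) = 0" by (rule AE_lborel_affine) simp
  then show ?thesis using b0 b(3) unfolding ae_eq_iff
  proof eventually_elim
    case (elim x)
    then show ?case by (cases "x < S") (auto simp: Z_def)
  qed
qed

section \<open>Continuously differentiable functions are dense\<close>

definition C1 :: "(real \<Rightarrow> complex) \<Rightarrow> (real \<Rightarrow> complex) \<Rightarrow> bool" where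
  "C1 g g' \<longleftrightarrow> (\<forall>x. (g has_vector_derivative g' x) (at x)) \<and> continuous_on UNIV g'"

lemma C1_add: "C1 f f' \<Longrightarrow> C1 g g' \<Longrightarrow> C1 (\<lambda>x. f x + g x) (\<lambda>x. f' x + g' x)"
  by (auto simp: C1_def intro!: has_vector_derivative_add continuous_intros)

lemma C1_cmult: "C1 f f' \<Longrightarrow> C1 (\<lambda>x. c * f x) (\<lambda>x. c * f' x)"
  by (auto simp: C1_def intro!: has_vector_derivative_mult_right continuous_intros)

lemma C1_reflect:
  assumes "C1 f f'" shows "C1 (\<lambda>x. f (s - x)) (\<lambda>x. - f' (s - x))"
  unfolding C1_def
proof (intro conjI allI)
  fix x
  have "((\<lambda>x. s - x) has_real_derivative - 1) (at x)" by (auto intro!: derivative_eq_intros)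
  moreover have "(f has_vector_derivative f' (s - x)) (at (s - x))" using assms by (simp add: C1_def)
  ultimately have "(f \<circ> (\<lambda>x. s - x) has_vector_derivative (- 1) *\<^sub>R f' (s - x)) (at x)"
    by (intro vector_diff_chain_at) (simp_all add: has_real_derivative_iff_has_vector_derivative)
  then show "((\<lambda>x. f (s - x)) has_vector_derivative - f' (s - x)) (at x)" by (simp add: o_def)
  show "continuous_on UNIV (\<lambda>x. - f' (s - x))"
    using assms unfolding C1_def
    by (intro continuous_on_minus continuous_on_compose2[of UNIV f' UNIV "\<lambda>x. s - x"] continuous_intros) auto
qed

lemma C1_continuous: "C1 f f' \<Longrightarrow> continuous_on UNIV f"
  by (auto simp: C1_def intro!: continuous_at_imp_continuous_on has_vector_derivative_continuous)

lemma C1_loc_abs_cont: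
  assumes "C1 f f'" shows "loc_abs_cont_deriv f f'"
proof -
  have "absolutely_cont_on {0..b} f" if "b > 0" for b
    unfolding absolutely_cont_on_def
  proof (intro allI impI)
    fix e :: real assume e: "0 < e"
    have "bounded (f' ` {0..b})"
      using assms by (intro compact_imp_bounded compact_continuous_image) (auto simp: C1_def intro: continuous_on_subset)
    then obtain B where B: "0 < B" "\<And>x. x \<in> {0..b} \<Longrightarrow> cmod (f' x) \<le> B"
      by (auto simp: bounded_pos)
    have lip: "cmod (f y - f x) \<le> B * (y - x)" if "0 \<le> x" "x \<le> y" "y \<le> b" for x y
    proof -
      have "norm (f y - f x) \<le> B * norm (y - x)"
      proof (rule differentiable_bound[where S = "{0..b}" and f' = "\<lambda>x h. h *\<^sub>R f' x"])
        fix z assume z: "z \<in> {0..b}"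
        show "(f has_derivative (\<lambda>h. h *\<^sub>R f' z)) (at z within {0..b})"
          using assms unfolding C1_def has_vector_derivative_def by (blast intro: has_derivative_at_withinI)
        show "onorm (\<lambda>h. h *\<^sub>R f' z) \<le> B"
          using B(2)[OF z] by (intro onorm_le) (simp add: mult.commute[of B] mult_left_mono)
      qed (use that in auto)
      then show ?thesis using that by simp
    qed
    show "\<exists>\<delta>>0. \<forall>D. D division_of \<Union> D \<and> \<Union> D \<subseteq> {0..b} \<and> (\<Sum>I\<in>D. Sup I - Inf I) < \<delta> \<longrightarrow>
        (\<Sum>I\<in>D. cmod (f (Sup I) - f (Inf I))) < e"
    proof (intro exI[of _ "e / B"] conjI allI impI)
      fix D assume D: "D division_of \<Union> D \<and> \<Union> D \<subseteq> {0..b} \<and> (\<Sum>I\<in>D. Sup I - Inf I) < e / B"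
      have "(\<Sum>I\<in>D. cmod (f (Sup I) - f (Inf I))) \<le> (\<Sum>I\<in>D. B * (Sup I - Inf I))"
      proof (rule sum_mono)
        fix I assume I: "I \<in> D"
        obtain u v where uv: "I = cbox u v" "I \<noteq> {}" using D I division_ofD(3,4) by metis
        moreover have "I \<subseteq> {0..b}" using D I by auto
        ultimately show "cmod (f (Sup I) - f (Inf I)) \<le> B * (Sup I - Inf I)" using lip[of u v] by auto
      qed
      also have "\<dots> = B * (\<Sum>I\<in>D. Sup I - Inf I)" by (rule sum_distrib_left[symmetric])
      also have "\<dots> < e" using D B(1) by (simp add: pos_less_divide_eq mult.commute)
      finally show "(\<Sum>I\<in>D. cmod (f (Sup I) - f (Inf I))) < e" .
    qed (use e B in simp)
  qed
  moreover have "AE x in halfline. (f has_vector_derivative f' x) (at x)" using assms by (simp add: C1_def)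
  ultimately show ?thesis unfolding loc_abs_cont_deriv_def by (intro exI[of _ f]) (auto simp: ae_eq_def)
qed

lemma continuous_support_square_integrable:
  assumes "continuous_on UNIV f" "\<And>x. x \<notin> {p..r} \<Longrightarrow> f x = 0"
  shows "square_integrable lborel f"
proof -
  have "bounded (f ` {p..r})"
    by (intro compact_imp_bounded compact_continuous_image continuous_on_subset[OF assms(1)]) auto
  then obtain B where B: "0 < B" "\<And>x. x \<in> {p..r} \<Longrightarrow> cmod (f x) \<le> B" by (auto simp: bounded_pos)
  show ?thesis
  proof (rule square_integrable_bounded_support[of _ B p r])
    show "f \<in> borel_measurable lborel" using borel_measurable_continuous_onI[OF assms(1)] by simp
    show "cmod (f x) \<le> B" for x using B assms(2)[of x] by (cases "x \<in> {p..r}") auto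
  qed (use assms(2) in auto)
qed

text \<open>Twice a second difference of the continuously differentiable function \<open>(max 0 x)\<^sup>2\<close>, rising from \<open>0\<close> to \<open>1\<close> on \<open>[0, 1]\<close>.\<close>

definition smooth_step :: "real \<Rightarrow> real" where
  "smooth_step x = 2 * ((max 0 x)\<^sup>2 - 2 * (max 0 (x - 1 / 2))\<^sup>2 + (max 0 (x - 1))\<^sup>2)"

definition smooth_step' :: "real \<Rightarrow> real" where
  "smooth_step' x = 4 * (max 0 x - 2 * max 0 (x - 1 / 2) + max 0 (x - 1))"

lemma smooth_step_simps:
  "x \<le> 0 \<Longrightarrow> smooth_step x = 0" "1 \<le> x \<Longrightarrow> smooth_step x = 1"
  "x \<le> 0 \<Longrightarrow> smooth_step' x = 0" "1 \<le> x \<Longrightarrow> smooth_step' x = 0"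
  by (auto simp: smooth_step_def smooth_step'_def max_def power2_eq_square algebra_simps)

lemma smooth_step_bound: "\<bar>smooth_step x\<bar> \<le> 8"
proof (cases "0 \<le> x \<and> x \<le> 1")
  case True
  have "(max 0 x)\<^sup>2 \<le> 1" "(max 0 (x - 1 / 2))\<^sup>2 \<le> 1" "(max 0 (x - 1))\<^sup>2 \<le> 1"
    using True by (auto intro!: power_le_one)
  moreover have "0 \<le> (max 0 x)\<^sup>2" "0 \<le> (max 0 (x - 1 / 2))\<^sup>2" "0 \<le> (max 0 (x - 1))\<^sup>2" by simp_all
  moreover have "\<bar>2 * (u - 2 * v + w)\<bar> \<le> 8" if "u \<le> 1" "v \<le> 1" "w \<le> 1" "0 \<le> u" "0 \<le> v" "0 \<le> w" for u v w :: real
    using that by (simp add: abs_le_iff)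
  ultimately show ?thesis unfolding smooth_step_def by blast
next
  case False then show ?thesis using smooth_step_simps(1,2)[of x] by fastforce
qed

lemma max_square_deriv: "((\<lambda>x. (max 0 (x - c))\<^sup>2) has_real_derivative 2 * max 0 (x - c)) (at (x::real))"
proof -
  consider "x < c" | "x = c" | "c < x" by linarith
  then show ?thesis
  proof cases
    case 1
    have "((\<lambda>x. 0) has_real_derivative 0) (at x)" by simp
    then have "((\<lambda>x. (max 0 (x - c))\<^sup>2) has_real_derivative 0) (at x)"
      by (rule has_field_derivative_transform_within_open[of _ _ _ "{..<c}"]) (use 1 in auto)
    then show ?thesis using 1 by simp
  next
    case 2
    have "((\<lambda>h. ((max 0 (x + h - c))\<^sup>2 - (max 0 (x - c))\<^sup>2) / h) \<longlongrightarrow> 0) (at 0)"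
    proof (rule Lim_null_comparison)
      show "\<forall>\<^sub>F h in at 0. norm (((max 0 (x + h - c))\<^sup>2 - (max 0 (x - c))\<^sup>2) / h) \<le> \<bar>h\<bar>"
        by (rule always_eventually) (auto simp: 2 max_def power2_eq_square)
      show "((\<lambda>h::real. \<bar>h\<bar>) \<longlongrightarrow> 0) (at 0)" by (rule tendsto_rabs_zero) simp
    qed
    then show ?thesis using 2 by (simp add: DERIV_def)
  next
    case 3
    have "((\<lambda>x. (x - c)\<^sup>2) has_real_derivative 2 * (x - c)) (at x)" by (auto intro!: derivative_eq_intros)
    then have "((\<lambda>x. (max 0 (x - c))\<^sup>2) has_real_derivative 2 * (x - c)) (at x)"
      by (rule has_field_derivative_transform_within_open[of _ _ _ "{c<..}"]) (use 3 in auto)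
    then show ?thesis using 3 by simp
  qed
qed

lemma smooth_step_C1: "C1 (\<lambda>x. of_real (smooth_step (k * (x - c)))) (\<lambda>x. of_real (k * smooth_step' (k * (x - c))))"
  unfolding C1_def
proof (intro conjI allI)
  fix x
  have "(smooth_step has_real_derivative smooth_step' y) (at y)" for y
    unfolding smooth_step_def[abs_def] smooth_step'_def
    by (rule derivative_eq_intros max_square_deriv max_square_deriv[of 0, simplified] refl)+ simp
  then have "((\<lambda>x. smooth_step (k * (x - c))) has_real_derivative smooth_step' (k * (x - c)) * k) (at x)"
    by (rule DERIV_chain2) (auto intro!: derivative_eq_intros)
  then have "((\<lambda>x. smooth_step (k * (x - c))) has_vector_derivative k * smooth_step' (k * (x - c))) (at x)"
    by (simp add: has_real_derivative_iff_has_vector_derivative mult.commute)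
  then show "((\<lambda>x. complex_of_real (smooth_step (k * (x - c)))) has_vector_derivative of_real (k * smooth_step' (k * (x - c)))) (at x)"
    by (rule bounded_linear.has_vector_derivative[OF bounded_linear_of_real])
  show "continuous_on UNIV (\<lambda>x. complex_of_real (k * smooth_step' (k * (x - c))))"
    unfolding smooth_step'_def by (intro continuous_intros)
qed

lemma smooth_step_tendsto:
  "(\<lambda>n. smooth_step (real (Suc n) * y)) \<longlonglongrightarrow> (if 0 < y then 1 else 0)"
proof (cases "0 < y")
  case True
  obtain N :: nat where N: "1 / y < real N" using reals_Archimedean2 by blast
  have "smooth_step (real (Suc n) * y) = 1" if "N \<le> n" for n
  proof -
    have "1 / y < real (Suc n)" using N that by simp
    then have "1 \<le> real (Suc n) * y" using True by (simp add: pos_divide_less_eq del: of_nat_Suc)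
    then show ?thesis by (rule smooth_step_simps)
  qed
  then have "\<forall>\<^sub>F n in sequentially. smooth_step (real (Suc n) * y) = 1" unfolding eventually_sequentially by blast
  then show ?thesis using True by (simp add: tendsto_eventually)
next
  case False
  then have "smooth_step (real (Suc n) * y) = 0" for n
    by (intro smooth_step_simps mult_nonneg_nonpos) auto
  then show ?thesis using False by simp
qed

lemma interval_C1_approximation:
  assumes ab: "a \<le> b" and e: "0 < e"
  shows "\<exists>g g'. C1 g g' \<and> square_integrable lborel g \<and> square_integrable lborel g' \<and>
    norm2 lborel (\<lambda>x. indicator {a<..b} x - g x) < e"
proof -
  define g where "g n x = complex_of_real (smooth_step (real (Suc n) * (x - a))) + (- 1) * of_real (smooth_step (real (Suc n) * (x - b)))" for n x
  define g' where "g' n x = complex_of_real (real (Suc n) * smooth_step' (real (Suc n) * (x - a))) + (- 1) * of_real (real (Suc n) * smooth_step' (real (Suc n) * (x - b)))" for n x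
  have C: "C1 (g n) (g' n)" for n
    unfolding g_def[abs_def] g'_def[abs_def] by (intro C1_add C1_cmult smooth_step_C1)
  have out: "g n x = 0 \<and> g' n x = 0" if "x \<notin> {a..b + 1}" for n x
  proof (cases "x < a")
    case True
    then have "real (Suc n) * (x - a) \<le> 0" "real (Suc n) * (x - b) \<le> 0" using ab by (auto intro!: mult_nonneg_nonpos)
    then show ?thesis by (simp add: g_def g'_def smooth_step_simps del: of_nat_Suc)
  next
    case False
    then have "1 \<le> x - a" "1 \<le> x - b" using that ab by auto
    then have "1 * 1 \<le> real (Suc n) * (x - a)" "1 * 1 \<le> real (Suc n) * (x - b)" by (intro mult_mono; simp)+
    then show ?thesis by (simp add: g_def g'_def smooth_step_simps del: of_nat_Suc)
  qed
  have s: "square_integrable lborel (g n)" "square_integrable lborel (g' n)" for n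
    by (rule continuous_support_square_integrable[of _ a "b + 1"]; use C1_continuous[OF C] C out in \<open>auto simp: C1_def\<close>)+
  have "(\<lambda>n. norm2 lborel (\<lambda>x. g n x - indicator {a<..b} x)) \<longlonglongrightarrow> 0"
  proof (rule norm2_tendsto_0_dominated)
    show "g n \<in> borel_measurable lborel" for n by (rule square_integrable_measurable[OF s(1)])
    show "square_integrable lborel (\<lambda>x. 17 * indicator {a..b + 1} x :: complex)"
      by (rule square_integrable_bounded_support[of _ 17 a "b + 1"]) (auto simp: indicator_def)
    have "(\<lambda>n. g n x) \<longlonglongrightarrow> of_real (if 0 < x - a then 1 else 0) + (- 1) * of_real (if 0 < x - b then 1 else 0)" for x
      unfolding g_def by (intro tendsto_intros smooth_step_tendsto)
    moreover have "complex_of_real (if 0 < x - a then 1 else 0) + (- 1) * of_real (if 0 < x - b then 1 else 0) = indicator {a<..b} x" for x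
      using ab by (auto simp: indicator_def)
    ultimately show "AE x in lborel. (\<lambda>n. g n x) \<longlonglongrightarrow> indicator {a<..b} x" by simp
    show "AE x in lborel. cmod (g n x - indicator {a<..b} x) \<le> cmod (17 * indicator {a..b + 1} x)" for n
    proof (rule AE_I2)
      fix x
      show "cmod (g n x - indicator {a<..b} x) \<le> cmod (17 * indicator {a..b + 1} x)"
      proof (cases "x \<in> {a..b + 1}")
        case True
        have "cmod (g n x) \<le> 8 + 8"
          unfolding g_def by (intro order_trans[OF norm_triangle_ineq] add_mono) (simp_all add: norm_mult smooth_step_bound)
        moreover have "cmod (indicator {a<..b} x) \<le> 1" by (simp add: indicator_def)
        ultimately have "cmod (g n x - indicator {a<..b} x) \<le> 17"
          by (intro order_trans[OF norm_triangle_ineq4]) linarith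
        then show ?thesis using True by simp
      next
        case False
        then show ?thesis using out by (auto simp: indicator_def)
      qed
    qed
  qed simp
  then have "\<forall>\<^sub>F n in sequentially. norm2 lborel (\<lambda>x. g n x - indicator {a<..b} x) < e"
    using e by (rule order_tendstoD(2))
  then obtain n where "norm2 lborel (\<lambda>x. g n x - indicator {a<..b} x) < e" by (auto simp: eventually_sequentially)
  then show ?thesis using C s by (intro exI[of _ "g n"] exI[of _ "g' n"]) (simp add: norm2_minus_commute)
qed

lemma C1_approximation:
  assumes "square_integrable lborel f" "0 < e"
  shows "\<exists>g g'. C1 g g' \<and> square_integrable lborel g \<and> square_integrable lborel g' \<and>
    norm2 lborel (\<lambda>x. f x - g x) < e"
proof -
  have "\<forall>e>0. \<exists>g g'. C1 g g' \<and> square_integrable lborel g \<and> square_integrable lborel g' \<and> norm2 lborel (\<lambda>x. f x - g x) < e"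
    using assms(1)
  proof (induction rule: square_integrable_induct)
    case (interval a b)
    then show ?case using interval_C1_approximation by blast
  next
    case (add f1 f2)
    show ?case
    proof (intro allI impI)
      fix e :: real assume "0 < e"
      then have e2: "0 < e / 2" by simp
      obtain g1 g1' where 1: "C1 g1 g1'" "square_integrable lborel g1" "square_integrable lborel g1'" "norm2 lborel (\<lambda>x. f1 x - g1 x) < e / 2"
        using add.IH(1) e2 by blast
      obtain g2 g2' where 2: "C1 g2 g2'" "square_integrable lborel g2" "square_integrable lborel g2'" "norm2 lborel (\<lambda>x. f2 x - g2 x) < e / 2"
        using add.IH(2) e2 by blast
      have "norm2 lborel (\<lambda>x. (f1 x - g1 x) + (f2 x - g2 x)) < e"
        using norm2_triangle[OF square_integrable_diff(1)[OF add.hyps(1) 1(2)] square_integrable_diff(1)[OF add.hyps(2) 2(2)]] 1(4) 2(4)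
        by simp
      moreover have "(\<lambda>x. (f1 x - g1 x) + (f2 x - g2 x)) = (\<lambda>x. f1 x + f2 x - (g1 x + g2 x))" by (simp add: algebra_simps)
      ultimately show "\<exists>g g'. C1 g g' \<and> square_integrable lborel g \<and> square_integrable lborel g' \<and> norm2 lborel (\<lambda>x. f1 x + f2 x - g x) < e"
        using C1_add[OF 1(1) 2(1)] square_integrable_add(1)[OF 1(2) 2(2)] square_integrable_add(1)[OF 1(3) 2(3)]
        by (intro exI[of _ "\<lambda>x. g1 x + g2 x"] exI[of _ "\<lambda>x. g1' x + g2' x"]) simp
    qed
  next
    case (cmult f c)
    show ?case
    proof (intro allI impI)
      fix e :: real assume "0 < e"
      then have "0 < e / (cmod c + 1)" by (simp add: add_nonneg_pos)
      then obtain g g' where g: "C1 g g'" "square_integrable lborel g" "square_integrable lborel g'" "norm2 lborel (\<lambda>x. f x - g x) < e / (cmod c + 1)"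
        using cmult.IH by blast
      have pos: "0 < cmod c + 1" by (simp add: add_nonneg_pos)
      have "norm2 lborel (\<lambda>x. c * f x - c * g x) = cmod c * norm2 lborel (\<lambda>x. f x - g x)"
        using norm2_cmult[of lborel c "\<lambda>x. f x - g x"] by (simp add: right_diff_distrib)
      also have "\<dots> \<le> cmod c * (e / (cmod c + 1))" using g(4) by (intro mult_left_mono) auto
      also have "\<dots> < e" using \<open>0 < e\<close> pos by (simp add: field_simps)
      finally show "\<exists>g g'. C1 g g' \<and> square_integrable lborel g \<and> square_integrable lborel g' \<and> norm2 lborel (\<lambda>x. c * f x - g x) < e"
        using C1_cmult[OF g(1)] square_integrable_cmult[OF g(2)] square_integrable_cmult[OF g(3)] by blast
    qed
  next
    case (limit F f)
    show ?case
    proof (intro allI impI)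
      fix e :: real assume "0 < e"
      then have e2: "0 < e / 2" by simp
      obtain n where n: "norm2 lborel (\<lambda>x. F n x - f x) < e / 2"
        using order_tendstoD(2)[OF limit.hyps(3) e2] by (auto simp: eventually_sequentially)
      obtain g g' where g: "C1 g g'" "square_integrable lborel g" "square_integrable lborel g'" "norm2 lborel (\<lambda>x. F n x - g x) < e / 2"
        using limit.IH[of n] e2 by blast
      have "norm2 lborel (\<lambda>x. f x - g x) < e"
        using norm2_diff_triangle[OF limit.hyps(2) limit.hyps(1) g(2), of n] n g(4) by (simp add: norm2_minus_commute)
      then show "\<exists>g g'. C1 g g' \<and> square_integrable lborel g \<and> square_integrable lborel g' \<and> norm2 lborel (\<lambda>x. f x - g x) < e"
        using g by blast
    qed
  qed
  then show ?thesis using assms(2) by blast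
qed

lemma square_integrable_imp_L2:
  assumes "square_integrable lborel f" shows "f \<in> L2" "L2_norm f \<le> norm2 lborel f"
proof -
  have [measurable]: "f \<in> borel_measurable borel" using assms by auto
  let ?f = "\<lambda>x. if 0 < x then f x else 0"
  have m: "?f \<in> borel_measurable borel" by measurable
  have s: "square_integrable lborel ?f" "norm2 lborel ?f \<le> norm2 lborel f"
    by (rule square_integrable_dominated[OF assms]; use m in simp)+
  have h: "square_integrable halfline ?f" "norm2 halfline ?f = norm2 lborel ?f"
    using square_integrable_halfline[OF m] s(1) by auto
  have ae: "AE x in halfline. ?f x = f x" by (simp add: AE_halfline)
  have fm: "f \<in> borel_measurable halfline" by (rule borel_measurable_halfline) simp
  show "f \<in> L2" using square_integrable_cong_AE[OF h(1) fm ae] by (simp add: L2_iff)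
  have "norm2 halfline ?f = norm2 halfline f"
    by (rule norm2_cong_AE[OF borel_measurable_halfline[OF m] fm ae])
  then show "L2_norm f \<le> norm2 lborel f" using h(2) s(2) by (simp add: L2_norm_eq)
qed

lemma L2_C1_approximation:
  assumes f: "f \<in> L2" and e: "0 < e"
  obtains g g' where "C1 g g'" "g \<in> L2" "g' \<in> L2" "L2_norm (\<lambda>x. f x - g x) < e"
proof -
  obtain f0 where f0: "f0 \<in> causal" "square_integrable lborel f0" "ae_eq f f0" using L2_representative[OF f] .
  obtain g g' where g: "C1 g g'" "square_integrable lborel g" "square_integrable lborel g'" "norm2 lborel (\<lambda>x. f0 x - g x) < e"
    using C1_approximation[OF f0(2) e] by blast
  note gL = square_integrable_imp_L2(1)[OF g(2)]
  have "L2_norm (\<lambda>x. f x - g x) = L2_norm (\<lambda>x. f0 x - g x)"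
  proof (rule L2_norm_cong)
    show "ae_eq (\<lambda>x. f x - g x) (\<lambda>x. f0 x - g x)" using f0(3) unfolding ae_eq_def by eventually_elim simp
  qed (intro L2_diff f gL square_integrable_imp_L2(1)[OF f0(2)])+
  also have "\<dots> < e"
    using square_integrable_imp_L2(2)[OF square_integrable_diff(1)[OF f0(2) g(2)]] g(4) by simp
  finally show ?thesis using that g gL square_integrable_imp_L2(1)[OF g(3)] by blast
qed

lemma conv_unit_C1:
  assumes h: "h \<in> causal" and c: "continuous_on UNIV h"
  shows "C1 (conv unit_step h) h"
  unfolding C1_def
proof (intro conjI allI c)
  fix t :: real
  define R where "R = \<bar>t\<bar> + 1"
  have eq: "conv unit_step h y = integral {-R..y} h" for y
  proof -
    have [measurable]: "h \<in> borel_measurable borel" "unit_step \<in> borel_measurable borel"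
      using causalD(1)[OF h] causalD(1)[OF unit_step_causal] by auto
    have "conv unit_step h y = (LBINT x:{-R..y}. h x)"
      unfolding conv_def set_lebesgue_integral_def
    proof (rule integral_cong_AE)
      show "AE x in lborel. unit_step (y - x) * h x = indicator {-R..y} x *\<^sub>R h x"
        using AE_lborel_singleton[of y]
        by eventually_elim (use causalD(2)[OF h] in \<open>auto simp: unit_step_def indicator_def R_def\<close>)
    qed measurable
    also have "\<dots> = integral {-R..y} h"
      by (rule set_borel_integral_eq_integral(2))
        (rule borel_integrable_atLeastAtMost', rule continuous_on_subset[OF c], simp)
    finally show ?thesis .
  qed
  have "((\<lambda>y. integral {-R..y} h) has_vector_derivative h t) (at t within {-R..R})"
    by (rule integral_has_vector_derivative[OF continuous_on_subset[OF c]]) (auto simp: R_def)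
  moreover have "at t within {-R..R} = at t"
    by (rule at_within_interior) (auto simp: R_def)
  ultimately show "(conv unit_step h has_vector_derivative h t) (at t)"
    unfolding eq[abs_def] by simp
qed

section \<open>Reflected families\<close>

lemma reflect_L2:
  assumes h: "h \<in> causal"
  shows "(\<lambda>x. h (s - x)) \<in> L2" and "L2_norm (\<lambda>x. h (s - x)) \<le> norm2 lborel (cutoff s h)"
proof -
  have [measurable]: "h \<in> borel_measurable borel" by (rule causalD[OF h])
  have c: "square_integrable lborel (\<lambda>x. cutoff s h (s - x))"
    using square_integrable_affine[OF causalD(3)[OF h], of "-1"] by simp
  have ae: "AE x in halfline. cutoff s h (s - x) = h (s - x)" by (simp add: AE_halfline cutoff_def)
  have m: "(\<lambda>x. h (s - x)) \<in> borel_measurable halfline" by (rule borel_measurable_halfline) measurable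
  have L: "(\<lambda>x. cutoff s h (s - x)) \<in> L2" by (rule square_integrable_imp_L2(1)[OF c])
  then show 1: "(\<lambda>x. h (s - x)) \<in> L2"
    using square_integrable_cong_AE[OF _ m ae] by (simp add: L2_iff)
  have "L2_norm (\<lambda>x. h (s - x)) = L2_norm (\<lambda>x. cutoff s h (s - x))"
    by (rule L2_norm_cong[OF 1 L]) (simp add: ae_eq_iff cutoff_def)
  then show "L2_norm (\<lambda>x. h (s - x)) \<le> norm2 lborel (cutoff s h)"
    using square_integrable_imp_L2(2)[OF c] by (simp add: norm2_reflect)
qed

lemma reflect_continuous:
  assumes h: "h \<in> causal" and e: "0 < e"
  shows "\<exists>d>0. \<forall>t. \<bar>t - t0\<bar> < d \<longrightarrow> L2_norm (\<lambda>x. h (t - x) - h (t0 - x)) < e"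
proof -
  let ?h = "cutoff (t0 + 1) h"
  have sr: "square_integrable lborel (\<lambda>x. ?h (t - x))" for t
    using square_integrable_affine[OF causalD(3)[OF h], of "-1"] by simp
  have "\<forall>\<^sub>F k in at 0. norm2 lborel (\<lambda>x. ?h (x + k) - ?h x) < e"
    using norm2_translation_continuous[OF causalD(3)[OF h]] e by (rule order_tendstoD(2))
  then obtain d where d: "d > 0" "\<And>k. k \<noteq> 0 \<Longrightarrow> \<bar>k\<bar> < d \<Longrightarrow> norm2 lborel (\<lambda>x. ?h (x + k) - ?h x) < e"
    unfolding eventually_at by (auto simp: dist_real_def)
  have "L2_norm (\<lambda>x. h (t - x) - h (t0 - x)) < e" if t: "\<bar>t - t0\<bar> < min d 1" for t
  proof (cases "t = t0")
    case True then show ?thesis using e by (simp add: L2_norm_def)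
  next
    case False
    have "L2_norm (\<lambda>x. h (t - x) - h (t0 - x)) = L2_norm (\<lambda>x. ?h (t - x) - ?h (t0 - x))"
    proof (rule L2_norm_cong)
      show "(\<lambda>x. ?h (t - x) - ?h (t0 - x)) \<in> L2"
        by (rule square_integrable_imp_L2(1)[OF square_integrable_diff(1)[OF sr sr]])
      show "ae_eq (\<lambda>x. h (t - x) - h (t0 - x)) (\<lambda>x. ?h (t - x) - ?h (t0 - x))"
        unfolding ae_eq_iff using t by (intro AE_I2) (auto simp: cutoff_def)
    qed (intro L2_diff reflect_L2 h)
    also have "\<dots> \<le> norm2 lborel (\<lambda>x. ?h (t - x) - ?h (t0 - x))"
      by (rule square_integrable_imp_L2(2)[OF square_integrable_diff(1)[OF sr sr]])
    also have "\<dots> = norm2 lborel (\<lambda>x. ?h (x + (t - t0)) - ?h x)"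
      using norm2_reflect[of "\<lambda>x. ?h (x + (t - t0)) - ?h x" t0] by (simp add: algebra_simps)
    also have "\<dots> < e" using d(2)[of "t - t0"] t False by simp
    finally show ?thesis .
  qed
  then show ?thesis using d(1) by (intro exI[of _ "min d 1"]) auto
qed

lemma pairing_reflect:
  assumes h: "h \<in> causal" and q: "q \<in> L2" "ae_eq q q0" "q0 \<in> causal"
  shows "pairing (\<lambda>x. h (s - x)) q = conv h q0 s"
proof -
  have [measurable]: "h \<in> borel_measurable borel" "q0 \<in> borel_measurable borel"
    using causalD(1)[OF h] causalD(1)[OF q(3)] by auto
  have "pairing (\<lambda>x. h (s - x)) q = pairing (\<lambda>x. h (s - x)) q0"
    unfolding pairing_def
  proof (rule integral_cong_AE)
    show "AE x in halfline. h (s - x) * q x = h (s - x) * q0 x"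
      using q(2) unfolding ae_eq_def by eventually_elim simp
    show "(\<lambda>x. h (s - x) * q x) \<in> borel_measurable halfline"
      by (intro borel_measurable_times L2_measurable q borel_measurable_halfline) measurable
    show "(\<lambda>x. h (s - x) * q0 x) \<in> borel_measurable halfline"
      by (intro borel_measurable_halfline) measurable
  qed
  also have "\<dots> = conv h q0 s"
    unfolding conv_def by (rule pairing_borel) (use causalD(2)[OF q(3)] in auto)
  finally show ?thesis .
qed

lemma norm2_cutoff_unit_step: "0 \<le> s \<Longrightarrow> norm2 lborel (cutoff s unit_step) = sqrt s"
proof -
  assume s: "0 \<le> s"
  have "(\<lambda>x. (cmod (cutoff s unit_step x))\<^sup>2) = indicator {0<..s}"
    by (auto simp: cutoff_def unit_step_def indicator_def)
  then show ?thesis using s by (simp add: norm2_def)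
qed

text \<open>Integration gains a factor \<open>s\<close> on \<open>(0, s)\<close>: one \<open>\<surd>s\<close> from Cauchy-Schwarz and one from the length.\<close>

lemma norm2_cutoff_conv_unit:
  assumes h: "h \<in> causal" and s: "0 \<le> s"
  shows "norm2 lborel (cutoff s (conv unit_step h)) \<le> s * norm2 lborel (cutoff s h)"
proof -
  let ?N = "norm2 lborel (cutoff s h)"
  have "norm2 lborel (cutoff s (conv unit_step h)) \<le> norm2 lborel (\<lambda>x. of_real (sqrt s * ?N) * cutoff s unit_step x)"
  proof (rule square_integrable_dominated(2)[OF square_integrable_cmult[OF causalD(3)[OF unit_step_causal]]])
    show "cutoff s (conv unit_step h) \<in> borel_measurable lborel"
      using causalD(1)[OF conv_causal[OF unit_step_causal h]] by simp
    show "AE x in lborel. cmod (cutoff s (conv unit_step h) x) \<le> cmod (of_real (sqrt s * ?N) * cutoff s unit_step x)"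
    proof (rule AE_I2)
      fix x
      show "cmod (cutoff s (conv unit_step h) x) \<le> cmod (of_real (sqrt s * ?N) * cutoff s unit_step x)"
        using conv_bound[OF unit_step_causal h, of x s] conv_nonpos[OF unit_step_causal h, of x] s
        by (cases "x \<le> 0") (auto simp: cutoff_def unit_step_def norm2_cutoff_unit_step norm_mult)
    qed
  qed
  also have "\<dots> = sqrt s * ?N * sqrt s"
    unfolding norm2_cmult norm2_cutoff_unit_step[OF s] using s by (simp add: norm_mult)
  also have "\<dots> = s * ?N" using s by (simp add: mult.commute mult.left_commute real_sqrt_mult_self[of s])
  finally show ?thesis .
qed

lemma norm2_cutoff_small:
  assumes h: "h \<in> causal" and e: "0 < e"
  shows "\<exists>s>0. norm2 lborel (cutoff s h) < e"
proof -
  have "(\<lambda>n. norm2 lborel (\<lambda>x. cutoff (1 / real (Suc n)) h x - 0)) \<longlonglongrightarrow> 0"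
  proof (rule norm2_tendsto_0_dominated)
    show "cutoff (1 / real (Suc n)) h \<in> borel_measurable lborel" for n using causalD(1)[OF h] by simp
    show "square_integrable lborel (cutoff 1 h)" by (rule causalD[OF h])
    have "(\<lambda>n. cutoff (1 / real (Suc n)) h x) \<longlonglongrightarrow> 0" for x
    proof (cases "0 < x")
      case True
      obtain N where N: "1 / real (Suc N) < x" using nat_approx_posE[OF True] .
      have "cutoff (1 / real (Suc n)) h x = 0" if "N \<le> n" for n
      proof -
        have "1 / real (Suc n) \<le> 1 / real (Suc N)" using that by (intro divide_left_mono) auto
        then show ?thesis using N by (simp add: cutoff_def)
      qed
      then have "\<forall>\<^sub>F n in sequentially. cutoff (1 / real (Suc n)) h x = 0" unfolding eventually_sequentially by blast
      then show ?thesis by (rule tendsto_eventually)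
    next
      case False
      then have "cutoff c h x = 0" for c using causalD(2)[OF h, of x] by (simp add: cutoff_def)
      then show ?thesis by simp
    qed
    then show "AE x in lborel. (\<lambda>n. cutoff (1 / real (Suc n)) h x) \<longlonglongrightarrow> 0" by simp
    show "AE x in lborel. cmod (cutoff (1 / real (Suc n)) h x - 0) \<le> cmod (cutoff 1 h x)" for n
    proof (rule AE_I2)
      fix x
      have "x \<le> 1" if "x \<le> 1 / real (Suc n)"
        by (rule order_trans[OF that]) simp
      then show "cmod (cutoff (1 / real (Suc n)) h x - 0) \<le> cmod (cutoff 1 h x)"
        by (cases "x \<le> 1 / real (Suc n)") (simp_all add: cutoff_def del: of_nat_Suc)
    qed
  qed simp
  then have "\<forall>\<^sub>F n in sequentially. norm2 lborel (\<lambda>x. cutoff (1 / real (Suc n)) h x - 0) < e"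
    using e by (rule order_tendstoD(2))
  then obtain n where "norm2 lborel (cutoff (1 / real (Suc n)) h) < e" by (auto simp: eventually_sequentially)
  then show ?thesis by (intro exI[of _ "1 / real (Suc n)"]) auto
qed

text \<open>The generator is \<open>A\<^sub>M\<close>, but \<open>M\<close> itself has disappeared: of the relation between \<open>q\<close> and \<open>d\<^sup>M\<close> only the
  convolution identity \<open>q * D = 1 - e\<^bsup>-t\<^esup>\<close> is kept. The function \<open>q0\<close> is a Borel representative of \<open>q\<close>.\<close>

locale boundary_semigroup = L2_semigroup +
  fixes q q0 D :: "real \<Rightarrow> complex"
  assumes q: "q \<in> L2" "ae_eq q q0" "q0 \<in> causal" and D: "D \<in> causal"
    and qD: "conv q0 D = conv unit_step exp_step"
    and generator_iff: "(f, g) \<in> generator T \<longleftrightarrow> f \<in> L2 \<and> g \<in> L2 \<and>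
      (\<exists>f'. f' \<in> L2 \<and> loc_abs_cont_deriv f f' \<and> pairing (\<lambda>x. f x - f' x) q = 0 \<and> ae_eq g (\<lambda>x. - f' x))"
begin

text \<open>With \<open>J = 1 * 1 * D\<close>, the functions \<open>J (s - x)\<close> violate the boundary condition by \<open>s\<^sup>2 / 2\<close>, but their norm
  is \<open>o(s\<^sup>2)\<close>: a smooth function can be moved into the domain of the generator by a small correction.\<close>

lemma boundary_correction:
  assumes e: "0 < e"
  obtains v v' where "C1 v v'" "v \<in> L2" "v' \<in> L2" "pairing (\<lambda>x. v x - v' x) q = 1" "L2_norm v < e"
proof -
  obtain s where s: "s > 0" "norm2 lborel (cutoff s D) < e / 2" using norm2_cutoff_small[OF D, of "e / 2"] e by auto
  define K where "K = conv unit_step D"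
  define J where "J = conv unit_step K"
  have K: "K \<in> causal" unfolding K_def using D by simp
  have J: "J \<in> causal" unfolding J_def using K by simp
  have CJ: "C1 J K" unfolding J_def by (rule conv_unit_C1[OF K]) (simp add: K_def conv_continuous D)
  define c where "c = complex_of_real (2 / s\<^sup>2)"
  have sum: "(\<lambda>x. J (s - x) - - K (s - x)) = (\<lambda>x. (\<lambda>y. J y + K y) (s - x))" by simp
  have "conv (\<lambda>y. J y + K y) q0 s = of_real (s\<^sup>2 / 2)"
  proof -
    let ?h = unit_step and ?x = exp_step
    have "conv K q0 = conv ?h (conv q0 D)"
      unfolding K_def using q(3) D by (simp add: conv_assoc conv_commute[of D q0])
    then have Kq: "conv K q0 = conv ?h (conv ?h ?x)" by (simp add: qD)
    have Jq: "conv J q0 = conv ?h (conv ?h (conv ?h ?x))"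
      unfolding J_def using K q(3) by (simp add: conv_assoc Kq)
    have "conv ?h (conv ?h ?h) = conv ?h (conv ?h (\<lambda>x. ?x x + conv ?h ?x x))" unfolding exp_step_resolvent ..
    also have "\<dots> = conv ?h (\<lambda>t. conv ?h ?x t + conv ?h (conv ?h ?x) t)" by (simp add: conv_add_right)
    also have "\<dots> = (\<lambda>t. conv K q0 t + conv J q0 t)" by (simp add: conv_add_right Kq Jq)
    finally have "conv (\<lambda>y. J y + K y) q0 s = conv ?h (conv ?h ?h) s"
      using conv_add_left[OF J K q(3)] by (simp add: add.commute)
    then show ?thesis using conv_unit_unit_unit[of s] s(1) by simp
  qed
  then have pJ: "pairing (\<lambda>x. J (s - x) - - K (s - x)) q = of_real (s\<^sup>2 / 2)"
    unfolding sum pairing_reflect[OF causal_add[OF J K] q] .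
  note JL = reflect_L2(1)[OF J, of s] and KL = reflect_L2(1)[OF K, of s]
  have KL': "(\<lambda>x. - K (s - x)) \<in> L2" using L2_cmult[OF KL, of "-1"] by simp
  show ?thesis
  proof (rule that)
    show "C1 (\<lambda>x. c * J (s - x)) (\<lambda>x. c * - K (s - x))" by (rule C1_cmult[OF C1_reflect[OF CJ]])
    show "(\<lambda>x. c * J (s - x)) \<in> L2" by (rule L2_cmult[OF JL])
    show "(\<lambda>x. c * - K (s - x)) \<in> L2" by (rule L2_cmult[OF KL'])
    have "(\<lambda>x. c * J (s - x) - c * - K (s - x)) = (\<lambda>x. c * (J (s - x) - - K (s - x)))" by (simp add: algebra_simps)
    then show "pairing (\<lambda>x. c * J (s - x) - c * - K (s - x)) q = 1"
      using pairing_linear(3)[OF L2_diff[OF JL KL'] JL q(1), of c] s(1) unfolding pJ by (simp add: c_def)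
    have "norm2 lborel (cutoff s J) \<le> s * (s * norm2 lborel (cutoff s D))"
    proof (rule order_trans)
      show "norm2 lborel (cutoff s J) \<le> s * norm2 lborel (cutoff s K)"
        unfolding J_def by (rule norm2_cutoff_conv_unit[OF K]) (use s in simp)
      show "s * norm2 lborel (cutoff s K) \<le> s * (s * norm2 lborel (cutoff s D))"
        unfolding K_def by (intro mult_left_mono norm2_cutoff_conv_unit[OF D]) (use s in simp_all)
    qed
    also have "\<dots> < s * (s * (e / 2))" using s by (intro mult_strict_left_mono) auto
    finally have "L2_norm (\<lambda>x. J (s - x)) < s * (s * (e / 2))" using reflect_L2(2)[OF J, of s] by simp
    then have "2 / s\<^sup>2 * L2_norm (\<lambda>x. J (s - x)) < 2 / s\<^sup>2 * (s * (s * (e / 2)))"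
      using s(1) by (intro mult_strict_left_mono) auto
    also have "\<dots> = e" using s(1) by (simp add: power2_eq_square)
    finally show "L2_norm (\<lambda>x. c * J (s - x)) < e"
      unfolding L2_norm_eq norm2_cmult c_def norm_of_real by simp
  qed
qed

sublocale transport_semigroup
proof
  fix f g assume "(f, g) \<in> generator T"
  then show "\<exists>f'. f' \<in> L2 \<and> loc_abs_cont_deriv f f' \<and> ae_eq g (\<lambda>x. - f' x)" unfolding generator_iff by blast
next
  fix f :: "real \<Rightarrow> complex" and e :: real assume f: "f \<in> L2" and e: "0 < e"
  have "0 < e / 2" using e by simp
  then obtain g g' where g: "C1 g g'" "g \<in> L2" "g' \<in> L2" "L2_norm (\<lambda>x. f x - g x) < e / 2"
    using L2_C1_approximation[OF f] by blast
  define c where "c = pairing (\<lambda>x. g x - g' x) q"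
  have c1: "0 < cmod c + 1" by (simp add: add_nonneg_pos)
  have "0 < e / 2 / (cmod c + 1)" using e c1 by simp
  then obtain v v' where v: "C1 v v'" "v \<in> L2" "v' \<in> L2" "pairing (\<lambda>x. v x - v' x) q = 1" "L2_norm v < e / 2 / (cmod c + 1)"
    by (rule boundary_correction)
  let ?u = "\<lambda>x. g x + (- c) * v x" and ?u' = "\<lambda>x. g' x + (- c) * v' x"
  have u: "?u \<in> L2" "?u' \<in> L2" by (intro L2_add L2_cmult g v)+
  have eq: "(\<lambda>x. ?u x - ?u' x) = (\<lambda>x. (g x - g' x) + (- c) * (v x - v' x))" by (simp add: algebra_simps)
  have "pairing (\<lambda>x. ?u x - ?u' x) q = pairing (\<lambda>x. g x - g' x) q + pairing (\<lambda>x. (- c) * (v x - v' x)) q"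
    unfolding eq by (rule pairing_linear(1)[OF L2_diff[OF g(2,3)] L2_cmult[OF L2_diff[OF v(2,3)]] q(1)])
  also have "pairing (\<lambda>x. (- c) * (v x - v' x)) q = (- c) * pairing (\<lambda>x. v x - v' x) q"
    by (rule pairing_linear(3)[OF L2_diff[OF v(2,3)] v(2) q(1)])
  finally have bd: "pairing (\<lambda>x. ?u x - ?u' x) q = 0" by (simp add: v(4) c_def)
  have "(?u, \<lambda>x. - ?u' x) \<in> generator T"
    unfolding generator_iff
  proof (intro conjI exI[of _ ?u'])
    show "(\<lambda>x. - ?u' x) \<in> L2" using L2_cmult[OF u(2), of "-1"] by simp
    show "loc_abs_cont_deriv ?u ?u'" by (rule C1_loc_abs_cont[OF C1_add[OF g(1) C1_cmult[OF v(1)]]])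
  qed (use u bd in \<open>auto simp: ae_eq_def\<close>)
  moreover have "L2_norm (\<lambda>x. f x - ?u x) < e"
  proof -
    have "L2_norm (\<lambda>x. (f x - g x) + c * v x) \<le> L2_norm (\<lambda>x. f x - g x) + L2_norm (\<lambda>x. c * v x)"
      by (intro L2_norm_triangle L2_diff L2_cmult f g v)
    moreover have "L2_norm (\<lambda>x. c * v x) \<le> e / 2"
    proof -
      have "L2_norm (\<lambda>x. c * v x) = cmod c * L2_norm v" by (simp add: L2_norm_eq norm2_cmult)
      also have "\<dots> \<le> (cmod c + 1) * (e / 2 / (cmod c + 1))"
        using v(5) c1 by (intro mult_mono) (auto simp: L2_norm_eq)
      also have "\<dots> = e / 2" by (rule nonzero_mult_div_cancel_left[THEN trans[OF times_divide_eq_right]]) (use c1 in simp)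
      finally show ?thesis .
    qed
    moreover have "(\<lambda>x. (f x - g x) + c * v x) = (\<lambda>x. f x - ?u x)" by (simp add: algebra_simps)
    ultimately show ?thesis using g(4) by simp
  qed
  ultimately show "\<exists>u v. (u, v) \<in> generator T \<and> L2_norm (\<lambda>x. f x - u x) < e" by blast
qed

lemma boundary_eigenfunctional:
  assumes "f \<in> L2" "0 \<le> t"
  shows "pairing (T t f) q = of_real (exp (- t)) * pairing f q"
proof (rule eigenfunctional[OF q(1) _ assms])
  fix f g assume "(f, g) \<in> generator T"
  then obtain f' where f': "f \<in> L2" "g \<in> L2" "f' \<in> L2" "pairing (\<lambda>x. f x - f' x) q = 0" "ae_eq g (\<lambda>x. - f' x)"
    unfolding generator_iff by blast
  have "pairing (\<lambda>x. f x + g x) q = pairing (\<lambda>x. f x - f' x) q"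
  proof (rule pairing_cong)
    show "ae_eq (\<lambda>x. f x + g x) (\<lambda>x. f x - f' x)" using f'(5) unfolding ae_eq_def by eventually_elim simp
  qed (use f' q in \<open>auto intro: L2_add L2_diff simp: ae_eq_def\<close>)
  then show "pairing (\<lambda>x. f x + g x) q = 0" using f'(4) by simp
qed

lemma pairing_reflect_D:
  assumes "0 \<le> t" shows "pairing (\<lambda>x. D (t - x)) q = 1 - of_real (exp (- t))"
  using pairing_reflect[OF D q, of t] conv_unit_exp[OF assms] by (simp add: conv_commute[of D] qD)

lemma family_eq_0:
  assumes S: "0 < S" and R: "\<And>s. 0 < s \<Longrightarrow> s \<le> S \<Longrightarrow> R s \<in> L2"
    and supp: "AE x in lborel. S \<le> x \<longrightarrow> R S x = 0"
    and shift: "\<And>s. 0 < s \<Longrightarrow> s \<le> S \<Longrightarrow> AE x in lborel. 0 < x \<longrightarrow> R S (x + (S - s)) = R s x"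
    and pair: "\<And>s. 0 < s \<Longrightarrow> s \<le> S \<Longrightarrow> pairing (R s) q = 0"
  shows "ae_eq (R S) (\<lambda>x. 0)"
  using shift_compatible_family_eq_0[OF q D qD S R supp shift pair] .

text \<open>The differences \<open>T s d\<^sub>t - d\<^sub>s\<^sub>+\<^sub>t + d\<^sub>s\<close> are compatible with shifts and annihilated by \<open>q\<close>, because
  \<open>e\<^bsup>-s\<^esup> (1 - e\<^bsup>-t\<^esup>) - (1 - e\<^bsup>-s-t\<^esup>) + (1 - e\<^bsup>-s\<^esup>) = 0\<close>.\<close>

lemma T_reflect_D:
  assumes S: "0 < S" and t: "0 < t"
  shows "ae_eq (T S (\<lambda>x. D (t - x))) (\<lambda>x. D (S + t - x) - D (S - x))"
proof -
  let ?d = "\<lambda>x. D (t - x)"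
  have d: "?d \<in> L2" by (rule reflect_L2(1)[OF D])
  define R where "R s x = T s ?d x - D (s + t - x) + D (s - x)" for s x
  have "ae_eq (R S) (\<lambda>x. 0)"
  proof (rule family_eq_0[OF S])
    fix s assume s: "0 < s" "s \<le> S"
    have Ts: "T s ?d \<in> L2" using T_L2 d s by simp
    show "R s \<in> L2"
      unfolding R_def[abs_def] by (intro L2_add L2_diff Ts reflect_L2 D)
    have "AE x in lborel. 0 < (S - s) + 1 * x \<longrightarrow> T ((S - s) + s) ?d ((S - s) + 1 * x) = T (S - s) (T s ?d) ((S - s) + 1 * x)"
      by (rule AE_lborel_affine) (use T_time_add[of "S - s" s ?d] d s in \<open>auto simp: ae_eq_iff\<close>)
    moreover have "AE x in lborel. 0 < x \<longrightarrow> T (S - s) (T s ?d) (x + (S - s)) = T s ?d x"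
      by (rule left_shift[OF Ts]) (use s in simp)
    ultimately show "AE x in lborel. 0 < x \<longrightarrow> R S (x + (S - s)) = R s x"
      by eventually_elim (use s in \<open>auto simp: R_def algebra_simps\<close>)
    have "pairing (R s) q = pairing (T s ?d) q - pairing (\<lambda>x. D (s + t - x)) q + pairing (\<lambda>x. D (s - x)) q"
      unfolding R_def[abs_def]
        pairing_linear(1)[OF L2_diff[OF Ts reflect_L2(1)[OF D]] reflect_L2(1)[OF D] q(1)]
        pairing_linear(2)[OF Ts reflect_L2(1)[OF D] q(1)] ..
    also have "\<dots> = of_real (exp (- s)) * (1 - of_real (exp (- t))) - (1 - of_real (exp (- (s + t)))) + (1 - of_real (exp (- s)))"
      using s t by (simp only: boundary_eigenfunctional[OF d less_imp_le] pairing_reflect_D less_imp_le add_nonneg_nonneg)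
    also have "\<dots> = 0" by (simp add: exp_add exp_diff exp_minus field_simps)
    finally show "pairing (R s) q = 0" .
  next
    have "AE x in lborel. 0 < (- S) + 1 * x \<longrightarrow> T S ?d ((- S) + 1 * x + S) = ?d ((- S) + 1 * x)"
      by (rule AE_lborel_affine[OF left_shift[OF d]]) (use S in auto)
    then show "AE x in lborel. S \<le> x \<longrightarrow> R S x = 0"
      using AE_lborel_singleton[of S]
      by eventually_elim (use causalD(2)[OF D] in \<open>auto simp: R_def algebra_simps\<close>)
  qed
  then show ?thesis unfolding ae_eq_def R_def by eventually_elim (simp add: algebra_simps)
qed

text \<open>A cocycle is determined up to a factor by its pairings \<open>p(t)\<close> with \<open>q\<close>, and the two expansions of
  \<open>p(1 + t)\<close> force \<open>p(t) = c (1 - e\<^bsup>-t\<^esup>)\<close> with \<open>c = p(1) / (1 - e\<^bsup>-1\<^esup>)\<close>.\<close>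

lemma cocycle_unique:
  assumes d: "\<And>t. 0 < t \<Longrightarrow> d t \<in> L2" and supp: "\<And>t. 0 < t \<Longrightarrow> AE x in lborel. t \<le> x \<longrightarrow> d t x = 0"
    and cocycle: "\<And>s t. 0 < s \<Longrightarrow> 0 < t \<Longrightarrow> ae_eq (d (s + t)) (\<lambda>x. d s x + T s (d t) x)"
  shows "\<exists>c. \<forall>t>0. ae_eq (d t) (\<lambda>x. c * D (t - x))"
proof -
  define p where "p t = pairing (d t) q" for t
  have padd: "p (s + t) = p s + of_real (exp (- s)) * p t" if "0 < s" "0 < t" for s t
  proof -
    have Ts: "T s (d t) \<in> L2" using T_L2 d that by simp
    have "p (s + t) = pairing (\<lambda>x. d s x + T s (d t) x) q"
      unfolding p_def by (rule pairing_cong) (use cocycle[OF that] d that Ts q in \<open>auto intro: L2_add simp: ae_eq_def\<close>)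
    then show ?thesis
      using pairing_linear(1)[OF d[OF that(1)] Ts q(1)] boundary_eigenfunctional[OF d[OF that(2)], of s] that
      by (simp add: p_def)
  qed
  define E where "E t = complex_of_real (exp (- t))" for t
  have E1: "1 - E 1 \<noteq> 0"
  proof -
    have "exp (- 1) \<noteq> (1 :: real)" by simp
    then show ?thesis unfolding E_def by (metis eq_iff_diff_eq_0 of_real_eq_1_iff)
  qed
  define c where "c = p 1 / (1 - E 1)"
  have pc: "p t = c * (1 - E t)" if t: "0 < t" for t
  proof -
    have "p t + E t * p 1 = p 1 + E 1 * p t"
      using padd[of t 1] padd[of 1 t] t by (simp add: E_def add.commute)
    then have "p t * (1 - E 1) = p 1 * (1 - E t)" by (simp add: algebra_simps)
    then show ?thesis using E1 by (simp add: c_def field_simps)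
  qed
  have "ae_eq (d S) (\<lambda>x. c * D (S - x))" if S: "0 < S" for S
  proof -
    define R where "R s x = d s x - c * D (s - x)" for s x
    have "ae_eq (R S) (\<lambda>x. 0)"
    proof (rule family_eq_0[OF S])
      fix s assume s: "0 < s" "s \<le> S"
      note rL = reflect_L2(1)[OF D, of s]
      show "R s \<in> L2" unfolding R_def[abs_def] by (intro L2_diff L2_cmult rL d s)
      show "AE x in lborel. 0 < x \<longrightarrow> R S (x + (S - s)) = R s x"
      proof (cases "s = S")
        case False
        define r where "r = S - s"
        have r: "0 < r" "S = r + s" using s False by (auto simp: r_def)
        have 1: "AE x in lborel. 0 < r + 1 * x \<longrightarrow> d (r + s) (r + 1 * x) = d r (r + 1 * x) + T r (d s) (r + 1 * x)"
          by (rule AE_lborel_affine) (use cocycle[OF r(1) s(1)] in \<open>auto simp: ae_eq_iff\<close>)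
        have 2: "AE x in lborel. r \<le> r + 1 * x \<longrightarrow> d r (r + 1 * x) = 0"
          by (rule AE_lborel_affine[OF supp[OF r(1)]]) simp
        have 3: "AE x in lborel. 0 < x \<longrightarrow> T r (d s) (x + r) = d s x"
          by (rule left_shift[OF d[OF s(1)]]) (use r in simp)
        show ?thesis using 1 2 3
          by eventually_elim (use r in \<open>auto simp: R_def algebra_simps\<close>)
      qed simp
      have "pairing (R s) q = p s - c * pairing (\<lambda>x. D (s - x)) q"
        unfolding R_def[abs_def] pairing_linear(2)[OF d[OF s(1)] L2_cmult[OF rL] q(1)]
          pairing_linear(3)[OF rL rL q(1)] p_def ..
      then show "pairing (R s) q = 0" using pc[OF s(1)] pairing_reflect_D[of s] s by (simp add: E_def)
    next
      show "AE x in lborel. S \<le> x \<longrightarrow> R S x = 0"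
        using supp[OF S] by eventually_elim (use causalD(2)[OF D] in \<open>auto simp: R_def\<close>)
    qed
    then show ?thesis unfolding ae_eq_def R_def by eventually_elim simp
  qed
  then show ?thesis by blast
qed

end

section \<open>The Laplace transforms of the data\<close>

lemma has_laplace_real:
  assumes l: "has_laplace f (of_real z) w" and f: "f \<in> borel_measurable halfline" "ae_eq f f0"
    and f0: "f0 \<in> borel_measurable borel" "\<And>x. x \<le> 0 \<Longrightarrow> f0 x = 0"
  shows "real_laplace f0 z w"
proof -
  let ?e = "\<lambda>x. complex_of_real (exp (- z * x))"
  have e: "exp (- of_real z * of_real x) = ?e x" for x
    by (simp add: exp_of_real[symmetric])
  have em: "?e \<in> borel_measurable borel" by measurable
  have i: "integrable halfline (\<lambda>x. f x * ?e x)" "(LINT x|halfline. f x * ?e x) = w"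
    using l unfolding has_laplace_def e by auto
  have m: "(\<lambda>x. f x * ?e x) \<in> borel_measurable halfline" "(\<lambda>x. f0 x * ?e x) \<in> borel_measurable halfline"
    by (rule borel_measurable_times[OF f(1) borel_measurable_halfline[OF em]]
        borel_measurable_times[OF borel_measurable_halfline[OF f0(1)] borel_measurable_halfline[OF em]])+
  have ae: "AE x in halfline. f x * ?e x = f0 x * ?e x"
    using f(2) unfolding ae_eq_def by eventually_elim simp
  have b: "(\<lambda>x. f0 x * ?e x) \<in> borel_measurable borel" using f0(1) em by (rule borel_measurable_times)
  have "integrable halfline (\<lambda>x. f0 x * ?e x)" using integrable_cong_AE[OF m ae] i(1) by blast
  moreover have "(LINT x|halfline. f0 x * ?e x) = w" using integral_cong_AE[OF m ae] i(2) by simp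
  ultimately show ?thesis
    using integral_halfline[of "\<lambda>x. f0 x * ?e x", OF b] f0(2) by (simp add: real_laplace_def)
qed

text \<open>Lebesgue measure is complete, so measurability can be transferred along equality almost everywhere.\<close>

lemma measurable_halfline_AE:
  assumes g: "g \<in> borel_measurable halfline" and ae: "ae_eq g f"
  shows "f \<in> borel_measurable halfline"
proof -
  have G: "(\<lambda>x. if x \<in> {0<..} then g x else 0) \<in> borel_measurable lebesgue"
    using g by (subst borel_measurable_if) auto
  have "AE x in lebesgue. (if x \<in> {0<..} then g x else 0) = (if x \<in> {0<..} then f x else 0)"
    unfolding AE_completion_iff using ae[unfolded ae_eq_iff] by eventually_elim auto
  with G have "(\<lambda>x. if x \<in> {0<..} then f x else 0) \<in> borel_measurable lebesgue"
    by (rule borel_measurable_AE)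
  then show ?thesis by (subst (asm) borel_measurable_if) auto
qed

lemma L2_loc_representative:
  assumes "f \<in> L2_loc"
  obtains f0 where "f0 \<in> causal" "ae_eq f f0" "f \<in> borel_measurable halfline"
proof -
  have "(\<lambda>x. if x \<in> {0..} then f x else 0) \<in> borel_measurable lebesgue"
    using assms unfolding L2_loc_def by (subst borel_measurable_if) auto
  then have "(\<lambda>x. indicator {0<..} x * (if x \<in> {0..} then f x else 0)) \<in> borel_measurable lebesgue"
    by (intro borel_measurable_times borel_measurable_indicator) auto
  moreover have "(\<lambda>x. indicator {0<..} x * (if x \<in> {0..} then f x else 0)) = (\<lambda>x. if x \<in> {0<..} then f x else 0)"
    by (auto simp: indicator_def)
  ultimately have m: "f \<in> borel_measurable halfline"
    using borel_measurable_if[of "{0<..} :: real set" f] by simp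
  obtain f0 where f0: "f0 \<in> borel_measurable borel" "\<And>x. x \<le> 0 \<Longrightarrow> f0 x = 0" "ae_eq f f0"
    using borel_representative[OF m] by blast
  have "square_integrable lborel (cutoff b f0)" for b
  proof -
    have i: "integrable (lebesgue_on {0..b}) (\<lambda>x. (cmod (f x))\<^sup>2)"
      using assms by (simp add: L2_loc_def)
    then have "integrable lebesgue (\<lambda>x. indicator {0..b} x *\<^sub>R (cmod (f x))\<^sup>2)"
      by (subst (asm) integrable_restrict_space) (simp_all add: set_integrable_def)
    moreover have "AE x in lebesgue. indicator {0..b} x *\<^sub>R (cmod (f x))\<^sup>2 = (cmod (cutoff b f0 x))\<^sup>2"
      unfolding AE_completion_iff using f0(3)[unfolded ae_eq_iff] AE_lborel_singleton[of 0]
      by eventually_elim (use f0(2) in \<open>auto simp: indicator_def cutoff_def\<close>)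
    moreover have bm: "(\<lambda>x. (cmod (cutoff b f0 x))\<^sup>2) \<in> borel_measurable borel" using f0(1) by measurable
    moreover have "(\<lambda>x. (cmod (cutoff b f0 x))\<^sup>2) \<in> borel_measurable lebesgue"
      by (rule measurable_completion) (use bm in simp)
    ultimately have "integrable lebesgue (\<lambda>x. (cmod (cutoff b f0 x))\<^sup>2)"
      by (subst integrable_cong_AE[symmetric, OF borel_measurable_integrable]) assumption+
    then have "integrable lborel (\<lambda>x. (cmod (cutoff b f0 x))\<^sup>2)"
      using bm by (subst (asm) integrable_completion) simp_all
    then show ?thesis using f0(1) by (simp add: square_integrable_def)
  qed
  then show ?thesis using that f0 m by (auto simp: causal_def)
qed

text \<open>A zero of \<open>M\<close> at \<open>z\<close> would be isolated, and \<open>1 / (z M(z))\<close> would be unbounded near it, but a Laplace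
  integral that converges absolutely at a real point is bounded on the half plane to the right of it.\<close>

lemma M_nonzero:
  assumes M: "M \<in> HD" and a: "0 \<le> a"
    and l: "\<And>z. a < Re z \<Longrightarrow> has_laplace f z (1 / (z * M z))" and z: "a < z"
  shows "M (of_real z) \<noteq> 0"
proof
  assume zero: "M (of_real z) = 0"
  have hol: "M holomorphic_on Hr" and H2: "M \<notin> hardy_H2" using M by (auto simp: HD_def)
  have Hr: "open Hr" "connected Hr"
    unfolding Hr_def by (auto intro: open_halfspace_Re_gt convex_connected convex_halfspace_Re_gt)
  have "\<exists>\<beta>\<in>Hr. M \<beta> \<noteq> 0"
  proof (rule ccontr)
    assume "\<not> (\<exists>\<beta>\<in>Hr. M \<beta> \<noteq> 0)"
    then have "M w = 0" if "0 < Re w" for w using that by (auto simp: Hr_def)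
    then have "(\<integral>\<^sup>+ y. ennreal ((cmod (M (Complex x y)))\<^sup>2) \<partial>lborel) = 0" if "x \<in> {0<..}" for x
      using that by simp
    then have "(SUP x\<in>{0<..}. \<integral>\<^sup>+ y. ennreal ((cmod (M (Complex x y)))\<^sup>2) \<partial>lborel) = (SUP x\<in>{0::real<..}. 0)"
      by (intro SUP_cong) auto
    then have "(SUP x\<in>{0<..}. \<integral>\<^sup>+ y. ennreal ((cmod (M (Complex x y)))\<^sup>2) \<partial>lborel) = 0"
      by simp
    then show False using H2 hol by (simp add: hardy_H2_def)
  qed
  then obtain \<beta> where \<beta>: "\<beta> \<in> Hr" "M \<beta> \<noteq> 0" by blast
  have zH: "of_real z \<in> Hr" using z a by (simp add: Hr_def)
  obtain r where r: "0 < r" "ball (of_real z) r \<subseteq> Hr" "\<And>w. w \<in> ball (of_real z) r - {of_real z} \<Longrightarrow> M w \<noteq> 0"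
    using isolated_zeros[OF hol Hr zH zero \<beta>] by metis
  \<comment> \<open>any abscissa strictly between \<open>a\<close> and \<open>z\<close>: the Laplace integral at \<open>b\<close> dominates those to its right\<close>
  define b where "b = (a + z) / 2"
  have b: "a < b" "b < z" using z by (auto simp: b_def)
  define K where "K = (LINT x|halfline. cmod (f x * exp (- of_real b * of_real x)))"
  have bound: "cmod (1 / (w * M w)) \<le> K" if w: "b < Re w" for w
  proof -
    have li: "integrable halfline (\<lambda>x. f x * exp (- w * of_real x))" "(LINT x|halfline. f x * exp (- w * of_real x)) = 1 / (w * M w)"
      using l[of w] w b by (auto simp: has_laplace_def)
    have lb: "integrable halfline (\<lambda>x. f x * exp (- of_real b * of_real x))"
      using l[of "of_real b"] b by (auto simp: has_laplace_def)
    have "cmod (1 / (w * M w)) \<le> (LINT x|halfline. cmod (f x * exp (- w * of_real x)))"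
      unfolding li(2)[symmetric] by (rule integral_norm_bound)
    also have "\<dots> \<le> K"
      unfolding K_def
    proof (rule integral_mono_AE[OF integrable_norm[OF li(1)] integrable_norm[OF lb]])
      show "AE x in halfline. cmod (f x * exp (- w * of_real x)) \<le> cmod (f x * exp (- of_real b * of_real x))"
        unfolding AE_halfline using w
        by (intro AE_I2) (auto simp: norm_mult norm_exp_eq_Re intro!: mult_left_mono)
    qed
    finally show ?thesis .
  qed
  have cont: "isCont M (of_real z)"
    using holomorphic_on_imp_continuous_on[OF hol] zH Hr(1) by (simp add: continuous_on_eq_continuous_at)
  have "((\<lambda>w. K * cmod (w * M w)) \<longlongrightarrow> K * cmod (of_real z * M (of_real z))) (at (of_real z))"
    by (intro tendsto_intros cont[unfolded isCont_def])
  then have "((\<lambda>w. K * cmod (w * M w)) \<longlongrightarrow> 0) (at (of_real z))" by (simp add: zero)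
  then have "\<forall>\<^sub>F w in at (of_real z). K * cmod (w * M w) < 1" by (rule order_tendstoD(2)) simp
  moreover have "\<forall>\<^sub>F w in at (of_real z). w \<in> ball (of_real z) r - {of_real z}"
    unfolding eventually_at using r(1) by (intro exI[of _ r]) (auto simp: dist_commute)
  moreover have "\<forall>\<^sub>F w in at (of_real z). b < Re w"
  proof -
    have "((\<lambda>w. Re w) \<longlongrightarrow> Re (of_real z)) (at (of_real z))" by (intro tendsto_intros)
    then show ?thesis by (rule order_tendstoD(1)) (use b in simp)
  qed
  ultimately have "\<forall>\<^sub>F w in at (complex_of_real z). False"
  proof eventually_elim
    case (elim w)
    have nz: "w * M w \<noteq> 0" using r(3)[OF elim(2)] elim(3) b a by auto
    have "1 = cmod (1 / (w * M w)) * cmod (w * M w)" using nz by (simp add: norm_mult[symmetric] del: norm_divide)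
    also have "\<dots> \<le> K * cmod (w * M w)" by (intro mult_right_mono bound elim) simp
    finally show False using elim(1) by simp
  qed
  then show False by (simp add: trivial_limit_def[symmetric])
qed

text \<open>The Laplace transform of the imaginary part vanishes on the real axis.\<close>

lemma real_representative:
  assumes f: "f \<in> causal" and l: "\<And>z. a < z \<Longrightarrow> real_laplace f z (w z)" and w: "\<And>z. a < z \<Longrightarrow> w z \<in> \<real>"
  shows "AE x in lborel. f x \<in> \<real>"
proof -
  have [measurable]: "f \<in> borel_measurable borel" by (rule causalD[OF f])
  let ?g = "\<lambda>x. complex_of_real (Im (f x))"
  have gm: "?g \<in> borel_measurable borel" by measurable
  have g: "?g \<in> causal"
  proof -
    have "square_integrable lborel (cutoff b ?g)" for b
      by (rule square_integrable_dominated(1)[OF causalD(3)[OF f, of b]])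
        (use cutoff_measurable[OF gm] in \<open>auto simp: cutoff_def abs_Im_le_cmod\<close>)
    then show ?thesis using gm causalD(2)[OF f] by (auto simp: causal_def)
  qed
  have "AE x in lborel. ?g x = 0"
  proof (rule real_laplace_eq_0[OF g])
    fix z assume "a < z"
    then have i: "integrable lborel (\<lambda>x. f x * of_real (exp (- z * x)))" "(LBINT x. f x * of_real (exp (- z * x))) = w z"
      and wz: "w z \<in> \<real>" using l w by (auto simp: real_laplace_def)
    have eq: "Im (f x * of_real (exp (- z * x))) = Im (f x) * exp (- z * x)" for x
      by (simp only: Im_complex_of_real Re_complex_of_real times_complex.simps)
    have ii: "integrable lborel (\<lambda>x. Im (f x) * exp (- z * x))"
      using integrable_Im[OF i(1)] unfolding eq .
    have "(LBINT x. Im (f x) * exp (- z * x)) = Im (w z)"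
      using integral_Im[OF i(1)] unfolding eq i(2) .
    then have "(LBINT x. Im (f x) * exp (- z * x)) = 0" using wz by (simp add: complex_is_Real_iff)
    then show "real_laplace ?g z 0"
      unfolding real_laplace_def of_real_mult[symmetric]
      using ii by (simp only: integral_complex_of_real integrable_of_real of_real_0 simp_thms)
  qed
  then show ?thesis by eventually_elim (simp add: complex_is_Real_iff)
qed

lemma zero_generator:
  assumes "C0_semigroup T" shows "((\<lambda>x. 0), (\<lambda>x. 0)) \<in> generator T"
proof -
  interpret L2_semigroup T by unfold_locales (rule assms)
  have z: "(\<lambda>x. 0) \<in> L2" by (simp add: L2_def)
  have "L2_norm (\<lambda>x. (T t (\<lambda>x. 0) x - 0) / of_real t - 0) = 0" if t: "0 < t" for t
  proof -
    have Tz: "T t (\<lambda>x. 0) \<in> L2" using T_L2 z t by simp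
    have "ae_eq (T t (\<lambda>x. 0 * 0)) (\<lambda>x. 0 * T t (\<lambda>x. 0) x)" by (rule T_cmult) (use t z in auto)
    then have "ae_eq (\<lambda>x. of_real (1 / t) * T t (\<lambda>x. 0) x) (\<lambda>x. 0)"
      unfolding ae_eq_def by eventually_elim simp
    then have "L2_norm (\<lambda>x. of_real (1 / t) * T t (\<lambda>x. 0) x) = 0"
      using L2_norm_zero_iff[OF L2_cmult[OF Tz]] by blast
    then show ?thesis by simp
  qed
  then have "\<forall>\<^sub>F t in at_right 0. L2_norm (\<lambda>x. (T t (\<lambda>x. 0) x - 0) / of_real t - 0) = 0"
    unfolding eventually_at_right_field by (intro exI[of _ 1]) auto
  then have "((\<lambda>t. L2_norm (\<lambda>x. (T t (\<lambda>x. 0) x - 0) / of_real t - 0)) \<longlongrightarrow> 0) (at_right 0)"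
    by (rule tendsto_eventually)
  then show ?thesis using z by (simp add: generator_def)
qed

text \<open>The product of the transforms of \<open>q\<close> and \<open>d\<^sup>M\<close> is that of \<open>1 - e\<^bsup>-t\<^esup>\<close>. The graph of \<open>A\<^sub>M\<close> chooses its own \<open>q\<close>
  for each pair, which uniqueness of the Laplace transform identifies with a fixed one; the pair \<open>(0, 0)\<close>
  supplies it.\<close>

lemma is_exp_A_boundary_semigroup:
  assumes M: "M \<in> HD" and T: "is_exp_A M T" and a: "0 \<le> a"
    and l: "\<And>z. a < Re z \<Longrightarrow> has_laplace dM z (1 / (z * M z))"
    and D0: "D0 \<in> causal" "ae_eq dM D0" "dM \<in> borel_measurable halfline"
  shows "\<exists>q q0. boundary_semigroup T q q0 D0"
proof -
  have C0: "C0_semigroup T" and gen: "generator T = A_graph M" using T by (auto simp: is_exp_A_def)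
  obtain q where q: "q \<in> L2" "\<And>z. z \<in> Hr \<Longrightarrow> has_laplace q z (M z / (1 + z))"
    using zero_generator[OF C0] unfolding gen A_graph_def by blast
  obtain q0 where q0: "q0 \<in> causal" "square_integrable lborel q0" "ae_eq q q0" using L2_representative[OF q(1)] .
  have lrep: "real_laplace p0 z (M (of_real z) / (1 + of_real z))"
    if "0 < z" "p \<in> L2" "\<And>z. z \<in> Hr \<Longrightarrow> has_laplace p z (M z / (1 + z))" "p0 \<in> causal" "ae_eq p p0" for p p0 z
    by (rule has_laplace_real[OF that(3)[of "of_real z"] L2_measurable[OF that(2)] that(5)])
      (use that causalD(1,2)[OF that(4)] in \<open>auto simp: Hr_def\<close>)
  have lq: "real_laplace q0 z (M (of_real z) / (1 + of_real z))" if "0 < z" for z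
    by (rule lrep[OF that q q0(1,3)])
  have lD: "real_laplace D0 z (1 / (of_real z * M (of_real z)))" if "a < z" for z
    by (rule has_laplace_real[OF l[of "of_real z"] D0(3,2)]) (use that causalD(1,2)[OF D0(1)] in auto)
  have AEqD: "AE x in lborel. conv q0 D0 x = conv unit_step exp_step x"
  proof (rule real_laplace_unique)
    fix z assume z: "a < z"
    have "real_laplace (conv q0 D0) z (M (of_real z) / (1 + of_real z) * (1 / (of_real z * M (of_real z))))"
      by (rule real_laplace_conv[OF q0(1) D0(1) lq lD]) (use z a in auto)
    moreover have "M (of_real z) / (1 + of_real z) * (1 / (of_real z * M (of_real z))) = 1 / of_real z * (1 / (1 + of_real z))"
      using M_nonzero[OF M a l z] by simp
    ultimately show "real_laplace (conv q0 D0) z (1 / of_real z * (1 / (1 + of_real z)))" by simp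
    show "real_laplace (conv unit_step exp_step) z (1 / of_real z * (1 / (1 + of_real z)))"
      by (rule real_laplace_conv[OF unit_step_causal exp_step_causal real_laplace_unit_step real_laplace_exp_step])
        (use z a in auto)
  qed (use q0 D0 in auto)
  have qD: "conv q0 D0 = conv unit_step exp_step"
  proof
    fix t
    have "conv q0 D0 t - conv unit_step exp_step t = 0"
    proof (rule continuous_AE_eq_0[of _ "t + 1"])
      show "continuous_on UNIV (\<lambda>t. conv q0 D0 t - conv unit_step exp_step t)"
        by (intro continuous_on_diff conv_continuous q0 D0 unit_step_causal exp_step_causal)
      show "AE x in lborel. x < t + 1 \<longrightarrow> conv q0 D0 x - conv unit_step exp_step x = 0"
        using AEqD by eventually_elim simp
    qed simp
    then show "conv q0 D0 t = conv unit_step exp_step t" by simp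
  qed
  have uniq: "ae_eq p q" if p: "p \<in> L2" "\<And>z. z \<in> Hr \<Longrightarrow> has_laplace p z (M z / (1 + z))" for p
  proof -
    obtain p0 where p0: "p0 \<in> causal" "square_integrable lborel p0" "ae_eq p p0" using L2_representative[OF p(1)] .
    have "AE x in lborel. p0 x = q0 x"
      by (rule real_laplace_unique[OF p0(1) q0(1), of 0, OF lrep[OF _ p p0(1,3)] lq])
    then have "ae_eq p0 q0" unfolding ae_eq_iff by eventually_elim simp
    then show ?thesis using ae_eq_trans[OF p0(3)] ae_eq_sym[OF q0(3)] ae_eq_trans by blast
  qed
  have "boundary_semigroup T q q0 D0"
  proof
    show "(f, g) \<in> generator T \<longleftrightarrow> f \<in> L2 \<and> g \<in> L2 \<and>
      (\<exists>f'. f' \<in> L2 \<and> loc_abs_cont_deriv f f' \<and> pairing (\<lambda>x. f x - f' x) q = 0 \<and> ae_eq g (\<lambda>x. - f' x))" for f g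
    proof
      assume "(f, g) \<in> generator T"
      then obtain f' p where p: "p \<in> L2" "\<forall>z\<in>Hr. has_laplace p z (M z / (1 + z))"
        and f: "f \<in> L2" "f' \<in> L2" "loc_abs_cont_deriv f f'" "pairing (\<lambda>x. f x - f' x) p = 0"
        and g: "g \<in> L2" "ae_eq g (\<lambda>x. - f' x)"
        unfolding gen A_graph_def by blast
      have "pairing (\<lambda>x. f x - f' x) q = pairing (\<lambda>x. f x - f' x) p"
        by (rule pairing_cong)
          (use f p q(1) ae_eq_sym[OF uniq[OF p(1)]] in \<open>auto intro: L2_diff simp: ae_eq_def[of "\<lambda>x. f x - f' x"]\<close>)
      then show "f \<in> L2 \<and> g \<in> L2 \<and> (\<exists>f'. f' \<in> L2 \<and> loc_abs_cont_deriv f f' \<and> pairing (\<lambda>x. f x - f' x) q = 0 \<and> ae_eq g (\<lambda>x. - f' x))"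
        using f g by auto
    next
      assume "f \<in> L2 \<and> g \<in> L2 \<and> (\<exists>f'. f' \<in> L2 \<and> loc_abs_cont_deriv f f' \<and> pairing (\<lambda>x. f x - f' x) q = 0 \<and> ae_eq g (\<lambda>x. - f' x))"
      then show "(f, g) \<in> generator T" unfolding gen A_graph_def using q by blast
    qed
  qed (use C0 q q0 D0 qD in auto)
  then show ?thesis by blast
qed

section \<open>The cocycle\<close>

lemma reflected_family_ae_eq:
  assumes "ae_eq dM D0" "D0 \<in> causal"
  shows "ae_eq (reflected_family dM t) (\<lambda>x. D0 (t - x))"
proof -
  have "AE x in lborel. 0 < t + (-1) * x \<longrightarrow> dM (t + (-1) * x) = D0 (t + (-1) * x)"
    by (rule AE_lborel_affine[OF assms(1)[unfolded ae_eq_iff]]) simp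
  then show ?thesis unfolding ae_eq_iff using AE_lborel_singleton[of t]
    by eventually_elim (use causalD(2)[OF assms(2)] in \<open>auto simp: reflected_family_def indicator_def\<close>)
qed

theorem lemma5p5:
  fixes M :: "complex \<Rightarrow> complex"
    and T :: "real \<Rightarrow> (real \<Rightarrow> complex) \<Rightarrow> (real \<Rightarrow> complex)"
    and dM :: "real \<Rightarrow> complex"
  assumes "M \<in> HD2_real"
    and "is_exp_A M T"
    and "dM \<in> L2_loc"
    and "\<exists>a\<ge>0. \<forall>z. Re z > a \<longrightarrow> has_laplace dM z (1 / (z * M z))"
  shows "imaginary_additive_cocycle T (reflected_family dM) \<and>
    (\<forall>d. imaginary_additive_cocycle T d \<longrightarrow>
      (\<exists>c::real. \<forall>t>0. ae_eq (d t) (\<lambda>x. of_real c * reflected_family dM t x)))"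
proof -
  obtain a where a: "0 \<le> a" "\<And>z. a < Re z \<Longrightarrow> has_laplace dM z (1 / (z * M z))" using assms(4) by blast
  have M: "M \<in> HD" and Mreal: "\<And>z. z \<in> Hr \<Longrightarrow> cnj (M z) = M (cnj z)"
    using assms(1) by (auto simp: HD2_real_def HD2_def)
  obtain D where Dc: "D \<in> causal" "ae_eq dM D" "dM \<in> borel_measurable halfline"
    using L2_loc_representative[OF assms(3)] .
  obtain q q0 where bs: "boundary_semigroup T q q0 D"
    using is_exp_A_boundary_semigroup[OF M assms(2) a(1,2) Dc] by blast
  interpret boundary_semigroup T q q0 D by (rule bs)
  let ?r = "reflected_family dM"
  have r: "ae_eq (?r t) (\<lambda>x. D (t - x))" for t by (rule reflected_family_ae_eq[OF Dc(2,1)])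
  have DL: "(\<lambda>x. D (t - x)) \<in> L2" for t by (rule reflect_L2(1)[OF Dc(1)])
  have rm: "?r t \<in> borel_measurable halfline" for t
    by (rule measurable_halfline_AE[OF _ ae_eq_sym[OF r]]) (rule L2_measurable[OF DL])
  have rL: "?r t \<in> L2" for t
    using square_integrable_cong_AE[OF DL[of t, unfolded L2_iff] rm[of t]] ae_eq_sym[OF r[of t]] by (simp add: L2_iff ae_eq_def)
  have Dreal: "AE x in lborel. D x \<in> \<real>"
  proof (rule real_representative[OF Dc(1), of a])
    fix z assume z: "a < z"
    show "real_laplace D z (1 / (of_real z * M (of_real z)))"
      by (rule has_laplace_real[OF a(2)[of "of_real z"] Dc(3,2)]) (use z causalD(1,2)[OF Dc(1)] in auto)
    have "M (of_real z) \<in> \<real>" using Mreal[of "of_real z"] z a(1) by (simp add: Hr_def Reals_cnj_iff)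
    then show "1 / (of_real z * M (of_real z)) \<in> \<real>" by (intro Reals_divide Reals_mult) auto
  qed
  have rreal: "AE x in halfline. ?r t x \<in> \<real>" for t
  proof -
    have "AE x in lborel. D (t + (-1) * x) \<in> \<real>" by (rule AE_lborel_affine[OF Dreal]) simp
    then show ?thesis unfolding AE_halfline using r[of t, unfolded ae_eq_iff] by eventually_elim auto
  qed
  have "imaginary_additive_cocycle T ?r"
    unfolding imaginary_additive_cocycle_def
  proof (intro conjI allI impI)
    fix U assume U: "L2_open U"
    have "open {t \<in> {0<..}. ?r t \<in> U}"
      unfolding open_dist
    proof
      fix t0 assume t0: "t0 \<in> {t \<in> {0<..}. ?r t \<in> U}"
      then obtain e where e: "0 < e" "\<And>g. g \<in> L2 \<Longrightarrow> L2_norm (\<lambda>x. g x - ?r t0 x) < e \<Longrightarrow> g \<in> U"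
        using U unfolding L2_open_def by blast
      obtain d where d: "0 < d" "\<And>t. \<bar>t - t0\<bar> < d \<Longrightarrow> L2_norm (\<lambda>x. D (t - x) - D (t0 - x)) < e"
        using reflect_continuous[OF Dc(1) e(1)] by blast
      have "?r t \<in> U" if "\<bar>t - t0\<bar> < d" for t
      proof (rule e(2)[OF rL])
        have "L2_norm (\<lambda>x. ?r t x - ?r t0 x) = L2_norm (\<lambda>x. D (t - x) - D (t0 - x))"
        proof (rule L2_norm_cong)
          show "ae_eq (\<lambda>x. ?r t x - ?r t0 x) (\<lambda>x. D (t - x) - D (t0 - x))"
            using r[of t] r[of t0] unfolding ae_eq_def by eventually_elim simp
        qed (intro L2_diff rL DL)+
        then show "L2_norm (\<lambda>x. ?r t x - ?r t0 x) < e" using d(2)[OF that] by simp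
      qed
      then show "\<exists>e>0. \<forall>t. dist t t0 < e \<longrightarrow> t \<in> {t \<in> {0<..}. ?r t \<in> U}"
        using t0 d(1) by (intro exI[of _ "min d t0"]) (auto simp: dist_real_def)
    qed
    then show "{t \<in> {0<..}. ?r t \<in> U} \<in> sets borel" by (rule borel_open)
  next
    fix t :: real assume "0 < t"
    have "AE x in halfline. t \<le> x \<longrightarrow> ?r t x = 0"
      unfolding AE_halfline using AE_lborel_singleton[of t]
      by eventually_elim (auto simp: reflected_family_def indicator_def)
    then show "?r t \<in> L2_real_upto t" using rL rreal by (simp add: L2_real_upto_def L2_real_def)
  next
    fix s t :: real assume st: "0 < s" "0 < t"
    have "ae_eq (T s (?r t)) (T s (\<lambda>x. D (t - x)))"
      by (rule T_cong[OF less_imp_le[OF st(1)] rL DL r])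
    then show "ae_eq (?r (s + t)) (\<lambda>x. ?r s x + T s (?r t) x)"
      using T_reflect_D[OF st] r[of "s + t"] r[of s] unfolding ae_eq_def by eventually_elim simp
  qed
  moreover have "\<exists>c::real. \<forall>t>0. ae_eq (d t) (\<lambda>x. of_real c * ?r t x)" if d: "imaginary_additive_cocycle T d" for d
  proof -
    have dt: "d t \<in> L2" "AE x in halfline. d t x \<in> \<real>" "AE x in halfline. t \<le> x \<longrightarrow> d t x = 0" if "0 < t" for t
      using d that by (auto simp: imaginary_additive_cocycle_def L2_real_upto_def L2_real_def)
    have "\<exists>c. \<forall>t>0. ae_eq (d t) (\<lambda>x. c * D (t - x))"
    proof (rule cocycle_unique)
      fix t :: real assume t: "0 < t"
      show "d t \<in> L2" by (rule dt[OF t])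
      show "AE x in lborel. t \<le> x \<longrightarrow> d t x = 0"
        using dt(3)[OF t] unfolding AE_halfline by eventually_elim (use t in auto)
    next
      fix s t :: real assume "0 < s" "0 < t"
      then show "ae_eq (d (s + t)) (\<lambda>x. d s x + T s (d t) x)"
        using d by (simp add: imaginary_additive_cocycle_def)
    qed
    then obtain c where c: "\<And>t. 0 < t \<Longrightarrow> ae_eq (d t) (\<lambda>x. c * D (t - x))" by blast
    \<comment> \<open>both families are real, so the factor may be replaced by its real part\<close>
    have "ae_eq (d t) (\<lambda>x. of_real (Re c) * ?r t x)" if t: "0 < t" for t
      using c[OF t] r[of t] dt(2)[OF t] rreal[of t] unfolding ae_eq_def
    proof eventually_elim
      case (elim x)
      then have "Re (d t x) = Re (c * ?r t x)" by simp
      then show ?case using elim by (auto simp: complex_eq_iff complex_is_Real_iff)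
    qed
    then show ?thesis by blast
  qed
  ultimately show ?thesis by blast
qed

end
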